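(* Fix an integer $p\ge1$ and a small $\tau>0$ (with $\tau<T$), and let $s_t:\mathbb R^d\to\mathbb R^d$, $0\le t\le T-\tau$, satisfy for some $L\ge1$ (which may depend on $p$ and $\tau$): for all $0\le t\le T-\tau$, $\|s_t(x)\|_2\le L(\sqrt d+\|x\|_2)$ for all $x$, $s_t(x)$ is $C^{p+1}$ (in $(t,x)$), and $$\sup_{x\in\mathbb R^d}\max_{1\le k+|\alpha|\le p+1}\max_{1\le j\le d}|\partial_t^k\partial_x^\alpha s_t^{(j)}(x)|\le L .$$ Let $\widehat V_t(x)=x+s_t(x)$, let an explicit $s$-stage $p$-th order Runge–Kutta method with coefficients $(a_{jk}),(b_j),(c_j)$ be given, put $B:=1+\max_{1\le i<j\le s}|a_{ji}|+\max_{1\le j\le s}|b_j|$, let $[t_i,t_{i+1}]\subset[0,T-\tau]$ be a time step with $t_{i+1}-t_i=h>0$, and let $F_r$ and $\widetilde Y_t$ be the one-step maps and the interpolation defined in the context. There exists a large constant $C(p,s,B)$, depending only on $p,s,B$, such that if $8sBhdL\le1$, then the following holds. For every $0\le r\le h$ the map $F_r$ is a diffeomorphism from $\mathbb R^d$ to $\mathbb R^d$. Denote its inverse by $F_r^{-1}$ and let $$\widetilde V_{t_i+r}(x)=(\partial_rF_r)(F_r^{-1}(x)),\qquad 0\le r\le h .$$ Then for $t_i\le t\le t_{i+1}$ one has $\partial_t\widetilde Y_t=\widetilde V_t(\widetilde Y_t)$, and for all $x\in\mathbb R^d$, $$\|\widetilde V_t(x)-\widehat V_t(x)\|_\infty,\quad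 \|\nabla(\widetilde V_t(x)-\widehat V_t(x))\|_\infty\ \le\ C(p,s,B)\,L\big((\sqrt d+\|x\|_2)\sqrt d\,hL\big)^p .$$
   Context: One-step maps: for $0\le r\le h$ and $x\in\mathbb R^d$, $$F_r(x)=x+r\sum_{j=1}^sb_jk_j(x),\qquad k_j(x)=\widehat V_{t_i+rc_j}\Big(x+r\sum_{l=1}^{j-1}a_{jl}k_l(x)\Big),\quad 1\le j\le s$$ (the $k_j$ depend on $r$). The interpolated Runge–Kutta process on $[t_i,t_{i+1}]$ is $\widetilde Y_{t_i+r}=F_r(\widetilde Y_{t_i})$, where $\widetilde Y_{t_i}$ is the value at time $t_i$. The method is of order $p$: its coefficients are chosen so that $F_r(x)$ and the exact flow $\Phi_r(x)$ of the ODE ($\Phi_0(x)=x$, $\partial_r\Phi_r(x)=\widehat V_{t_i+r}(\Phi_r(x))$) have equal $r$-derivatives at $r=0$ up to order $p$ (local truncation error $O(h^{p+1})$). Norms: $\|\cdot\|_\infty$ of a vector or matrix is the maximum absolute value of its entries; $\|\cdot\|_2$ is the Euclidean norm; $\nabla$ is the Jacobian in $x$. Multi-indices: $|\alpha|=\sum_i\alpha_i$, $\partial_x^\alpha=\partial_{x_1}^{\alpha_1}\cdots\partial_{x_d}^{\alpha_d}$.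
   Formalization: The nodes are assumed to satisfy 0 ≤ c_j ≤ 1; without a restriction on c_j the stages may leave [0,T−τ], and the bound with a constant depending only on p, s, B fails (for example p=s=1, b_1=1, c_1 of order 1/h). *)

theory Defs
  imports "HOL-Analysis.Analysis" "HOL-Analysis.Finite_Function_Topology"
begin

text \<open>
  The constant in the theorem has to be uniform in the dimension, so the dimension must be a
  term variable and not a type. The space \<open>\<real>\<^sup>d\<close> is therefore the subspace
  \<^term>\<open>Rn d\<close> of the finitely supported sequences. The library norm on that type is the sum of
  the absolute values of the entries; on \<open>Rn d\<close> it induces the usual topology and the usual notion
  of differentiability, and only these are taken from it. The Euclidean and maximum norms are
  \<open>norm2\<close> and \<open>norm_inf\<close> below. Coordinates are numbered from \<open>0\<close> to \<open>d - 1\<close>, Runge--Kutta stages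
  from \<open>1\<close> to \<open>s\<close>.
\<close>

type_synonym rvec = "nat \<Rightarrow>\<^sub>0 real"

abbreviation coord :: "rvec \<Rightarrow> nat \<Rightarrow> real" where
  "coord \<equiv> Poly_Mapping.lookup"

definition Rn :: "nat \<Rightarrow> rvec set" where
  "Rn d = {x. Poly_Mapping.keys x \<subseteq> {..<d}}"

definition unit_vec :: "nat \<Rightarrow> rvec" where
  "unit_vec j = Poly_Mapping.single j 1"

definition norm2 :: "nat \<Rightarrow> rvec \<Rightarrow> real" where
  "norm2 d x = L2_set (coord x) {..<d}"

definition norm_inf :: "nat \<Rightarrow> rvec \<Rightarrow> real" where
  "norm_inf d x = Max ((\<lambda>i. \<bar>coord x i\<bar>) ` {..<d})"

definition partial_x :: "nat \<Rightarrow> (rvec \<Rightarrow> 'a::real_normed_vector) \<Rightarrow> rvec \<Rightarrow> 'a" where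
  "partial_x j f x = vector_derivative (\<lambda>u. f (x + u *\<^sub>R unit_vec j)) (at 0)"

definition jacobian_norm_inf :: "nat \<Rightarrow> (rvec \<Rightarrow> rvec) \<Rightarrow> rvec \<Rightarrow> real" where
  "jacobian_norm_inf d f x =
     Max ((\<lambda>(i, j). \<bar>partial_x j (\<lambda>y. coord (f y) i) x\<bar>) ` ({..<d} \<times> {..<d}))"

text \<open>Time derivatives are taken within the time interval, hence one-sided at its end points.\<close>

definition partial_t :: "real set \<Rightarrow> (real \<Rightarrow> rvec \<Rightarrow> 'a::real_normed_vector) \<Rightarrow> real \<Rightarrow> rvec \<Rightarrow> 'a" where
  "partial_t I g = (\<lambda>t x. vector_derivative (\<lambda>u. g u x) (at t within I))"

definition partial_alpha ::
    "nat \<Rightarrow> (nat \<Rightarrow> nat) \<Rightarrow> (rvec \<Rightarrow> 'a::real_normed_vector) \<Rightarrow> rvec \<Rightarrow> 'a" where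
  "partial_alpha d \<alpha> f = foldr (\<lambda>i. partial_x i ^^ \<alpha> i) [0..<d] f"

definition partial_t_alpha ::
    "real set \<Rightarrow> nat \<Rightarrow> nat \<Rightarrow> (nat \<Rightarrow> nat) \<Rightarrow> (real \<Rightarrow> rvec \<Rightarrow> 'a::real_normed_vector) \<Rightarrow> real \<Rightarrow> rvec \<Rightarrow> 'a" where
  "partial_t_alpha I d k \<alpha> g = (partial_t I ^^ k) (\<lambda>t. partial_alpha d \<alpha> (g t))"

text \<open>\<open>Ck_on I d m g\<close>: the function \<open>g\<close> is of class \<open>C\<^sup>m\<close> jointly in \<open>(t, x) \<in> I \<times> \<real>\<^sup>d\<close>, that is,
  all iterated partial derivatives of order at most \<open>m\<close> exist and are jointly continuous.\<close>

primrec Ck_on :: "real set \<Rightarrow> nat \<Rightarrow> nat \<Rightarrow> (real \<Rightarrow> rvec \<Rightarrow> 'a::real_normed_vector) \<Rightarrow> bool" where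
  "Ck_on I d 0 g \<longleftrightarrow> continuous_on (I \<times> Rn d) (\<lambda>(t, x). g t x)"
| "Ck_on I d (Suc m) g \<longleftrightarrow>
     continuous_on (I \<times> Rn d) (\<lambda>(t, x). g t x) \<and>
     (\<forall>t\<in>I. \<forall>x\<in>Rn d. (\<lambda>u. g u x) differentiable (at t within I)) \<and>
     Ck_on I d m (partial_t I g) \<and>
     (\<forall>j<d. (\<forall>t\<in>I. \<forall>x\<in>Rn d. (\<lambda>u. g t (x + u *\<^sub>R unit_vec j)) differentiable (at 0)) \<and>
            Ck_on I d m (\<lambda>t. partial_x j (g t)))"

definition C1_map :: "nat \<Rightarrow> (rvec \<Rightarrow> rvec) \<Rightarrow> bool" where
  "C1_map d f \<longleftrightarrow> f differentiable_on Rn d \<and> (\<forall>j<d. continuous_on (Rn d) (partial_x j f))"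

definition diffeomorphism :: "nat \<Rightarrow> (rvec \<Rightarrow> rvec) \<Rightarrow> bool" where
  "diffeomorphism d f \<longleftrightarrow>
     bij_betw f (Rn d) (Rn d) \<and> C1_map d f \<and> C1_map d (inv_into (Rn d) f)"

function rk_stage ::
    "(real \<Rightarrow> rvec \<Rightarrow> rvec) \<Rightarrow> (nat \<Rightarrow> nat \<Rightarrow> real) \<Rightarrow> (nat \<Rightarrow> real) \<Rightarrow> real \<Rightarrow> real \<Rightarrow> rvec \<Rightarrow> nat \<Rightarrow> rvec" where
  "rk_stage V a c t0 r x j =
     V (t0 + r * c j) (x + r *\<^sub>R (\<Sum>l\<in>{1..<j}. a j l *\<^sub>R rk_stage V a c t0 r x l))"
  by pat_completeness auto
termination
  by (relation "Wellfounded.measure (\<lambda>(V, a, c, t0, r, x, j). j)") auto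

declare rk_stage.simps [simp del]

definition rk_map ::
    "(real \<Rightarrow> rvec \<Rightarrow> rvec) \<Rightarrow> nat \<Rightarrow> (nat \<Rightarrow> nat \<Rightarrow> real) \<Rightarrow> (nat \<Rightarrow> real) \<Rightarrow> (nat \<Rightarrow> real) \<Rightarrow>
     real \<Rightarrow> real \<Rightarrow> rvec \<Rightarrow> rvec" where
  "rk_map V s a b c t0 r x = x + r *\<^sub>R (\<Sum>j\<in>{1..s}. b j *\<^sub>R rk_stage V a c t0 r x j)"

definition nth_deriv :: "real set \<Rightarrow> nat \<Rightarrow> (real \<Rightarrow> rvec) \<Rightarrow> real \<Rightarrow> rvec" where
  "nth_deriv I k f = ((\<lambda>g t. vector_derivative g (at t within I)) ^^ k) f"

text \<open>
  Order \<open>p\<close> is a property of the coefficients: for every dimension and every \<open>C\<^sup>p\<^sup>+\<^sup>1\<close>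
  time-dependent vector field, the one-step map and the exact solution \<open>\<Phi>\<close> started at the same
  point have the same derivatives in \<open>r\<close> at \<open>r = 0\<close> up to order \<open>p\<close>.
\<close>

definition rk_order ::
    "nat \<Rightarrow> nat \<Rightarrow> (nat \<Rightarrow> nat \<Rightarrow> real) \<Rightarrow> (nat \<Rightarrow> real) \<Rightarrow> (nat \<Rightarrow> real) \<Rightarrow> bool" where
  "rk_order p s a b c \<longleftrightarrow>
     (\<forall>d t0 h V x \<Phi>.
        d \<ge> 1 \<longrightarrow> h > 0 \<longrightarrow>
        (\<forall>t\<in>{t0..t0 + h}. \<forall>y\<in>Rn d. V t y \<in> Rn d) \<longrightarrow>
        Ck_on {t0..t0 + h} d (p + 1) V \<longrightarrow>
        x \<in> Rn d \<longrightarrow> \<Phi> 0 = x \<longrightarrow>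
        (\<forall>r\<in>{0..h}. \<Phi> r \<in> Rn d \<and>
           (\<Phi> has_vector_derivative V (t0 + r) (\<Phi> r)) (at r within {0..h})) \<longrightarrow>
        (\<forall>k\<le>p. nth_deriv {0..h} k (\<lambda>r. rk_map V s a b c t0 r x) 0 = nth_deriv {0..h} k \<Phi> 0))"

text \<open>The \<open>insert 0\<close> fixes the empty maximum to be \<open>0\<close> when \<open>s = 1\<close>.\<close>

definition rk_B :: "nat \<Rightarrow> (nat \<Rightarrow> nat \<Rightarrow> real) \<Rightarrow> (nat \<Rightarrow> real) \<Rightarrow> real" where
  "rk_B s a b =
     1 + Max (insert 0 {\<bar>a j i\<bar> | i j. 1 \<le> i \<and> i < j \<and> j \<le> s}) + Max ((\<lambda>j. \<bar>b j\<bar>) ` {1..s})"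

text \<open>\<open>rk_velocity\<close> is the field \<open>(\<partial>\<^sub>rF\<^sub>r)(F\<^sub>r\<^sup>-\<^sup>1(x))\<close> at time \<open>t = t0 + r\<close>; the derivative in \<open>r\<close> is
  taken within \<open>[0, h]\<close>.\<close>

definition rk_velocity ::
    "(real \<Rightarrow> rvec \<Rightarrow> rvec) \<Rightarrow> nat \<Rightarrow> (nat \<Rightarrow> nat \<Rightarrow> real) \<Rightarrow> (nat \<Rightarrow> real) \<Rightarrow> (nat \<Rightarrow> real) \<Rightarrow>
     nat \<Rightarrow> real \<Rightarrow> real \<Rightarrow> real \<Rightarrow> rvec \<Rightarrow> rvec" where
  "rk_velocity V s a b c d t0 h t x =
     vector_derivative
       (\<lambda>\<rho>. rk_map V s a b c t0 \<rho> (inv_into (Rn d) (rk_map V s a b c t0 (t - t0)) x))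
       (at (t - t0) within {0..h})"

end

theory Submission
  imports Defs "HOL-Probability.Discrete_Topology"
begin

text \<open>
  Append the step itself to the tableau as a stage \<open>s + 1\<close>. The defect
  \<open>f(r, x) = \<partial>\<^sub>rF\<^sub>r(x) - V(t\<^sub>0 + r, F\<^sub>r(x)) = \<Sum>\<^sub>j b\<^sub>j (k\<^sub>j + r \<partial>\<^sub>rk\<^sub>j) - k\<^sub>s\<^sub>+\<^sub>1\<close>
  is \<open>o(r\<^sup>p\<^sup>-\<^sup>1)\<close> for every \<open>x\<close>, because \<open>F\<close> and the exact flow agree to order \<open>p\<close>. So its Taylor coefficients
  in \<open>r\<close> below order \<open>p\<close> vanish identically in \<open>x\<close>, and with them those of \<open>\<partial>\<^sub>xf\<close>. What remains are Taylor
  remainders. Since \<open>r \<partial>\<^sub>rk\<^sub>j\<close> needs the expansion of \<open>\<partial>\<^sub>rk\<^sub>j\<close> only to order \<open>p - 1\<close>, the remainder of \<open>\<partial>\<^sub>xf\<close> involves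
  no more than \<open>\<partial>\<^sub>r\<^sup>p\<partial>\<^sub>xk\<^sub>j\<close>, hence \<open>p + 1\<close> derivatives of \<open>V\<close>. By induction over the stages each derivative in \<open>r\<close> costs
  a factor \<open>M(x) = L\<surd>d(\<surd>d + |x|\<^sub>2)\<close> in the maximum norm, which gives \<open>|f|, |\<partial>\<^sub>xf| \<le> C L (r M(x))\<^sup>p\<close>. Finally
  \<open>F\<^sub>r\<close> is the identity plus a map that contracts the \<open>l\<^sup>1\<close> norm by \<open>1/2\<close>, so it is a diffeomorphism whose inverse has
  derivative at most \<open>2\<close>, and the difference of the two fields is \<open>f(r, F\<^sub>r\<^sup>-\<^sup>1(x))\<close>.
\<close>

section \<open>Coordinates and partial derivatives\<close>

text \<open>Three difficulties shape the proof. First, the order condition compares with an exact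
  solution only if one is given. A solution on the step is therefore constructed; it is used
  qualitatively, through its derivatives at \<open>r = 0\<close>, and none of its bounds enters the
  final constant. Second, the constant must not see \<open>d\<close>. Products pair a maximum norm
  with an \<open>l^1\<close> norm, and the factor \<open>d\<close> lost in passing from the first
  norm to the second is only affordable next to a factor \<open>L\<close>: it becomes part of one
  \<open>M\<close>, or is cancelled by \<open>h\<close>, since \<open>h * d * L\<close> is at most
  \<open>1\<close>. Third, \<open>V\<close> has no derivative to spare. The derivative in
  \<open>x\<close> of a stage velocity is never estimated as such; it is obtained from the time
  derivative of the tangent stage by exchanging the two derivatives. The \<open>8\<close> of the
  step condition is \<open>4 * 2\<close>: stages may grow by a factor \<open>2\<close> over the
  linear bound \<open>2 * L\<close> of the field, and a step may displace a point by at most half of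
  \<open>sqrt d + norm2 d x\<close>. In the locales \<open>n\<close> stands for
  \<open>p - 1\<close>.\<close>

abbreviation has_partial :: "nat \<Rightarrow> (rvec \<Rightarrow> 'a::real_normed_vector) \<Rightarrow> rvec \<Rightarrow> 'a \<Rightarrow> bool" where
  "has_partial q f x D \<equiv> ((\<lambda>\<xi>. f (x + \<xi> *\<^sub>R unit_vec q)) has_vector_derivative D) (at 0)"

lemma coord_scaleR [simp]: "coord (c *\<^sub>R x) i = c * coord x i"
proof -
  have "finite {i. c *\<^sub>R coord x i \<noteq> 0}"
    by (rule finite_subset[OF _ finite_lookup[of x]]) auto
  then show ?thesis
    by (simp add: scaleR_poly_mapping_def Abs_poly_mapping_inverse)
qed

lemma coord_add [simp]: "coord (x + y) i = coord x i + coord y i"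
  by (rule lookup_add)

lemma coord_diff [simp]: "coord (x - y) i = coord x i - coord y i"
  by (rule lookup_minus)

lemma coord_sum [simp]: "coord (\<Sum>l\<in>S. f l) i = (\<Sum>l\<in>S. coord (f l) i)"
  by (rule lookup_sum)

lemma coord_unit_vec: "coord (unit_vec j) i = (if i = j then 1 else 0)"
  by (auto simp: unit_vec_def lookup_single)

lemma Rn_iff: "x \<in> Rn d \<longleftrightarrow> (\<forall>i\<ge>d. coord x i = 0)"
proof -
  have "x \<in> Rn d \<longleftrightarrow> (\<forall>i. coord x i \<noteq> 0 \<longrightarrow> i < d)"
    by (auto simp: Rn_def in_keys_iff)
  then show ?thesis by (metis not_le)
qed

lemma Rn_eqI: "x \<in> Rn d \<Longrightarrow> y \<in> Rn d \<Longrightarrow> (\<And>i. i < d \<Longrightarrow> coord x i = coord y i) \<Longrightarrow> x = y"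
  by (rule poly_mapping_eqI) (metis Rn_iff leI)

lemma Rn_0 [simp]: "0 \<in> Rn d"
  and Rn_add [simp]: "x \<in> Rn d \<Longrightarrow> y \<in> Rn d \<Longrightarrow> x + y \<in> Rn d"
  and Rn_diff [simp]: "x \<in> Rn d \<Longrightarrow> y \<in> Rn d \<Longrightarrow> x - y \<in> Rn d"
  and Rn_scaleR [simp]: "x \<in> Rn d \<Longrightarrow> c *\<^sub>R x \<in> Rn d"
  and Rn_sum [simp]: "(\<And>l. l \<in> S \<Longrightarrow> f l \<in> Rn d) \<Longrightarrow> (\<Sum>l\<in>S. f l) \<in> Rn d"
  and Rn_unit_vec [simp]: "j < d \<Longrightarrow> unit_vec j \<in> Rn d"
  by (auto simp: Rn_iff coord_unit_vec)

lemma Rn_expand: "x \<in> Rn d \<Longrightarrow> x = (\<Sum>i<d. coord x i *\<^sub>R unit_vec i)"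
proof (rule Rn_eqI[of _ d])
  show "(\<Sum>i<d. coord x i *\<^sub>R unit_vec i) \<in> Rn d"
    by (intro Rn_sum Rn_scaleR Rn_unit_vec) simp
qed (auto simp: coord_unit_vec if_distrib sum.delta cong: if_cong)

lemma norm_Rn:
  assumes "x \<in> Rn d"
  shows "norm x = (\<Sum>i<d. \<bar>coord x i\<bar>)"
proof -
  have "norm x = (\<Sum>i\<in>Poly_Mapping.keys x. \<bar>coord x i\<bar>)"
    by (simp add: norm_poly_mapping_def dist_poly_mapping_def)
  also have "\<dots> = (\<Sum>i<d. \<bar>coord x i\<bar>)"
    using assms by (intro sum.mono_neutral_left) (auto simp: Rn_def in_keys_iff)
  finally show ?thesis .
qed

lemma abs_coord_le_norm: "\<bar>coord x i\<bar> \<le> norm x"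
proof (cases "i \<in> Poly_Mapping.keys x")
  case True
  then have "\<bar>coord x i\<bar> \<le> (\<Sum>i\<in>Poly_Mapping.keys x. \<bar>coord x i\<bar>)"
    by (intro member_le_sum) auto
  then show ?thesis by (simp add: norm_poly_mapping_def dist_poly_mapping_def)
qed (simp add: in_keys_iff)

lemma sum_abs_coord_le_norm: "(\<Sum>q<d. \<bar>coord x q\<bar>) \<le> norm x"
proof -
  have "(\<Sum>q<d. \<bar>coord x q\<bar>) = (\<Sum>q\<in>{..<d} \<inter> Poly_Mapping.keys x. \<bar>coord x q\<bar>)"
    by (intro sum.mono_neutral_right) (auto simp: in_keys_iff)
  also have "\<dots> \<le> (\<Sum>q\<in>Poly_Mapping.keys x. \<bar>coord x q\<bar>)"
    by (intro sum_mono2) auto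
  also have "\<dots> = norm x" by (simp add: norm_poly_mapping_def dist_poly_mapping_def)
  finally show ?thesis .
qed

lemma norm_unit_vec [simp]: "norm (unit_vec j) = 1"
  using norm_Rn[of "unit_vec j" "Suc j"] by (simp add: coord_unit_vec)

lemma bounded_linear_coord: "bounded_linear (\<lambda>x. coord x i)"
  by (rule bounded_linear_intro[where K=1]) (auto simp: abs_coord_le_norm)

lemmas continuous_on_coord [continuous_intros] = bounded_linear.continuous_on[OF bounded_linear_coord]

lemma has_vector_derivative_coord:
  "(f has_vector_derivative f') F \<Longrightarrow> ((\<lambda>u. coord (f u) i) has_vector_derivative coord f' i) F"
  by (rule bounded_linear.has_vector_derivative[OF bounded_linear_coord])

lemma convex_Rn: "convex (Rn d)"
  by (auto simp: convex_def)

text \<open>The surrounding space of finitely supported sequences is incomplete in the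
  \<open>l^1\<close> norm, so Banach's fixed point theorem has to be applied on the subspace, where
  finitely many coordinate limits determine the limit.\<close>

lemma complete_Rn: "complete (Rn d)"
proof (rule completeI)
  fix f :: "nat \<Rightarrow> rvec"
  assume f: "\<forall>n. f n \<in> Rn d" and C: "Cauchy f"
  define l where "l i = lim (\<lambda>n. coord (f n) i)" for i
  have l: "(\<lambda>n. coord (f n) i) \<longlonglongrightarrow> l i" for i
    using bounded_linear.Cauchy[OF bounded_linear_coord C, of i]
    by (simp add: l_def Cauchy_convergent_iff convergent_LIMSEQ_iff)
  have "(\<lambda>n. \<Sum>i<d. coord (f n) i *\<^sub>R unit_vec i) \<longlonglongrightarrow> (\<Sum>i<d. l i *\<^sub>R unit_vec i)"
    by (intro tendsto_intros l)
  then have "f \<longlonglongrightarrow> (\<Sum>i<d. l i *\<^sub>R unit_vec i)"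
    using f Rn_expand[symmetric, of "f n" d for n] by simp
  then show "\<exists>l\<in>Rn d. f \<longlonglongrightarrow> l" by (intro bexI) (auto intro!: Rn_sum Rn_scaleR Rn_unit_vec)
qed

lemma vector_derivative_within_Icc:
  fixes f :: "real \<Rightarrow> 'a::real_normed_vector"
  assumes "a < b" "t \<in> {a..b}" "(f has_vector_derivative f') (at t within {a..b})"
  shows "vector_derivative f (at t within {a..b}) = f'"
  using vector_derivative_within_cbox[of a b t f f'] assms by simp

lemma has_vector_derivative_unique_Icc:
  fixes f :: "real \<Rightarrow> 'a::real_normed_vector"
  assumes "a < b" "t \<in> {a..b}" "(f has_vector_derivative f') (at t within {a..b})"
    "(f has_vector_derivative f'') (at t within {a..b})"
  shows "f' = f''"
  using vector_derivative_within_Icc[OF assms(1,2)] assms(3,4) by metis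

text \<open>Partial derivatives are given at parameter \<open>0\<close> only. Moving the base point
  along the line gives them at every parameter, as mean value and exchange arguments
  require.\<close>

lemma has_vector_derivative_shift_line:
  fixes f :: "rvec \<Rightarrow> 'a::real_normed_vector"
  assumes "((\<lambda>u. f (x + \<xi> *\<^sub>R v + u *\<^sub>R v)) has_vector_derivative D) (at 0)"
  shows "((\<lambda>u. f (x + u *\<^sub>R v)) has_vector_derivative D) (at \<xi>)"
proof -
  have "((\<lambda>u. f (x + \<xi> *\<^sub>R v + u *\<^sub>R v)) \<circ> (\<lambda>u. u - \<xi>) has_vector_derivative (1 *\<^sub>R D)) (at \<xi>)"
    using assms by (intro vector_diff_chain_at) (auto intro!: derivative_eq_intros)
  moreover have "(\<lambda>u. f (x + \<xi> *\<^sub>R v + u *\<^sub>R v)) \<circ> (\<lambda>u. u - \<xi>) = (\<lambda>u. f (x + u *\<^sub>R v))"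
    by (auto simp: algebra_simps)
  ultimately show ?thesis by simp
qed

text \<open>Integrating \<open>\<partial>\<^sub>tg\<^sub>\<xi>\<close> over \<open>\<xi>\<close> avoids any assumption on the mixed derivative in the other order.\<close>

lemma has_vector_derivative_swap:
  fixes g :: "real \<Rightarrow> real \<Rightarrow> real"
  assumes ab: "a < b" and cd: "c < e"
    and g\<xi>: "\<And>t \<xi>. t \<in> {a..b} \<Longrightarrow> \<xi> \<in> {c..e} \<Longrightarrow> (g t has_vector_derivative g\<xi> t \<xi>) (at \<xi> within {c..e})"
    and gt: "\<And>t \<xi>. t \<in> {a..b} \<Longrightarrow> \<xi> \<in> {c..e} \<Longrightarrow> ((\<lambda>t. g t \<xi>) has_vector_derivative gt t \<xi>) (at t within {a..b})"
    and g\<xi>t: "\<And>t \<xi>. t \<in> {a..b} \<Longrightarrow> \<xi> \<in> {c..e} \<Longrightarrow> ((\<lambda>t. g\<xi> t \<xi>) has_vector_derivative g\<xi>t t \<xi>) (at t within {a..b})"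
    and cont: "continuous_on ({a..b} \<times> {c..e}) (\<lambda>(t, \<xi>). g\<xi>t t \<xi>)"
    and t: "t \<in> {a..b}" and \<xi>: "\<xi> \<in> {c..e}"
  shows "(gt t has_vector_derivative g\<xi>t t \<xi>) (at \<xi> within {c..e})"
proof -
  have int: "(g\<xi> t has_integral (g t \<xi> - g t c)) {c..\<xi>}" if "t \<in> {a..b}" "\<xi> \<in> {c..e}" for t \<xi>
    using that by (intro fundamental_theorem_of_calculus)
      (auto intro!: has_vector_derivative_within_subset[OF g\<xi>])
  \<comment> \<open>The fundamental theorem in \<open>\<xi>\<close> is differentiated in
    \<open>t\<close> under the integral sign, and uniqueness of the derivative in \<open>t\<close>
    identifies the result. The right-hand side is visibly differentiable in
    \<open>\<xi>\<close>.\<close>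
  have eq: "gt t \<xi> = gt t c + integral {c..\<xi>} (g\<xi>t t)" if t: "t \<in> {a..b}" and \<xi>: "\<xi> \<in> {c..e}" for t \<xi>
  proof -
    have 1: "((\<lambda>t. integral (cbox c \<xi>) (g\<xi> t)) has_vector_derivative integral (cbox c \<xi>) (g\<xi>t t)) (at t within {a..b})"
    proof (rule leibniz_rule_vector_derivative[where fx=g\<xi>t])
      show "continuous_on ({a..b} \<times> cbox c \<xi>) (\<lambda>(t, \<xi>). g\<xi>t t \<xi>)"
        using \<xi> by (intro continuous_on_subset[OF cont]) auto
    qed (use int t \<xi> g\<xi>t in \<open>auto simp: integrable_on_def\<close>)
    have "((\<lambda>t. g t \<xi> - g t c) has_vector_derivative integral {c..\<xi>} (g\<xi>t t)) (at t within {a..b})"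
      by (rule has_vector_derivative_transform[OF t _ 1[unfolded box_real]])
        (use integral_unique[OF int] \<xi> in auto)
    moreover have "((\<lambda>t. g t \<xi> - g t c) has_vector_derivative gt t \<xi> - gt t c) (at t within {a..b})"
      using t \<xi> cd by (intro has_vector_derivative_diff gt) auto
    ultimately show ?thesis
      using has_vector_derivative_unique_Icc[OF ab t] by fastforce
  qed
  have "continuous_on {c..e} (\<lambda>\<xi>. (\<lambda>(t, \<xi>). g\<xi>t t \<xi>) (t, \<xi>))"
    using t by (intro continuous_on_compose2[OF cont] continuous_intros) auto
  then have "((\<lambda>\<xi>. integral {c..\<xi>} (g\<xi>t t)) has_vector_derivative g\<xi>t t \<xi>) (at \<xi> within {c..e})"
    using \<xi> by (intro integral_has_vector_derivative) simp_all
  then have "((\<lambda>\<xi>. gt t c + integral {c..\<xi>} (g\<xi>t t)) has_vector_derivative g\<xi>t t \<xi>) (at \<xi> within {c..e})"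
    by (auto intro!: derivative_eq_intros)
  then show ?thesis
    by (rule has_vector_derivative_transform[OF \<xi>, rotated]) (rule eq[OF t])
qed

section \<open>Iterated partial derivatives\<close>

text \<open>Words in \<open>None\<close> for \<open>\<partial>\<^sub>t\<close> and \<open>Some j\<close> for the derivative in the coordinate \<open>j\<close>. The hypothesis bounds only the
  words sorted as in \<^const>\<open>partial_t_alpha\<close>; the chain rule produces them in any order.\<close>

definition letters :: "nat \<Rightarrow> nat option set" where
  "letters d = insert None (Some ` {..<d})"

definition pd :: "real set \<Rightarrow> nat option \<Rightarrow> (real \<Rightarrow> rvec \<Rightarrow> 'a::real_normed_vector) \<Rightarrow> real \<Rightarrow> rvec \<Rightarrow> 'a" where
  "pd I a g = (case a of None \<Rightarrow> partial_t I g | Some j \<Rightarrow> (\<lambda>t. partial_x j (g t)))"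

lemma pd_simps [simp]: "pd I None g = partial_t I g" "pd I (Some j) g = (\<lambda>t. partial_x j (g t))"
  by (simp_all add: pd_def)

abbreviation pds :: "real set \<Rightarrow> nat option list \<Rightarrow> (real \<Rightarrow> rvec \<Rightarrow> 'a::real_normed_vector) \<Rightarrow> real \<Rightarrow> rvec \<Rightarrow> 'a" where
  "pds I w g \<equiv> foldr (pd I) w g"

lemma letters_cases:
  assumes "a \<in> letters d"
  obtains "a = None" | j where "a = Some j" "j < d"
  using assms by (auto simp: letters_def)

lemma vector_derivative_within_cong:
  assumes "t \<in> I" "\<And>u. u \<in> I \<Longrightarrow> f u = g u"
  shows "vector_derivative f (at t within I) = vector_derivative g (at t within I)"
proof -
  have "(f has_vector_derivative f') (at t within I) \<longleftrightarrow> (g has_vector_derivative f') (at t within I)" for f'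
    using assms has_vector_derivative_transform[of t I f g f'] has_vector_derivative_transform[of t I g f f']
    by auto
  then show ?thesis by (simp add: vector_derivative_def)
qed

lemma pd_cong:
  assumes "\<And>t x. t \<in> I \<Longrightarrow> x \<in> Rn d \<Longrightarrow> g t x = g' t x" "a \<in> letters d" "t \<in> I" "x \<in> Rn d"
  shows "pd I a g t x = pd I a g' t x"
  using assms(2)
proof (cases rule: letters_cases)
  case 1
  then show ?thesis using assms by (auto simp: partial_t_def intro!: vector_derivative_within_cong)
next
  case (2 j)
  then have "(\<lambda>u. g t (x + u *\<^sub>R unit_vec j)) = (\<lambda>u. g' t (x + u *\<^sub>R unit_vec j))"
    using assms by (intro ext) auto
  then show ?thesis using 2 by (simp add: partial_x_def)
qed

section \<open>Calculus of the class \<open>Ck_on\<close>\<close>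

declare Ck_on.simps(2) [simp del]

lemma Ck_on_pd: "Ck_on I d (Suc m) g \<Longrightarrow> a \<in> letters d \<Longrightarrow> Ck_on I d m (pd I a g)"
  by (auto simp: letters_def Ck_on.simps(2))

lemmas Ck_on_partial_t = Ck_on_pd[where a=None, simplified letters_def pd_simps, OF _ insertI1]

lemma Ck_on_partial_x: "Ck_on I d (Suc m) g \<Longrightarrow> j < d \<Longrightarrow> Ck_on I d m (\<lambda>t. partial_x j (g t))"
  using Ck_on_pd[of I d m g "Some j"] by (simp add: letters_def)

lemma Ck_on_continuous: "Ck_on I d m g \<Longrightarrow> continuous_on (I \<times> Rn d) (\<lambda>(t, x). g t x)"
  by (cases m) (auto simp: Ck_on.simps(2))

lemma Ck_on_cong:
  assumes "\<And>t x. t \<in> I \<Longrightarrow> x \<in> Rn d \<Longrightarrow> g t x = g' t x" "Ck_on I d m g"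
  shows "Ck_on I d m g'"
  using assms
proof (induction m arbitrary: g g')
  case 0
  then show ?case by (auto elim!: continuous_on_eq)
next
  case (Suc m)
  note eq = Suc.prems(1)
  have t: "(\<lambda>u. g' u x) differentiable (at t within I)" if tx: "t \<in> I" "x \<in> Rn d" for t x
  proof -
    have "(\<lambda>u. g u x) differentiable (at t within I)"
      using Suc.prems(2) tx by (simp add: Ck_on.simps(2))
    then obtain D where "((\<lambda>u. g u x) has_derivative D) (at t within I)" unfolding differentiable_def ..
    then have "((\<lambda>u. g' u x) has_derivative D) (at t within I)"
      by (rule has_derivative_transform[OF tx(1), rotated]) (use eq tx in auto)
    then show ?thesis unfolding differentiable_def by blast
  qed
  have x: "(\<lambda>u. g t (x + u *\<^sub>R unit_vec j)) = (\<lambda>u. g' t (x + u *\<^sub>R unit_vec j))"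
    if "t \<in> I" "x \<in> Rn d" "j < d" for t x j
    using that eq by (intro ext) auto
  have "Ck_on I d m (partial_t I g')"
    by (rule Suc.IH[OF _ Ck_on_partial_t[OF Suc.prems(2)]])
      (use eq pd_cong[of I d g g' None] in \<open>auto simp: letters_def\<close>)
  moreover have "Ck_on I d m (\<lambda>t. partial_x j (g' t))" if "j < d" for j
    by (rule Suc.IH[OF _ Ck_on_partial_x[OF Suc.prems(2) that]])
      (use that eq pd_cong[of I d g g' "Some j"] in \<open>auto simp: letters_def\<close>)
  moreover have "continuous_on (I \<times> Rn d) (\<lambda>(t, x). g' t x)"
    using Ck_on_continuous[OF Suc.prems(2)] eq by (auto elim!: continuous_on_eq)
  ultimately show ?case
    using t x Suc.prems(2) by (simp add: Ck_on.simps(2))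
qed

lemma Ck_on_SucD:
  assumes "Ck_on I d (Suc m) g"
  shows "Ck_on I d m g"
  using assms
proof (induction m arbitrary: g)
  case 0
  then show ?case using Ck_on_continuous by simp
next
  case (Suc m)
  note Suc.IH[OF Ck_on_partial_t[OF Suc.prems]] Suc.IH[OF Ck_on_partial_x[OF Suc.prems]]
  then show ?case
    using Suc.prems by (simp add: Ck_on.simps(2)[of I d "Suc m" g] Ck_on.simps(2)[of I d m g])
qed

lemma Ck_on_le:
  assumes "Ck_on I d m g" "n \<le> m"
  shows "Ck_on I d n g"
  using assms(2,1) by (induction rule: inc_induct) (auto dest: Ck_on_SucD)

lemma Ck_on_pds: "Ck_on I d (length w + m) g \<Longrightarrow> set w \<subseteq> letters d \<Longrightarrow> Ck_on I d m (pds I w g)"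
proof (induction w arbitrary: m)
  case (Cons a w)
  then show ?case using Cons.IH[of "Suc m"] by (auto intro!: Ck_on_pd)
qed auto

lemma Ck_on_has_partial_t:
  assumes "Ck_on I d (Suc m) g" "t \<in> I" "x \<in> Rn d"
  shows "((\<lambda>u. g u x) has_vector_derivative partial_t I g t x) (at t within I)"
  using assms by (auto simp: partial_t_def vector_derivative_works[symmetric] Ck_on.simps(2))

lemma Ck_on_has_partial_x:
  assumes "Ck_on I d (Suc m) g" "t \<in> I" "x \<in> Rn d" "j < d"
  shows "((\<lambda>u. g t (x + u *\<^sub>R unit_vec j)) has_vector_derivative partial_x j (g t) (x + v *\<^sub>R unit_vec j)) (at v)"
proof (rule has_vector_derivative_shift_line)
  have "x + v *\<^sub>R unit_vec j \<in> Rn d" using assms by simp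
  then show "has_partial j (g t) (x + v *\<^sub>R unit_vec j) (partial_x j (g t) (x + v *\<^sub>R unit_vec j))"
    using assms by (auto simp: partial_x_def vector_derivative_works[symmetric] Ck_on.simps(2))
qed

lemma Ck_on_SucI:
  assumes "a < b" "continuous_on ({a..b} \<times> Rn d) (\<lambda>(t, x). g t x)"
    and gt: "\<And>t x. t \<in> {a..b} \<Longrightarrow> x \<in> Rn d \<Longrightarrow> ((\<lambda>u. g u x) has_vector_derivative gt t x) (at t within {a..b})"
    and gx: "\<And>j t x. j < d \<Longrightarrow> t \<in> {a..b} \<Longrightarrow> x \<in> Rn d \<Longrightarrow>
      has_partial j (g t) x (gx j t x)"
    and C: "Ck_on {a..b} d m gt" "\<And>j. j < d \<Longrightarrow> Ck_on {a..b} d m (gx j)"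
  shows "Ck_on {a..b} d (Suc m) g"
proof -
  have "Ck_on {a..b} d m (partial_t {a..b} g)"
    using C(1) by (rule Ck_on_cong[rotated])
      (use vector_derivative_within_Icc[OF assms(1) _ gt] in \<open>auto simp: partial_t_def\<close>)
  moreover have "Ck_on {a..b} d m (\<lambda>t. partial_x j (g t))" if "j < d" for j
    using C(2)[OF that] by (rule Ck_on_cong[rotated])
      (use vector_derivative_at[OF gx] that in \<open>auto simp: partial_x_def\<close>)
  moreover have "(\<lambda>u. g u x) differentiable (at t within {a..b})" if "t \<in> {a..b}" "x \<in> Rn d" for t x
    using gt[OF that] by (rule differentiableI_vector)
  moreover have "(\<lambda>u. g t (x + u *\<^sub>R unit_vec j)) differentiable (at 0)"
    if "t \<in> {a..b}" "x \<in> Rn d" "j < d" for t x j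
    using gx[OF that(3,1,2)] by (rule differentiableI_vector)
  ultimately show ?thesis using assms(2) by (simp add: Ck_on.simps(2))
qed

lemma Ck_on_const: "a < b \<Longrightarrow> Ck_on {a..b} d m (\<lambda>t x. v)"
proof (induction m arbitrary: v)
  case (Suc m)
  then show ?case
    by (intro Ck_on_SucI[where gt="\<lambda>t x. 0" and gx="\<lambda>j t x. 0"]) (auto intro!: derivative_eq_intros)
qed auto

lemma Ck_on_id: "a < b \<Longrightarrow> Ck_on {a..b} d m (\<lambda>t x. x)"
proof (cases m)
  case (Suc n)
  assume "a < b"
  then show ?thesis unfolding Suc
    by (intro Ck_on_SucI[where gt="\<lambda>t x. 0" and gx="\<lambda>j t x. unit_vec j"] Ck_on_const)
      (auto intro!: derivative_eq_intros continuous_intros simp: case_prod_unfold)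
qed (auto intro!: continuous_intros simp: case_prod_unfold)

lemma Ck_on_add:
  "a < b \<Longrightarrow> Ck_on {a..b} d m g \<Longrightarrow> Ck_on {a..b} d m g' \<Longrightarrow> Ck_on {a..b} d m (\<lambda>t x. g t x + g' t x)"
proof (induction m arbitrary: g g')
  case 0
  then show ?case by (auto simp: case_prod_unfold intro!: continuous_intros)
next
  case (Suc m)
  note C = Suc.prems(2,3)
  show ?case
  proof (rule Ck_on_SucI[where gt="\<lambda>t x. partial_t {a..b} g t x + partial_t {a..b} g' t x"
        and gx="\<lambda>j t x. partial_x j (g t) x + partial_x j (g' t) x"])
    show "continuous_on ({a..b} \<times> Rn d) (\<lambda>(t, x). g t x + g' t x)"
      using C[THEN Ck_on_continuous] by (auto simp: case_prod_unfold intro!: continuous_intros)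
  next
    fix t x assume "t \<in> {a..b}" "x \<in> Rn d"
    then show "((\<lambda>u. g u x + g' u x) has_vector_derivative partial_t {a..b} g t x + partial_t {a..b} g' t x) (at t within {a..b})"
      using C by (intro has_vector_derivative_add Ck_on_has_partial_t)
  next
    fix j t x assume *: "j < d" "t \<in> {a..b}" "x \<in> Rn d"
    show "((\<lambda>u. g t (x + u *\<^sub>R unit_vec j) + g' t (x + u *\<^sub>R unit_vec j)) has_vector_derivative
      partial_x j (g t) x + partial_x j (g' t) x) (at 0)"
      using C[THEN Ck_on_has_partial_x, OF *(2,3,1), of 0] by (intro has_vector_derivative_add) auto
  qed (use Suc in \<open>auto intro!: Suc.IH Ck_on_partial_t Ck_on_partial_x\<close>)
qed

lemma Ck_on_bounded_linear:
  assumes "bounded_linear f" "a < b" "Ck_on {a..b} d m g"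
  shows "Ck_on {a..b} d m (\<lambda>t x. f (g t x))"
  using assms(3)
proof (induction m arbitrary: g)
  case 0
  then show ?case
    by (auto simp: case_prod_unfold intro!: bounded_linear.continuous_on[OF assms(1)])
next
  case (Suc m)
  note hvd = bounded_linear.has_vector_derivative[OF assms(1)]
  show ?case
  proof (rule Ck_on_SucI[where gt="\<lambda>t x. f (partial_t {a..b} g t x)" and gx="\<lambda>j t x. f (partial_x j (g t) x)"])
    show "continuous_on ({a..b} \<times> Rn d) (\<lambda>(t, x). f (g t x))"
      using Suc.prems[THEN Ck_on_continuous]
      by (auto simp: case_prod_unfold intro!: bounded_linear.continuous_on[OF assms(1)])
  next
    fix t x assume "t \<in> {a..b}" "x \<in> Rn d"
    then show "((\<lambda>u. f (g u x)) has_vector_derivative f (partial_t {a..b} g t x)) (at t within {a..b})"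
      using Suc.prems by (intro hvd Ck_on_has_partial_t)
  next
    fix j t x assume *: "j < d" "t \<in> {a..b}" "x \<in> Rn d"
    show "((\<lambda>u. f (g t (x + u *\<^sub>R unit_vec j))) has_vector_derivative f (partial_x j (g t) x)) (at 0)"
      using Suc.prems[THEN Ck_on_has_partial_x, OF *(2,3,1), of 0] by (intro hvd) auto
  qed (use Suc assms in \<open>auto intro!: Suc.IH Ck_on_partial_t Ck_on_partial_x\<close>)
qed

text \<open>\<open>rk_order\<close> speaks of the step interval, the hypotheses on the score of the
  whole time interval. A derivative taken within the larger interval is also one within the smaller,
  and \<open>a' < b'\<close> keeps it unique there.\<close>

lemma Ck_on_subinterval:
  assumes "a \<le> a'" "a' < b'" "b' \<le> b" "Ck_on {a..b} d m g"
  shows "Ck_on {a'..b'} d m g"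
  using assms(4)
proof (induction m arbitrary: g)
  case 0
  then show ?case using assms by (auto elim!: continuous_on_subset)
next
  case (Suc m)
  show ?case
  proof (rule Ck_on_SucI[where gt="partial_t {a..b} g" and gx="\<lambda>j t. partial_x j (g t)"])
    show "continuous_on ({a'..b'} \<times> Rn d) (\<lambda>(t, x). g t x)"
      using Suc.prems[THEN Ck_on_continuous] assms by (auto elim!: continuous_on_subset)
  next
    fix t x assume "t \<in> {a'..b'}" "x \<in> Rn d"
    then show "((\<lambda>u. g u x) has_vector_derivative partial_t {a..b} g t x) (at t within {a'..b'})"
      using assms Suc.prems by (intro has_vector_derivative_within_subset[OF Ck_on_has_partial_t]) auto
  next
    fix j t x assume *: "j < d" "t \<in> {a'..b'}" "x \<in> Rn d"
    show "has_partial j (g t) x (partial_x j (g t) x)"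
      using Ck_on_has_partial_x[OF Suc.prems, of t x j 0] * assms by auto
  qed (use Suc assms in \<open>auto intro!: Suc.IH Ck_on_partial_t Ck_on_partial_x\<close>)
qed

section \<open>Symmetry of mixed derivatives and sorting of words\<close>

lemma partial_x_pd_commute:
  fixes g :: "real \<Rightarrow> rvec \<Rightarrow> real"
  assumes "a < b" "Ck_on {a..b} d 2 g" "l \<in> letters d" "j < d" "t \<in> {a..b}" "x \<in> Rn d"
  shows "partial_x j (pd {a..b} l g t) x = pd {a..b} l (\<lambda>t. partial_x j (g t)) t x"
proof -
  let ?I = "{a..b}"
  have C: "Ck_on ?I d (Suc 1) g" using assms by (simp add: numeral_2_eq_2)
  have Cj: "Ck_on ?I d (Suc 0) (\<lambda>t. partial_x j (g t))"
    using Ck_on_partial_x[OF C assms(4)] by simp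
  have Cl: "continuous_on (?I \<times> Rn d) (\<lambda>(t, x). pd ?I l (\<lambda>t. partial_x j (g t)) t x)"
    using Ck_on_pd[OF Cj assms(3)] by simp
  \<comment> \<open>The exchange lemma works on compact intervals; with \<open>0\<close> in the
    interior of \<open>[-1, 1]\<close> the derivative obtained within the interval is
    two-sided.\<close>
  have "((\<lambda>\<xi>. pd ?I l g t (x + \<xi> *\<^sub>R unit_vec j)) has_vector_derivative
      pd ?I l (\<lambda>t. partial_x j (g t)) t (x + 0 *\<^sub>R unit_vec j)) (at 0 within {-1..1})"
    using assms(3)
  proof (cases rule: letters_cases)
    case 1
    show ?thesis unfolding 1 pd_simps
    proof (rule has_vector_derivative_swap[where a=a and b=b
          and g="\<lambda>t \<xi>. g t (x + \<xi> *\<^sub>R unit_vec j)"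
          and g\<xi>="\<lambda>t \<xi>. partial_x j (g t) (x + \<xi> *\<^sub>R unit_vec j)"
          and g\<xi>t="\<lambda>t \<xi>. partial_t ?I (\<lambda>t. partial_x j (g t)) t (x + \<xi> *\<^sub>R unit_vec j)"])
      show "continuous_on (?I \<times> {-1..1}) (\<lambda>(t, \<xi>). partial_t ?I (\<lambda>t. partial_x j (g t)) t (x + \<xi> *\<^sub>R unit_vec j))"
        unfolding case_prod_unfold
        using assms
        by (intro continuous_on_compose2[OF Cl[unfolded 1 pd_simps case_prod_unfold],
              where f="\<lambda>z. (fst z, x + snd z *\<^sub>R unit_vec j)", simplified])
          (auto intro!: continuous_intros)
    next
      fix u \<xi> :: real assume u: "u \<in> {a..b}"
      show "((\<lambda>\<xi>. g u (x + \<xi> *\<^sub>R unit_vec j)) has_vector_derivative partial_x j (g u) (x + \<xi> *\<^sub>R unit_vec j))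
           (at \<xi> within {- 1..1})"
        using Ck_on_has_partial_x[OF C u assms(6,4)] by (rule has_vector_derivative_at_within)
    qed (use assms in \<open>auto intro!: Ck_on_has_partial_t[OF C] Ck_on_has_partial_t[OF Cj]\<close>)
  next
    case (2 i)
    have "((\<lambda>\<xi>. partial_x i (g t) (x + \<xi> *\<^sub>R unit_vec j + 0 *\<^sub>R unit_vec i)) has_vector_derivative
      partial_x i (partial_x j (g t)) (x + 0 *\<^sub>R unit_vec j + 0 *\<^sub>R unit_vec i)) (at 0 within {-1..1})"
    proof (rule has_vector_derivative_swap[where a="-1" and b=1
          and g="\<lambda>\<eta> \<xi>. g t (x + \<xi> *\<^sub>R unit_vec j + \<eta> *\<^sub>R unit_vec i)"
          and gt="\<lambda>\<eta> \<xi>. partial_x i (g t) (x + \<xi> *\<^sub>R unit_vec j + \<eta> *\<^sub>R unit_vec i)"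
          and g\<xi>="\<lambda>\<eta> \<xi>. partial_x j (g t) (x + \<xi> *\<^sub>R unit_vec j + \<eta> *\<^sub>R unit_vec i)"
          and g\<xi>t="\<lambda>\<eta> \<xi>. partial_x i (partial_x j (g t)) (x + \<xi> *\<^sub>R unit_vec j + \<eta> *\<^sub>R unit_vec i)"])
      show "continuous_on ({-1..1} \<times> {-1..1})
          (\<lambda>(\<eta>, \<xi>). partial_x i (partial_x j (g t)) (x + \<xi> *\<^sub>R unit_vec j + \<eta> *\<^sub>R unit_vec i))"
        unfolding case_prod_unfold
        using assms 2
        by (intro continuous_on_compose2[OF Cl[unfolded 2 pd_simps case_prod_unfold],
              where f="\<lambda>z. (t, x + snd z *\<^sub>R unit_vec j + fst z *\<^sub>R unit_vec i)", simplified])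
          (auto intro!: continuous_intros)
    next
      fix \<eta> \<xi> :: real
      show "((\<lambda>\<xi>. g t (x + \<xi> *\<^sub>R unit_vec j + \<eta> *\<^sub>R unit_vec i)) has_vector_derivative
          partial_x j (g t) (x + \<xi> *\<^sub>R unit_vec j + \<eta> *\<^sub>R unit_vec i)) (at \<xi> within {-1..1})"
      proof (rule has_vector_derivative_at_within)
        have "x + \<eta> *\<^sub>R unit_vec i \<in> Rn d" using assms(6) 2 by simp
        note Ck_on_has_partial_x[OF C assms(5) this assms(4), of \<xi>]
        then show "((\<lambda>\<xi>. g t (x + \<xi> *\<^sub>R unit_vec j + \<eta> *\<^sub>R unit_vec i)) has_vector_derivative
          partial_x j (g t) (x + \<xi> *\<^sub>R unit_vec j + \<eta> *\<^sub>R unit_vec i)) (at \<xi>)"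
          by (simp only: add.assoc add.commute add.left_commute)
      qed
      have xj: "x + \<xi> *\<^sub>R unit_vec j \<in> Rn d"
        by (intro Rn_add Rn_scaleR Rn_unit_vec assms)
      show "((\<lambda>\<eta>. g t (x + \<xi> *\<^sub>R unit_vec j + \<eta> *\<^sub>R unit_vec i)) has_vector_derivative
          partial_x i (g t) (x + \<xi> *\<^sub>R unit_vec j + \<eta> *\<^sub>R unit_vec i)) (at \<eta> within {-1..1})"
        by (rule has_vector_derivative_at_within, rule Ck_on_has_partial_x[OF C assms(5) xj 2(2)])
      show "((\<lambda>\<eta>. partial_x j (g t) (x + \<xi> *\<^sub>R unit_vec j + \<eta> *\<^sub>R unit_vec i)) has_vector_derivative
          partial_x i (partial_x j (g t)) (x + \<xi> *\<^sub>R unit_vec j + \<eta> *\<^sub>R unit_vec i)) (at \<eta> within {-1..1})"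
        by (rule has_vector_derivative_at_within, rule Ck_on_has_partial_x[OF Cj assms(5) xj 2(2)])
    qed auto
    then show ?thesis by (simp add: 2)
  qed
  then have "((\<lambda>\<xi>. pd ?I l g t (x + \<xi> *\<^sub>R unit_vec j)) has_vector_derivative
      pd ?I l (\<lambda>t. partial_x j (g t)) t x) (at 0)"
    by (simp add: at_within_Icc_at)
  then show ?thesis
    unfolding partial_x_def by (rule vector_derivative_at)
qed

text \<open>Two time letters commute trivially. Otherwise one letter is spatial, and
  \<open>partial_x_pd_commute\<close> applies in one direction or the other.\<close>

lemma pd_commute:
  fixes g :: "real \<Rightarrow> rvec \<Rightarrow> real"
  assumes "a < b" "Ck_on {a..b} d 2 g" "l \<in> letters d" "l' \<in> letters d" "t \<in> {a..b}" "x \<in> Rn d"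
  shows "pd {a..b} l (pd {a..b} l' g) t x = pd {a..b} l' (pd {a..b} l g) t x"
  using assms(4)
proof (cases rule: letters_cases)
  case l': 1
  show ?thesis using assms(3)
    by (cases rule: letters_cases) (use partial_x_pd_commute[OF assms(1,2), of None] l' assms in auto)
next
  case (2 j)
  then show ?thesis using partial_x_pd_commute[OF assms(1-3), of j] assms by auto
qed

lemma pds_cong:
  assumes "\<And>t x. t \<in> I \<Longrightarrow> x \<in> Rn d \<Longrightarrow> g t x = g' t x" "set w \<subseteq> letters d" "t \<in> I" "x \<in> Rn d"
  shows "pds I w g t x = pds I w g' t x"
  using assms(2-)
proof (induction w arbitrary: t x)
  case (Cons l w)
  then show ?case by (auto intro!: pd_cong[where d=d])
qed (use assms in auto)

text \<open>One transposition per letter passed. Each exchanges the two outermost letters of a word,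
  so the derivative below them must be \<open>C^2\<close>; the order demanded of \<open>g\<close> is
  the length of the full word.\<close>

lemma pds_move:
  fixes g :: "real \<Rightarrow> rvec \<Rightarrow> real"
  assumes ab: "a < b" and "Ck_on {a..b} d (Suc (length (w @ w'))) g" "set (l # w @ w') \<subseteq> letters d"
    "t \<in> {a..b}" "x \<in> Rn d"
  shows "pds {a..b} (w @ l # w') g t x = pds {a..b} (l # w @ w') g t x"
  using assms(2-)
proof (induction w arbitrary: t x)
  case (Cons l' w)
  let ?I = "{a..b}"
  have C2: "Ck_on ?I d 2 (pds ?I (w @ w') g)"
    using Cons.prems by (intro Ck_on_pds) (auto simp: numeral_2_eq_2)
  have "pds ?I (w @ l # w') g t x = pds ?I (l # w @ w') g t x" if "t \<in> ?I" "x \<in> Rn d" for t x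
    using Cons.prems that by (intro Cons.IH) (auto dest: Ck_on_SucD)
  then have "pds ?I ((l' # w) @ l # w') g t x = pd ?I l' (pds ?I (l # w @ w') g) t x"
    using Cons.prems by (auto intro!: pd_cong[where d=d])
  also have "\<dots> = pd ?I l (pds ?I (l' # w @ w') g) t x"
    using pd_commute[OF ab C2] Cons.prems by simp
  finally show ?case by simp
qed simp

lemma pds_mset_eq:
  fixes g :: "real \<Rightarrow> rvec \<Rightarrow> real"
  assumes ab: "a < b" and "Ck_on {a..b} d (length w) g" "set w \<subseteq> letters d" "mset w = mset w'"
    "t \<in> {a..b}" "x \<in> Rn d"
  shows "pds {a..b} w g t x = pds {a..b} w' g t x"
  using assms(2-)
proof (induction w' arbitrary: w t x)
  case (Cons l w')
  then have "l \<in> set w" by (metis list.set_intros(1) set_mset_mset)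
  then obtain w1 w2 where w: "w = w1 @ l # w2" by (meson split_list)
  have m: "mset (w1 @ w2) = mset w'" using Cons.prems w by simp
  have "pds {a..b} w g t x = pds {a..b} (l # w1 @ w2) g t x"
    unfolding w using Cons.prems w by (intro pds_move[OF ab]) auto
  also have "\<dots> = pd {a..b} l (pds {a..b} w' g) t x"
  proof -
    have "pds {a..b} (w1 @ w2) g t x = pds {a..b} w' g t x" if "t \<in> {a..b}" "x \<in> Rn d" for t x
      using Cons.prems w that by (intro Cons.IH m) (auto dest: Ck_on_SucD)
    then show ?thesis using Cons.prems w by (auto intro!: pd_cong[where d=d])
  qed
  finally show ?case by simp
qed simp

section \<open>From multi-indices to bounds on all words\<close>

definition canonical_word :: "nat \<Rightarrow> nat \<Rightarrow> (nat \<Rightarrow> nat) \<Rightarrow> nat option list" where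
  "canonical_word d k \<alpha> = replicate k None @ concat (map (\<lambda>i. replicate (\<alpha> i) (Some i)) [0..<d])"

lemma partial_t_alpha_eq_pds:
  fixes g :: "real \<Rightarrow> rvec \<Rightarrow> 'a::real_normed_vector"
  shows "partial_t_alpha I d k \<alpha> g = pds I (canonical_word d k \<alpha>) g"
proof -
  have x: "pds I (replicate n (Some i)) G t = (partial_x i ^^ n) (G t)" for n i G t
    by (induction n) auto
  have "foldr (\<lambda>i. partial_x i ^^ \<alpha> i) xs (g t) = pds I (concat (map (\<lambda>i. replicate (\<alpha> i) (Some i)) xs)) g t" for xs t
    by (induction xs) (auto simp: x simp del: foldr_replicate)
  moreover have "pds I (replicate n None) G = (partial_t I ^^ n) G"
    for n and G :: "real \<Rightarrow> rvec \<Rightarrow> 'a"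
    by (induction n) auto
  ultimately show ?thesis
    by (simp add: partial_t_alpha_def partial_alpha_def canonical_word_def del: foldr_replicate)
qed

lemma mset_canonical_word:
  "mset (canonical_word d k \<alpha>) = replicate_mset k None + (\<Sum>i<d. replicate_mset (\<alpha> i) (Some i))"
  by (simp add: canonical_word_def mset_concat interv_sum_list_conv_sum_set_nat atLeast0LessThan o_def)

lemma obtain_canonical_word:
  assumes "set w \<subseteq> letters d"
  obtains k \<alpha> where "mset (canonical_word d k \<alpha>) = mset w" "k + (\<Sum>i<d. \<alpha> i) = length w"
proof
  define k \<alpha> where "k = count (mset w) None" and "\<alpha> i = count (mset w) (Some i)" for i
  show eq: "mset (canonical_word d k \<alpha>) = mset w"
  proof (rule multiset_eqI)
    fix l
    consider "l = None" | j where "l = Some j" "j < d" | "l \<notin> letters d"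
      by (cases l) (auto simp: letters_def)
    then show "count (mset (canonical_word d k \<alpha>)) l = count (mset w) l"
    proof cases
      case 3
      then have "count (mset w) l = 0" using assms by (auto simp: count_eq_zero_iff)
      then show ?thesis using 3
        by (cases l) (auto simp: mset_canonical_word count_sum letters_def)
    qed (auto simp: mset_canonical_word count_sum k_def \<alpha>_def sum.delta)
  qed
  show "k + (\<Sum>i<d. \<alpha> i) = length w"
    using arg_cong[OF eq, of size] by (simp add: mset_canonical_word size_multiset_sum)
qed

text \<open>The empty word counts, so \<open>g\<close> itself is bounded. As the field grows
  linearly, the predicate is assumed only of its first derivatives.\<close>

definition pd_bounded :: "real set \<Rightarrow> nat \<Rightarrow> nat \<Rightarrow> real \<Rightarrow> (real \<Rightarrow> rvec \<Rightarrow> real) \<Rightarrow> bool" where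
  "pd_bounded I d n A g \<longleftrightarrow>
    (\<forall>w t x. set w \<subseteq> letters d \<longrightarrow> length w \<le> n \<longrightarrow> t \<in> I \<longrightarrow> x \<in> Rn d \<longrightarrow> \<bar>pds I w g t x\<bar> \<le> A)"

lemma pd_bounded_pd: "pd_bounded I d (Suc n) A g \<Longrightarrow> l \<in> letters d \<Longrightarrow> pd_bounded I d n A (pd I l g)"
  unfolding pd_bounded_def
  by (intro allI impI) (drule_tac x="w @ [l]" in spec, auto)

lemma pd_boundedD: "pd_bounded I d n A g \<Longrightarrow> t \<in> I \<Longrightarrow> x \<in> Rn d \<Longrightarrow> \<bar>g t x\<bar> \<le> A"
  unfolding pd_bounded_def by (drule spec[of _ "[]"]) auto

lemma pd_bounded_cong:
  assumes "pd_bounded I d n A g" "\<And>t x. t \<in> I \<Longrightarrow> x \<in> Rn d \<Longrightarrow> g t x = g' t x"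
  shows "pd_bounded I d n A g'"
  using assms pds_cong[of I d g g'] by (auto simp: pd_bounded_def)

text \<open>The bounds start at order one; appending \<open>l\<close> makes every word nonempty, and
  sorting \<open>w @ [l]\<close> turns it into a multi-index derivative.\<close>

lemma pd_bounded_of_partial_t_alpha:
  assumes ab: "a < b" and C: "Ck_on {a..b} d (Suc n) g"
    and bd: "\<And>t x k \<alpha>. t \<in> {a..b} \<Longrightarrow> x \<in> Rn d \<Longrightarrow> 1 \<le> k + (\<Sum>i<d. \<alpha> i) \<Longrightarrow> k + (\<Sum>i<d. \<alpha> i) \<le> Suc n \<Longrightarrow>
      \<bar>partial_t_alpha {a..b} d k \<alpha> g t x\<bar> \<le> A"
    and l: "l \<in> letters d"
  shows "pd_bounded {a..b} d n A (pd {a..b} l g)"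
  unfolding pd_bounded_def
proof (intro allI impI)
  fix w t x
  assume *: "set w \<subseteq> letters d" "length w \<le> n" "t \<in> {a..b}" "x \<in> Rn d"
  then have "set (w @ [l]) \<subseteq> letters d" using l by auto
  then obtain k \<alpha> where k: "mset (canonical_word d k \<alpha>) = mset (w @ [l])" "k + (\<Sum>i<d. \<alpha> i) = length (w @ [l])"
    using obtain_canonical_word by metis
  have "pds {a..b} w (pd {a..b} l g) t x = pds {a..b} (w @ [l]) g t x" by simp
  also have "\<dots> = partial_t_alpha {a..b} d k \<alpha> g t x"
    unfolding partial_t_alpha_eq_pds
    using * l by (intro pds_mset_eq[OF ab Ck_on_le[OF C]] k(1)[symmetric]) auto
  finally show "\<bar>pds {a..b} w (pd {a..b} l g) t x\<bar> \<le> A"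
    using bd[of t x k \<alpha>] * k(2) by simp
qed

text \<open>The innermost letter annihilates \<open>c\<close>, so only the empty word sees it, at
  the price \<open>\<bar>c\<bar>\<close>. Meant for the first derivatives of
  \<open>x + s_t(x)\<close>, where \<open>c\<close> is \<open>0\<close> or \<open>1\<close>.\<close>

lemma pd_bounded_add_const:
  assumes ab: "a < b" and C: "Ck_on {a..b} d n g" and bd: "pd_bounded {a..b} d n A g"
  shows "pd_bounded {a..b} d n (A + \<bar>c\<bar>) (\<lambda>t x. c + g t x)"
  unfolding pd_bounded_def
proof (intro allI impI)
  fix w t x
  assume *: "set w \<subseteq> letters d" "length w \<le> n" "t \<in> {a..b}" "x \<in> Rn d"
  show "\<bar>pds {a..b} w (\<lambda>t x. c + g t x) t x\<bar> \<le> A + \<bar>c\<bar>"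
  proof (cases w rule: rev_cases)
    case Nil
    then show ?thesis using pd_boundedD[OF bd *(3,4)] by simp
  next
    case (snoc w' l)
    have "pd {a..b} l (\<lambda>t x. c + g t x) t x = pd {a..b} l g t x" if "t \<in> {a..b}" "x \<in> Rn d" for t x
    proof -
      have l: "l \<in> letters d" and C1: "Ck_on {a..b} d (Suc 0) g"
        using * snoc by (auto intro: Ck_on_le[OF C])
      show ?thesis using l
      proof (cases rule: letters_cases)
        case 1
        have "((\<lambda>u. c + g u x) has_vector_derivative partial_t {a..b} g t x) (at t within {a..b})"
          using Ck_on_has_partial_t[OF C1 that] by (auto intro!: derivative_eq_intros)
        then show ?thesis
          using that 1 vector_derivative_within_Icc[OF ab that(1)] by (simp add: partial_t_def)
      next
        case (2 j)
        have "((\<lambda>u. c + g t (x + u *\<^sub>R unit_vec j)) has_vector_derivative partial_x j (g t) x) (at 0)"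
          using Ck_on_has_partial_x[OF C1 that, of j 0] 2 by (auto intro!: derivative_eq_intros)
        then have "partial_x j (\<lambda>x. c + g t x) x = partial_x j (g t) x"
          unfolding partial_x_def[of j "\<lambda>x. c + g t x"] by (rule vector_derivative_at)
        then show ?thesis using 2 by simp
      qed
    qed
    then have "pds {a..b} w (\<lambda>t x. c + g t x) t x = pds {a..b} w g t x"
      using * snoc by (auto intro!: pds_cong[where d=d])
    then show ?thesis using bd * by (auto simp: pd_bounded_def intro: add_increasing2)
  qed
qed

section \<open>Differentiation along curves\<close>

definition cut :: "nat \<Rightarrow> rvec \<Rightarrow> rvec" where
  "cut q v = (\<Sum>i<q. coord v i *\<^sub>R unit_vec i)"

lemma coord_cut: "coord (cut q v) i = (if i < q then coord v i else 0)"
  by (auto simp: cut_def coord_unit_vec if_distrib sum.delta cong: if_cong)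

lemma cut_Suc: "cut (Suc q) v = cut q v + coord v q *\<^sub>R unit_vec q"
  by (simp add: cut_def)

lemma cut_in_Rn: "q \<le> d \<Longrightarrow> cut q v \<in> Rn d"
  by (auto simp: Rn_iff coord_cut)

lemma cut_eq: "v \<in> Rn d \<Longrightarrow> cut d v = v"
  using Rn_expand[of v d] by (simp add: cut_def)

lemma norm_cut_le: "norm (cut d w) \<le> norm w"
proof -
  have "norm (cut d w) = (\<Sum>q<d. \<bar>coord w q\<bar>)"
    using norm_Rn[OF cut_in_Rn[of d d w]] by (simp add: coord_cut)
  then show ?thesis using sum_abs_coord_le_norm[where x=w and d=d] by simp
qed

text \<open>Moving from \<open>x\<close> to \<open>y\<close> one coordinate at a time; the norm is the sum of the moves.\<close>

lemma has_derivative_partials: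
  fixes g :: "rvec \<Rightarrow> 'a::real_normed_vector"
  assumes g': "\<And>q y. q < d \<Longrightarrow> y \<in> Rn d \<Longrightarrow> has_partial q g y (g' q y)"
    and cont: "\<And>q. q < d \<Longrightarrow> continuous_on (Rn d) (g' q)"
    and x: "x \<in> Rn d"
  shows "(g has_derivative (\<lambda>v. \<Sum>q<d. coord v q *\<^sub>R g' q x)) (at x within Rn d)"
  unfolding has_derivative_within_alt
proof (intro conjI allI impI)
  show "bounded_linear (\<lambda>v. \<Sum>q<d. coord v q *\<^sub>R g' q x)"
    by (intro bounded_linear_sum bounded_linear_compose[OF bounded_linear_scaleR_left bounded_linear_coord])
  fix e :: real assume e: "e > 0"
  have "\<exists>\<delta>>0. \<forall>y\<in>Rn d. norm (y - x) < \<delta> \<longrightarrow> norm (g' q y - g' q x) \<le> e" if "q < d" for q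
    using cont[OF that] x e unfolding continuous_on_iff dist_norm by (meson less_imp_le)
  then obtain \<delta> where \<delta>: "\<And>q. q < d \<Longrightarrow> \<delta> q > 0"
    "\<And>q y. q < d \<Longrightarrow> y \<in> Rn d \<Longrightarrow> norm (y - x) < \<delta> q \<Longrightarrow> norm (g' q y - g' q x) \<le> e"
    by metis
  define \<eta> where "\<eta> = Min (insert 1 (\<delta> ` {..<d}))"
  have \<eta>: "\<eta> > 0" "\<And>q. q < d \<Longrightarrow> \<eta> \<le> \<delta> q"
    using \<delta>(1) by (auto simp: \<eta>_def)
  show "\<exists>\<eta>>0. \<forall>y\<in>Rn d. norm (y - x) < \<eta> \<longrightarrow>
      norm (g y - g x - (\<Sum>q<d. coord (y - x) q *\<^sub>R g' q x)) \<le> e * norm (y - x)"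
  proof (intro exI[of _ \<eta>] conjI ballI impI \<eta>(1))
    fix y assume y: "y \<in> Rn d" and "norm (y - x) < \<eta>"
    define v where "v = y - x"
    have v: "v \<in> Rn d" "norm v < \<eta>" using x y \<open>norm (y - x) < \<eta>\<close> by (auto simp: v_def)
    have step: "norm (g (x + cut (Suc q) v) - g (x + cut q v) - coord v q *\<^sub>R g' q x) \<le> \<bar>coord v q\<bar> * e" if q: "q < d" for q
    proof -
      let ?S = "closed_segment 0 (coord v q)"
      let ?\<phi> = "\<lambda>u. g (x + cut q v + u *\<^sub>R unit_vec q)"
      have in_Rn: "x + cut q v + u *\<^sub>R unit_vec q \<in> Rn d" for u
        using q x by (intro Rn_add Rn_scaleR cut_in_Rn) auto
      have deriv: "(?\<phi> has_vector_derivative g' q (x + cut q v + u *\<^sub>R unit_vec q)) (at u within T)" for u T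
        by (rule has_vector_derivative_at_within, rule has_vector_derivative_shift_line, rule g'[OF q in_Rn])
      \<comment> \<open>In the sum norm no point of an edge of the path is farther from
        \<open>x\<close> than \<open>y\<close> is, so the choice of \<open>\<delta>\<close> covers
        the whole edge.\<close>
      have bd: "norm (g' q (x + cut q v + u *\<^sub>R unit_vec q) - g' q x) \<le> e" if "u \<in> ?S" for u
      proof (rule \<delta>(2)[OF q in_Rn])
        have "\<bar>u\<bar> \<le> \<bar>coord v q\<bar>" using that by (auto simp: closed_segment_eq_real_ivl split: if_splits)
        then have "norm (cut q v + u *\<^sub>R unit_vec q) \<le> norm (cut (Suc q) v)"
        proof -
          have "(\<Sum>i<Suc q. \<bar>coord (cut q v + u *\<^sub>R unit_vec q) i\<bar>) \<le> (\<Sum>i<Suc q. \<bar>coord (cut (Suc q) v) i\<bar>)"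
            using \<open>\<bar>u\<bar> \<le> \<bar>coord v q\<bar>\<close> by (intro sum_mono) (auto simp: coord_cut coord_unit_vec less_Suc_eq)
          then show ?thesis
            using norm_Rn[OF cut_in_Rn, of "Suc q" "Suc q" v] norm_Rn[of "cut q v + u *\<^sub>R unit_vec q" "Suc q"]
            by (simp add: cut_in_Rn del: sum.lessThan_Suc)
        qed
        also have "\<dots> \<le> norm v" by (rule norm_cut_le)
        also have "\<dots> < \<delta> q" using v \<eta>(2)[OF q] by simp
        finally show "norm (x + cut q v + u *\<^sub>R unit_vec q - x) < \<delta> q" by (simp add: add.assoc)
      qed
      have "norm (?\<phi> (coord v q) - ?\<phi> 0 - (coord v q - 0) *\<^sub>R g' q x) \<le> norm (coord v q - 0) * e"
      proof -
        have "((\<lambda>u. ?\<phi> u - u *\<^sub>R g' q x) has_derivative (\<lambda>h. h *\<^sub>R (g' q (x + cut q v + u *\<^sub>R unit_vec q) - g' q x))) (at u within ?S)" for u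
          using has_vector_derivative_diff[OF deriv[of u ?S] has_vector_derivative_scaleR[OF DERIV_ident has_vector_derivative_const[of "g' q x"]]]
          by (simp add: has_vector_derivative_def)
        then have "norm ((?\<phi> (coord v q) - coord v q *\<^sub>R g' q x) - (?\<phi> 0 - 0 *\<^sub>R g' q x)) \<le> e * norm (coord v q - 0)"
          by (rule differentiable_bound[OF convex_closed_segment]) (use bd e in \<open>auto intro!: onorm_le simp: mult.commute[of e] mult_left_mono\<close>)
        then show ?thesis by (simp add: algebra_simps)
      qed
      then show ?thesis by (simp add: cut_Suc add.assoc)
    qed
    have "g y - g x - (\<Sum>q<d. coord v q *\<^sub>R g' q x)
      = (\<Sum>q<d. g (x + cut (Suc q) v) - g (x + cut q v) - coord v q *\<^sub>R g' q x)"
      using sum_lessThan_telescope[of "\<lambda>q. g (x + cut q v)" d] cut_eq[OF v(1)]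
      by (subst sum_subtractf) (simp add: cut_def[of 0] v_def)
    also have "norm \<dots> \<le> (\<Sum>q<d. \<bar>coord v q\<bar> * e)"
      using step by (intro order_trans[OF norm_sum] sum_mono) auto
    also have "\<dots> = e * norm v"
      using norm_Rn[OF v(1)] by (simp add: sum_distrib_left mult.commute)
    finally show "norm (g y - g x - (\<Sum>q<d. coord (y - x) q *\<^sub>R g' q x)) \<le> e * norm (y - x)"
      by (simp add: v_def)
  qed
qed

text \<open>\<open>S\<close> is left general for two uses: the time interval, for derivatives in
  \<open>r\<close>, and the whole line with constant \<open>\<sigma>\<close>, for derivatives in
  \<open>x\<close>.\<close>

lemma has_derivative_along_curve:
  fixes g :: "real \<Rightarrow> rvec \<Rightarrow> 'a::real_normed_vector"
  assumes ab: "a < b" and C: "Ck_on {a..b} d (Suc m) g"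
    and \<sigma>: "(\<sigma> has_real_derivative \<sigma>') (at r within S)" and u: "(u has_vector_derivative u') (at r within S)"
    and "\<And>r. r \<in> S \<Longrightarrow> \<sigma> r \<in> {a..b}" "\<And>r. r \<in> S \<Longrightarrow> u r \<in> Rn d" and r: "r \<in> S"
  shows "((\<lambda>r. g (\<sigma> r) (u r)) has_vector_derivative
    \<sigma>' *\<^sub>R partial_t {a..b} g (\<sigma> r) (u r) + (\<Sum>q<d. coord u' q *\<^sub>R partial_x q (g (\<sigma> r)) (u r))) (at r within S)"
proof -
  let ?I = "{a..b}"
  have t: "continuous_on (?I \<times> Rn d) (\<lambda>(t, x). partial_t ?I g t x)"
    using Ck_on_continuous[OF Ck_on_partial_t[OF C]] .
  have x: "continuous_on (Rn d) (partial_x q (g t))" if "q < d" "t \<in> ?I" for q t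
  proof -
    have "continuous_on (Rn d) (\<lambda>x. (\<lambda>(t, x). partial_x q (g t) x) (t, x))"
      by (rule continuous_on_compose2[OF Ck_on_continuous[OF Ck_on_partial_x[OF C that(1)]]])
        (use that in \<open>auto intro!: continuous_intros\<close>)
    then show ?thesis by simp
  qed
  \<comment> \<open>The variables are ordered \<open>(x, t)\<close> because the criterion asks for a
    total derivative in the first variable at one point only, and for a continuous derivative in the
    second, where operator-valued continuity is easy.\<close>
  have D: "((\<lambda>(x, t). g t x) has_derivative
      (\<lambda>(tx, ty). (\<Sum>q<d. coord tx q *\<^sub>R partial_x q (g (\<sigma> r)) (u r)) +
        blinfun_apply (blinfun_scaleR_left (partial_t ?I g (\<sigma> r) (u r))) ty)) (at (u r, \<sigma> r) within Rn d \<times> ?I)"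
  proof (rule has_derivative_partialsI[where fy="\<lambda>x t. blinfun_scaleR_left (partial_t ?I g t x)"])
    show "(g (\<sigma> r) has_derivative (\<lambda>tx. \<Sum>q<d. coord tx q *\<^sub>R partial_x q (g (\<sigma> r)) (u r))) (at (u r) within Rn d)"
      using assms x Ck_on_has_partial_x[OF C, where v=0] by (intro has_derivative_partials) auto
    show "((\<lambda>t. g t x) has_derivative blinfun_apply (blinfun_scaleR_left (partial_t ?I g t x))) (at t within ?I)"
      if "x \<in> Rn d" "t \<in> ?I" for x t
      using Ck_on_has_partial_t[OF C that(2,1)] by (simp add: has_vector_derivative_def)
    have "continuous_on (Rn d \<times> ?I) (\<lambda>(x, t). blinfun_scaleR_left (partial_t ?I g t x))"
      unfolding case_prod_unfold
      by (intro bounded_linear.continuous_on[OF bounded_linear_blinfun_scaleR_left]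
          continuous_on_compose2[OF t[unfolded case_prod_unfold], where f="\<lambda>z. (snd z, fst z)", simplified])
        (auto intro!: continuous_intros)
    then show "continuous (at (u r, \<sigma> r) within Rn d \<times> ?I) (\<lambda>(x, t). blinfun_scaleR_left (partial_t ?I g t x))"
      using assms by (auto simp: continuous_on_eq_continuous_within)
  qed (use assms in auto)
  have pair: "((\<lambda>r. (u r, \<sigma> r)) has_derivative (\<lambda>h. (h *\<^sub>R u', h *\<^sub>R \<sigma>'))) (at r within S)"
    using \<sigma> u by (intro has_derivative_Pair)
      (auto simp: has_vector_derivative_def has_real_derivative_iff_has_vector_derivative)
  have "((\<lambda>r. (\<lambda>(x, t). g t x) (u r, \<sigma> r)) has_derivative
      (\<lambda>h. (\<lambda>(tx, ty). (\<Sum>q<d. coord tx q *\<^sub>R partial_x q (g (\<sigma> r)) (u r)) +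
        blinfun_apply (blinfun_scaleR_left (partial_t ?I g (\<sigma> r) (u r))) ty) (h *\<^sub>R u', h *\<^sub>R \<sigma>'))) (at r within S)"
    using assms by (intro has_derivative_in_compose[OF pair has_derivative_subset[OF D]]) auto
  then show ?thesis
    by (simp add: has_vector_derivative_def scaleR_add_right scaleR_sum_right add.commute)
qed

section \<open>Geometric bounds on derivatives in time\<close>

text \<open>\<open>rbd h X M n A g\<close>: the derivatives \<open>\<partial>\<^sub>r\<^sup>m g\<close>, \<open>m \<le> n\<close>, are jointly continuous on \<open>[0, h] \<times> X\<close> and bounded by
  \<open>A M\<^sup>m\<close>. Allowing \<open>A\<close> and \<open>M\<close> to depend on \<open>x\<close> keeps all constants free of \<open>d\<close>, \<open>L\<close> and \<open>x\<close>.\<close>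

primrec rbd :: "real \<Rightarrow> 'x::topological_space set \<Rightarrow> ('x \<Rightarrow> real) \<Rightarrow> nat \<Rightarrow> ('x \<Rightarrow> real) \<Rightarrow> (real \<Rightarrow> 'x \<Rightarrow> 'a::real_normed_vector) \<Rightarrow> bool" where
  "rbd h X M 0 A g \<longleftrightarrow> continuous_on ({0..h} \<times> X) (\<lambda>(r, x). g r x) \<and> (\<forall>r\<in>{0..h}. \<forall>x\<in>X. norm (g r x) \<le> A x)"
| "rbd h X M (Suc n) A g \<longleftrightarrow> continuous_on ({0..h} \<times> X) (\<lambda>(r, x). g r x) \<and> (\<forall>r\<in>{0..h}. \<forall>x\<in>X. norm (g r x) \<le> A x) \<and>
     (\<exists>g'. (\<forall>r\<in>{0..h}. \<forall>x\<in>X. ((\<lambda>r. g r x) has_vector_derivative g' r x) (at r within {0..h})) \<and>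
       rbd h X M n (\<lambda>x. A x * M x) g')"

declare rbd.simps(2) [simp del]

lemma rbd_cont: "rbd h X M n A g \<Longrightarrow> continuous_on ({0..h} \<times> X) (\<lambda>(r, x). g r x)"
  by (cases n) (auto simp: rbd.simps(2))

lemma rbd_bound: "rbd h X M n A g \<Longrightarrow> r \<in> {0..h} \<Longrightarrow> x \<in> X \<Longrightarrow> norm (g r x) \<le> A x"
  by (cases n) (auto simp: rbd.simps(2))

lemma rbd_SucE:
  assumes "rbd h X M (Suc n) A g"
  obtains g' where "\<And>r x. r \<in> {0..h} \<Longrightarrow> x \<in> X \<Longrightarrow> ((\<lambda>r. g r x) has_vector_derivative g' r x) (at r within {0..h})"
    "rbd h X M n (\<lambda>x. A x * M x) g'"
  using assms unfolding rbd.simps(2) by blast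

lemma rbd_SucI:
  assumes "rbd h X M 0 A g"
    and "\<And>r x. r \<in> {0..h} \<Longrightarrow> x \<in> X \<Longrightarrow> ((\<lambda>r. g r x) has_vector_derivative g' r x) (at r within {0..h})"
    "rbd h X M n (\<lambda>x. A x * M x) g'"
  shows "rbd h X M (Suc n) A g"
  using assms unfolding rbd.simps by blast

lemma rbd_0: "rbd h X M n A g \<Longrightarrow> rbd h X M 0 A g"
  using rbd_cont rbd_bound by fastforce

lemma rbd_mono:
  assumes "rbd h X M n A g" "\<And>x. x \<in> X \<Longrightarrow> A x \<le> A' x" "\<And>x. x \<in> X \<Longrightarrow> 0 \<le> M x"
  shows "rbd h X M n A' g"
  using assms(1,2)
proof (induction n arbitrary: A A' g)
  case 0
  then show ?case by fastforce
next
  case (Suc n)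
  from rbd_SucE[OF Suc.prems(1)] obtain g' where
    g': "\<And>r x. r \<in> {0..h} \<Longrightarrow> x \<in> X \<Longrightarrow> ((\<lambda>r. g r x) has_vector_derivative g' r x) (at r within {0..h})"
    "rbd h X M n (\<lambda>x. A x * M x) g'" by blast
  show ?case
  proof (rule rbd_SucI[OF _ g'(1)])
    show "rbd h X M 0 A' g" using rbd_0[OF Suc.prems(1)] Suc.prems(2) by fastforce
    show "rbd h X M n (\<lambda>x. A' x * M x) g'"
      using g'(2) by (rule Suc.IH) (use Suc.prems assms(3) in \<open>auto intro: mult_right_mono\<close>)
  qed
qed

lemma rbd_SucD: "rbd h X M (Suc n) A g \<Longrightarrow> rbd h X M n A g"
proof (induction n arbitrary: A g)
  case (Suc n)
  from rbd_SucE[OF Suc.prems(1)] obtain g' where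
    g': "\<And>r x. r \<in> {0..h} \<Longrightarrow> x \<in> X \<Longrightarrow> ((\<lambda>r. g r x) has_vector_derivative g' r x) (at r within {0..h})"
    "rbd h X M (Suc n) (\<lambda>x. A x * M x) g'" by blast
  show ?case by (rule rbd_SucI[OF rbd_0[OF Suc.prems] g'(1) Suc.IH[OF g'(2)]])
qed (auto simp: rbd.simps(2))

lemma rbd_le:
  assumes "rbd h X M n A g" "m \<le> n"
  shows "rbd h X M m A g"
  using assms(2,1) by (induction rule: inc_induct) (auto dest: rbd_SucD)

lemma rbd_cong:
  assumes "rbd h X M n A g" "\<And>r x. r \<in> {0..h} \<Longrightarrow> x \<in> X \<Longrightarrow> g r x = g' r x"
  shows "rbd h X M n A g'"
proof -
  have 0: "rbd h X M 0 A g'"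
    using rbd_0[OF assms(1)] assms(2) by (auto elim!: continuous_on_eq)
  show ?thesis
  proof (cases n)
    case (Suc m)
    from rbd_SucE[OF assms(1)[unfolded Suc]] obtain g1 where
      g1: "\<And>r x. r \<in> {0..h} \<Longrightarrow> x \<in> X \<Longrightarrow> ((\<lambda>r. g r x) has_vector_derivative g1 r x) (at r within {0..h})"
      "rbd h X M m (\<lambda>x. A x * M x) g1" by blast
    show ?thesis unfolding Suc
      by (rule rbd_SucI[OF 0 _ g1(2)], rule has_vector_derivative_transform[OF _ _ g1(1)]) (use assms(2) in auto)
  qed (use 0 in simp)
qed

lemma rbd_subset:
  assumes "rbd h X M n A g" "Y \<subseteq> X"
  shows "rbd h Y M n A g"
  using assms(1)
proof (induction n arbitrary: A g)
  case 0
  then show ?case using assms(2) by (auto elim!: continuous_on_subset)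
next
  case (Suc n)
  from rbd_SucE[OF Suc.prems(1)] obtain g' where
    g': "\<And>r x. r \<in> {0..h} \<Longrightarrow> x \<in> X \<Longrightarrow> ((\<lambda>r. g r x) has_vector_derivative g' r x) (at r within {0..h})"
    "rbd h X M n (\<lambda>x. A x * M x) g'" by blast
  have "rbd h Y M 0 A g"
    using rbd_0[OF Suc.prems] assms(2) by (auto elim!: continuous_on_subset)
  then show ?case by (rule rbd_SucI[OF _ g'(1) Suc.IH[OF g'(2)]]) (use assms(2) in auto)
qed

lemma rbd_add:
  "rbd h X M n A g \<Longrightarrow> rbd h X M n A' g' \<Longrightarrow> rbd h X M n (\<lambda>x. A x + A' x) (\<lambda>r x. g r x + g' r x)"
proof (induction n arbitrary: A A' g g')
  case 0
  then show ?case
    by (auto simp: case_prod_unfold intro!: continuous_intros order_trans[OF norm_triangle_ineq] add_mono)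
next
  case (Suc n)
  from rbd_SucE[OF Suc.prems(1)] obtain g1 where
    g1: "\<And>r x. r \<in> {0..h} \<Longrightarrow> x \<in> X \<Longrightarrow> ((\<lambda>r. g r x) has_vector_derivative g1 r x) (at r within {0..h})"
    "rbd h X M n (\<lambda>x. A x * M x) g1" by blast
  from rbd_SucE[OF Suc.prems(2)] obtain g1' where
    g1': "\<And>r x. r \<in> {0..h} \<Longrightarrow> x \<in> X \<Longrightarrow> ((\<lambda>r. g' r x) has_vector_derivative g1' r x) (at r within {0..h})"
    "rbd h X M n (\<lambda>x. A' x * M x) g1'" by blast
  have 0: "rbd h X M 0 (\<lambda>x. A x + A' x) (\<lambda>r x. g r x + g' r x)"
    using rbd_0[OF Suc.prems(1)] rbd_0[OF Suc.prems(2)]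
    by (auto simp: case_prod_unfold intro!: continuous_intros order_trans[OF norm_triangle_ineq] add_mono)
  show ?case
    by (rule rbd_SucI[OF 0 has_vector_derivative_add[OF g1(1) g1'(1)]])
      (use Suc.IH[OF g1(2) g1'(2)] in \<open>auto simp: algebra_simps\<close>)
qed

lemma rbd_const:
  assumes "continuous_on X v" "\<And>x. x \<in> X \<Longrightarrow> norm (v x) \<le> A x" "\<And>x. x \<in> X \<Longrightarrow> 0 \<le> M x"
  shows "rbd h X M n A (\<lambda>r. v)"
  using assms(1,2)
proof (induction n arbitrary: A v)
  case 0
  then show ?case
    by (auto simp: case_prod_unfold intro!: continuous_on_compose2[OF 0(1)] continuous_intros)
next
  case (Suc n)
  have "rbd h X M 0 A (\<lambda>r. v)"
    using Suc.prems by (auto simp: case_prod_unfold intro!: continuous_on_compose2[OF Suc.prems(1)] continuous_intros)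
  moreover have "0 \<le> A x" if "x \<in> X" for x
    using Suc.prems(2)[OF that] norm_ge_zero order_trans by blast
  ultimately show ?case
    by (rule_tac rbd_SucI[where g'="\<lambda>r x. 0"])
      (use assms(3) in \<open>auto intro!: Suc.IH continuous_intros\<close>)
qed

lemma rbd_bounded_linear:
  assumes f: "bounded_linear f" and K: "\<And>v. norm (f v) \<le> K * norm v" "0 \<le> K" and "rbd h X M n A g"
  shows "rbd h X M n (\<lambda>x. K * A x) (\<lambda>r x. f (g r x))"
  using assms(4)
proof (induction n arbitrary: A g)
  case 0
  then show ?case
    using K(2) by (auto simp: case_prod_unfold intro!: bounded_linear.continuous_on[OF f] order_trans[OF K(1)] mult_left_mono)
next
  case (Suc n)
  from rbd_SucE[OF Suc.prems(1)] obtain g' where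
    g': "\<And>r x. r \<in> {0..h} \<Longrightarrow> x \<in> X \<Longrightarrow> ((\<lambda>r. g r x) has_vector_derivative g' r x) (at r within {0..h})"
    "rbd h X M n (\<lambda>x. A x * M x) g'" by blast
  have 0: "rbd h X M 0 (\<lambda>x. K * A x) (\<lambda>r x. f (g r x))"
    using rbd_0[OF Suc.prems] K(2)
    by (auto simp: case_prod_unfold intro!: bounded_linear.continuous_on[OF f] order_trans[OF K(1)] mult_left_mono)
  show ?case
    by (rule rbd_SucI[OF 0 bounded_linear.has_vector_derivative[OF f g'(1)]])
      (use Suc.IH[OF g'(2)] in \<open>auto simp: mult.assoc\<close>)
qed

lemma rbd_scaleR: "rbd h X M n A g \<Longrightarrow> rbd h X M n (\<lambda>x. \<bar>c\<bar> * A x) (\<lambda>r x. c *\<^sub>R g r x)"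
  by (rule rbd_bounded_linear[OF bounded_linear_scaleR_right]) auto

lemma rbd_sum:
  assumes "finite S" "\<And>l. l \<in> S \<Longrightarrow> rbd h X M n (A l) (g l)" "\<And>x. x \<in> X \<Longrightarrow> 0 \<le> M x"
  shows "rbd h X M n (\<lambda>x. \<Sum>l\<in>S. A l x) (\<lambda>r x. \<Sum>l\<in>S. g l r x)"
  using assms(1,2)
  by (induction S rule: finite_induct) (auto intro!: rbd_add rbd_const assms(3))

text \<open>The factor \<open>d\<close> is the price of passing from the maximum norm to the
  \<open>l^1\<close> norm. In the stage bounds it meets a factor \<open>L\<close> and is absorbed by
  \<open>dL_le_M\<close> or \<open>hdL\<close>.\<close>

lemma rbd_vec:
  assumes "\<And>i. i < d \<Longrightarrow> rbd h X M n A (\<lambda>r x. coord (g r x) i)" "\<And>x. x \<in> X \<Longrightarrow> 0 \<le> M x"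
    "\<And>r x. r \<in> {0..h} \<Longrightarrow> x \<in> X \<Longrightarrow> g r x \<in> Rn d"
  shows "rbd h X M n (\<lambda>x. real d * A x) g"
proof -
  have "rbd h X M n (\<lambda>x. 1 * A x) (\<lambda>r x. coord (g r x) i *\<^sub>R unit_vec i)" if "i < d" for i
    using assms(1)[OF that] by (intro rbd_bounded_linear[OF bounded_linear_scaleR_left]) auto
  then have "rbd h X M n (\<lambda>x. \<Sum>i<d. A x) (\<lambda>r x. \<Sum>i<d. coord (g r x) i *\<^sub>R unit_vec i)"
    using assms(2) by (intro rbd_sum) auto
  then have "rbd h X M n (\<lambda>x. real d * A x) (\<lambda>r x. \<Sum>i<d. coord (g r x) i *\<^sub>R unit_vec i)"
    by simp
  then show ?thesis
    by (rule rbd_cong) (rule Rn_expand[OF assms(3), symmetric])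
qed

lemma norm_sum_coord_le:
  fixes G :: "nat \<Rightarrow> 'a::real_normed_vector"
  assumes "norm u \<le> A'" "\<And>q. q < d \<Longrightarrow> norm (G q) \<le> A" "0 \<le> A"
  shows "norm (\<Sum>q<d. coord u q *\<^sub>R G q) \<le> A * A'"
proof -
  have "norm (\<Sum>q<d. coord u q *\<^sub>R G q) \<le> (\<Sum>q<d. \<bar>coord u q\<bar> * A)"
    using assms(2) by (intro order_trans[OF norm_sum] sum_mono) (auto intro: mult_left_mono)
  also have "\<dots> \<le> A * A'"
    using order_trans[OF sum_abs_coord_le_norm assms(1), of d] assms(3)
    by (simp add: sum_distrib_right[symmetric] mult.commute[of _ A] sum_distrib_left[symmetric] mult_left_mono)
  finally show ?thesis .
qed

text \<open>Hoelder: the maximum norm of \<open>G\<close> is paired with the \<open>l\<^sup>1\<close> norm of \<open>u\<close>, which is the library norm.\<close>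

lemma rbd_pair:
  fixes G :: "nat \<Rightarrow> real \<Rightarrow> 'x::topological_space \<Rightarrow> real"
  assumes G: "\<And>q. q < d \<Longrightarrow> rbd h X M n A (G q)" and u: "rbd h X M n A' u"
    and A: "\<And>x. x \<in> X \<Longrightarrow> 0 \<le> A x" and M: "\<And>x. x \<in> X \<Longrightarrow> 0 \<le> M x" and h: "0 \<le> h"
  shows "rbd h X M n (\<lambda>x. 2 ^ n * (A x * A' x)) (\<lambda>r x. \<Sum>q<d. coord (u r x) q *\<^sub>R G q r x)"
proof -
  have zero: "rbd h X M 0 (\<lambda>x. A x * A' x) (\<lambda>r x. \<Sum>q<d. coord (u r x) q *\<^sub>R G q r x)"
    if G: "\<And>q. q < d \<Longrightarrow> rbd h X M n A (G q)" and u: "rbd h X M n A' u" and A: "\<And>x. x \<in> X \<Longrightarrow> 0 \<le> A x" for n A A' u G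
    unfolding rbd.simps(1)
  proof (intro conjI ballI)
    show "continuous_on ({0..h} \<times> X) (\<lambda>(r, x). \<Sum>q<d. coord (u r x) q *\<^sub>R G q r x)"
      using rbd_cont[OF G] rbd_cont[OF u] by (auto simp: case_prod_unfold intro!: continuous_intros)
    show "norm (\<Sum>q<d. coord (u r x) q *\<^sub>R G q r x) \<le> A x * A' x" if "r \<in> {0..h}" "x \<in> X" for r x
      using rbd_bound[OF G] rbd_bound[OF u] A that by (intro norm_sum_coord_le) auto
  qed
  show ?thesis using assms(1-3)
  proof (induction n arbitrary: A A' G u)
    case 0
    show ?case using zero[OF "0.prems"] by simp
  next
    case (Suc n)
    have A': "0 \<le> A' x" if "x \<in> X" for x
      using order_trans[OF norm_ge_zero rbd_bound[OF Suc.prems(2), of 0 x]] h that by simp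
    have "\<exists>g'. (\<forall>r\<in>{0..h}. \<forall>x\<in>X. ((\<lambda>r. G q r x) has_vector_derivative g' r x) (at r within {0..h})) \<and>
       rbd h X M n (\<lambda>x. A x * M x) g'" if "q < d" for q
      using Suc.prems(1)[OF that] by (auto simp: rbd.simps(2))
    then obtain G' where G': "\<And>q r x. q < d \<Longrightarrow> r \<in> {0..h} \<Longrightarrow> x \<in> X \<Longrightarrow> ((\<lambda>r. G q r x) has_vector_derivative G' q r x) (at r within {0..h})"
       "\<And>q. q < d \<Longrightarrow> rbd h X M n (\<lambda>x. A x * M x) (G' q)" by metis
    from rbd_SucE[OF Suc.prems(2)] obtain u' where
      u': "\<And>r x. r \<in> {0..h} \<Longrightarrow> x \<in> X \<Longrightarrow> ((\<lambda>r. u r x) has_vector_derivative u' r x) (at r within {0..h})"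
      "rbd h X M n (\<lambda>x. A' x * M x) u'" by blast
    show ?case
    proof (rule rbd_SucI)
      have "A x * A' x \<le> 2 ^ Suc n * (A x * A' x)" if "x \<in> X" for x
        using Suc.prems(3)[OF that] A'[OF that] mult_right_mono[of 1 "2 ^ Suc n" "A x * A' x"] by (simp del: power_Suc)
      moreover have "rbd h X M 0 (\<lambda>x. A x * A' x) (\<lambda>r x. \<Sum>q<d. coord (u r x) q *\<^sub>R G q r x)"
        using Suc.prems by (rule zero)
      ultimately show "rbd h X M 0 (\<lambda>x. 2 ^ Suc n * (A x * A' x)) (\<lambda>r x. \<Sum>q<d. coord (u r x) q *\<^sub>R G q r x)"
        using M by (rule_tac rbd_mono) auto
    next
      fix r x assume rx: "r \<in> {0..h}" "x \<in> X"
      show "((\<lambda>r. \<Sum>q<d. coord (u r x) q *\<^sub>R G q r x) has_vector_derivative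
          (\<Sum>q<d. coord (u r x) q *\<^sub>R G' q r x) + (\<Sum>q<d. coord (u' r x) q *\<^sub>R G q r x)) (at r within {0..h})"
        unfolding sum.distrib[symmetric]
        by (intro has_vector_derivative_sum has_vector_derivative_scaleR)
          (use rx G' has_vector_derivative_coord[OF u'(1)] in \<open>auto simp: has_real_derivative_iff_has_vector_derivative\<close>)
    next
      \<comment> \<open>The product rule yields two terms with the same bound, hence one factor
        \<open>2\<close> per derivative.\<close>
      have 1: "rbd h X M n (\<lambda>x. 2 ^ n * ((A x * M x) * A' x)) (\<lambda>r x. \<Sum>q<d. coord (u r x) q *\<^sub>R G' q r x)"
        using G' Suc.prems M by (intro Suc.IH) (auto intro: rbd_SucD)
      have 2: "rbd h X M n (\<lambda>x. 2 ^ n * (A x * (A' x * M x))) (\<lambda>r x. \<Sum>q<d. coord (u' r x) q *\<^sub>R G q r x)"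
        using u' Suc.prems M by (intro Suc.IH) (auto intro: rbd_SucD)
      show "rbd h X M n (\<lambda>x. 2 ^ Suc n * (A x * A' x) * M x)
        (\<lambda>r x. (\<Sum>q<d. coord (u r x) q *\<^sub>R G' q r x) + (\<Sum>q<d. coord (u' r x) q *\<^sub>R G q r x))"
        using rbd_add[OF 1 2] by (simp add: algebra_simps)
    qed
  qed
qed

text \<open>The \<open>m\<close>-th derivative of \<open>r g\<close> is \<open>r\<close> times that
  of \<open>g\<close> plus \<open>m\<close> times the previous one. The shortness of the step pays
  for the first term; the second has one derivative fewer and is allowed one \<open>M\<close> more.
  These are the last two hypotheses, and \<open>Suc n\<close> counts the terms.\<close>

lemma rbd_times_r:
  assumes h: "0 \<le> h" and M: "\<And>x. x \<in> X \<Longrightarrow> 0 \<le> M x" and "rbd h X M n A g"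
    "\<And>x. x \<in> X \<Longrightarrow> h * A x \<le> A' x" "\<And>x. x \<in> X \<Longrightarrow> A x \<le> A' x * M x"
  shows "rbd h X M n (\<lambda>x. real (Suc n) * A' x) (\<lambda>r x. r *\<^sub>R g r x)"
  using assms(3-)
proof (induction n arbitrary: A A' g)
  case 0
  have "r * norm (g r x) \<le> h * A x" if "r \<in> {0..h}" "x \<in> X" for r x
    using rbd_bound[OF 0(1) that] that by (intro mult_mono) auto
  with 0 show ?case
    by (auto simp: case_prod_unfold intro!: continuous_intros) (metis atLeastAtMost_iff order_trans)
next
  case (Suc n)
  have A: "0 \<le> A x" if "x \<in> X" for x
    using order_trans[OF norm_ge_zero rbd_bound[OF Suc.prems(1), of 0 x]] h that by simp
  have A': "0 \<le> A' x" if "x \<in> X" for x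
    using order_trans[OF _ Suc.prems(2)[OF that]] A[OF that] h by simp
  from rbd_SucE[OF Suc.prems(1)] obtain g' where
    g': "\<And>r x. r \<in> {0..h} \<Longrightarrow> x \<in> X \<Longrightarrow> ((\<lambda>r. g r x) has_vector_derivative g' r x) (at r within {0..h})"
    "rbd h X M n (\<lambda>x. A x * M x) g'" by blast
  show ?case
  proof (rule rbd_SucI)
    have "r * norm (g r x) \<le> real (Suc (Suc n)) * A' x" if "r \<in> {0..h}" "x \<in> X" for r x
    proof -
      have "r * norm (g r x) \<le> h * A x"
        using rbd_bound[OF Suc.prems(1) that] that by (intro mult_mono) auto
      also have "\<dots> \<le> 1 * A' x" using Suc.prems(2) that by simp
      also have "\<dots> \<le> real (Suc (Suc n)) * A' x" using A' that by (intro mult_right_mono) auto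
      finally show ?thesis .
    qed
    then show "rbd h X M 0 (\<lambda>x. real (Suc (Suc n)) * A' x) (\<lambda>r x. r *\<^sub>R g r x)"
      using rbd_cont[OF Suc.prems(1)] by (auto simp: case_prod_unfold intro!: continuous_intros)
  next
    fix r x assume "r \<in> {0..h}" "x \<in> X"
    then show "((\<lambda>r. r *\<^sub>R g r x) has_vector_derivative (r *\<^sub>R g' r x + 1 *\<^sub>R g r x)) (at r within {0..h})"
      using g'(1) by (intro has_vector_derivative_scaleR DERIV_ident)
  next
    have 1: "rbd h X M n (\<lambda>x. real (Suc n) * (A' x * M x)) (\<lambda>r x. r *\<^sub>R g' r x)"
      using g'(2) by (rule Suc.IH) (use Suc.prems M in \<open>auto simp flip: mult.assoc intro!: mult_right_mono\<close>)
    have 2: "rbd h X M n (\<lambda>x. A' x * M x) g"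
      using rbd_SucD[OF Suc.prems(1)] by (rule rbd_mono) (use Suc.prems M in auto)
    show "rbd h X M n (\<lambda>x. real (Suc (Suc n)) * A' x * M x) (\<lambda>r x. r *\<^sub>R g' r x + 1 *\<^sub>R g r x)"
      using rbd_add[OF 1 2] by (simp add: algebra_simps)
  qed
qed

text \<open>One chain rule per step: \<open>1\<close> for the derivative of \<open>g\<close> in
  time, \<open>2 ^ n * C\<close> for its pairing with \<open>u'\<close> by
  \<open>rbd_pair\<close>.\<close>

primrec comp_const :: "real \<Rightarrow> nat \<Rightarrow> real" where
  "comp_const C 0 = 1"
| "comp_const C (Suc n) = comp_const C n * (1 + 2 ^ n * C)"

lemma comp_const_ge_1: "0 \<le> C \<Longrightarrow> 1 \<le> comp_const C n"
proof (induction n)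
  case (Suc n)
  then have "1 * 1 \<le> comp_const C n * (1 + 2 ^ n * C)" by (intro mult_mono) auto
  then show ?case by simp
qed simp

lemma continuous_on_along:
  assumes "Ck_on I d m g" "continuous_on S \<sigma>" "continuous_on S u" "\<And>z. z \<in> S \<Longrightarrow> \<sigma> z \<in> I" "\<And>z. z \<in> S \<Longrightarrow> u z \<in> Rn d"
  shows "continuous_on S (\<lambda>z. g (\<sigma> z) (u z))"
proof -
  have "continuous_on S (\<lambda>z. (\<lambda>(t, x). g t x) (\<sigma> z, u z))"
    by (rule continuous_on_compose2[OF Ck_on_continuous[OF assms(1)]])
      (use assms in \<open>auto intro!: continuous_intros\<close>)
  then show ?thesis by simp
qed

text \<open>No formula for higher chain rules is required: the derivative of the composite is built
  from composites of \<open>partial_t g\<close> and \<open>partial_x q g\<close> with the same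
  curve, so the induction runs over all \<open>g\<close> at once. The size of \<open>u\<close> does
  not enter, since \<open>g\<close> is bounded uniformly; only \<open>u'\<close> has to be
  geometric. \<open>1 \<le> M\<close> lets the time derivative of \<open>g\<close> pass as one
  factor \<open>M\<close>.\<close>

lemma rbd_compose:
  fixes g :: "real \<Rightarrow> rvec \<Rightarrow> real" and u :: "real \<Rightarrow> 'x::topological_space \<Rightarrow> rvec"
  assumes ab: "a < b" and \<sigma>: "\<And>r. r \<in> {0..h} \<Longrightarrow> t0 + r * c \<in> {a..b}" and c: "\<bar>c\<bar> \<le> 1" and h: "0 \<le> h"
    and M: "\<And>x. x \<in> X \<Longrightarrow> 1 \<le> M x" and C: "0 \<le> C"
    and u_in: "\<And>r x. r \<in> {0..h} \<Longrightarrow> x \<in> X \<Longrightarrow> u r x \<in> Rn d"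
    and u_cont: "continuous_on ({0..h} \<times> X) (\<lambda>(r, x). u r x)"
    and u': "\<And>r x. r \<in> {0..h} \<Longrightarrow> x \<in> X \<Longrightarrow> ((\<lambda>r. u r x) has_vector_derivative u' r x) (at r within {0..h})"
    and u'_bd: "rbd h X M m (\<lambda>x. C * M x) u'" and n: "n \<le> Suc m"
    and "Ck_on {a..b} d n g" "pd_bounded {a..b} d n A g" and A: "0 \<le> A"
  shows "rbd h X M n (\<lambda>x. comp_const C n * A) (\<lambda>r x. g (t0 + r * c) (u r x))"
proof -
  have M0: "0 \<le> M x" if "x \<in> X" for x using M[OF that] by simp
  have zero: "rbd h X M 0 (\<lambda>x. A) (\<lambda>r x. g (t0 + r * c) (u r x))"
    if g: "Ck_on {a..b} d n g" "pd_bounded {a..b} d n A g" for n and g :: "real \<Rightarrow> rvec \<Rightarrow> real"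
  proof -
    have "continuous_on ({0..h} \<times> X) (\<lambda>z. g (t0 + fst z * c) (u (fst z) (snd z)))"
      using u_cont \<sigma> u_in by (intro continuous_on_along[OF g(1)]) (auto simp: case_prod_unfold intro!: continuous_intros)
    then show ?thesis using pd_boundedD[OF g(2) \<sigma> u_in] by (auto simp: case_prod_unfold)
  qed
  show ?thesis using n \<open>Ck_on {a..b} d n g\<close> \<open>pd_bounded {a..b} d n A g\<close>
  proof (induction n arbitrary: g)
    case 0
    show ?case using zero[OF "0.prems"(2,3)] by simp
  next
    case (Suc n)
    let ?I = "{a..b}" and ?K = "comp_const C n * A"
    have K: "0 \<le> ?K" using comp_const_ge_1[OF C, of n] A by simp
    have dt: "rbd h X M n (\<lambda>x. ?K) (\<lambda>r x. partial_t ?I g (t0 + r * c) (u r x))"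
      using Suc.prems Ck_on_partial_t[OF Suc.prems(2)] pd_bounded_pd[OF Suc.prems(3), of None]
      by (intro Suc.IH) (auto simp: letters_def)
    have dx: "rbd h X M n (\<lambda>x. ?K) (\<lambda>r x. partial_x q (g (t0 + r * c)) (u r x))" if "q < d" for q
      using that Suc.prems pd_bounded_pd[OF Suc.prems(3), of "Some q"]
      by (intro Suc.IH Ck_on_partial_x) (auto simp: letters_def)
    have dt': "rbd h X M n (\<lambda>x. \<bar>c\<bar> * ?K) (\<lambda>r x. c *\<^sub>R partial_t ?I g (t0 + r * c) (u r x))"
      using dt by (rule rbd_scaleR)
    have dx': "rbd h X M n (\<lambda>x. 2 ^ n * (?K * (C * M x))) (\<lambda>r x. \<Sum>q<d. coord (u' r x) q *\<^sub>R partial_x q (g (t0 + r * c)) (u r x))"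
      using Suc.prems(1) K M0 h by (intro rbd_pair dx rbd_le[OF u'_bd]) auto
    show ?case
    proof (rule rbd_SucI)
      have "A \<le> comp_const C (Suc n) * A"
        using comp_const_ge_1[OF C, of "Suc n"] A mult_right_mono[of 1 "comp_const C (Suc n)" A] by simp
      then show "rbd h X M 0 (\<lambda>x. comp_const C (Suc n) * A) (\<lambda>r x. g (t0 + r * c) (u r x))"
        using zero[OF Suc.prems(2,3)] M0 by (rule_tac rbd_mono) auto
    next
      fix r x assume rx: "r \<in> {0..h}" "x \<in> X"
      show "((\<lambda>r. g (t0 + r * c) (u r x)) has_vector_derivative
          c *\<^sub>R partial_t ?I g (t0 + r * c) (u r x) + (\<Sum>q<d. coord (u' r x) q *\<^sub>R partial_x q (g (t0 + r * c)) (u r x)))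
          (at r within {0..h})"
        by (rule has_derivative_along_curve[OF ab Suc.prems(2)])
          (use rx u' u_in \<sigma> in \<open>auto intro!: derivative_eq_intros\<close>)
    next
      have "\<bar>c\<bar> * ?K + 2 ^ n * (?K * (C * M x)) \<le> comp_const C (Suc n) * A * M x" if "x \<in> X" for x
      proof -
        have "\<bar>c\<bar> * ?K \<le> 1 * ?K" using c K by (intro mult_right_mono) auto
        also have "\<dots> \<le> ?K * M x" using mult_left_mono[OF M[OF that] K] by simp
        finally show ?thesis by (simp add: algebra_simps)
      qed
      then show "rbd h X M n (\<lambda>x. comp_const C (Suc n) * A * M x)
         (\<lambda>r x. c *\<^sub>R partial_t ?I g (t0 + r * c) (u r x) + (\<Sum>q<d. coord (u' r x) q *\<^sub>R partial_x q (g (t0 + r * c)) (u r x)))"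
        using rbd_add[OF dt' dx'] M0 by (rule_tac rbd_mono) auto
    qed
  qed
qed

section \<open>Stages of the method\<close>

lemma norm2_nonneg [simp]: "0 \<le> norm2 d x"
  by (simp add: norm2_def)

lemma norm2_add_le: "norm2 d (x + y) \<le> norm2 d x + norm2 d y"
  using L2_set_triangle_ineq[of "coord x" "coord y" "{..<d}"] by (simp add: norm2_def L2_set_def)

lemma norm2_scaleR: "norm2 d (c *\<^sub>R x) = \<bar>c\<bar> * norm2 d x"
  by (simp add: norm2_def L2_set_def power_mult_distrib real_sqrt_mult flip: sum_distrib_left)

lemma norm2_sum_le: "norm2 d (\<Sum>l\<in>S. f l) \<le> (\<Sum>l\<in>S. norm2 d (f l))"
proof (induction S rule: infinite_finite_induct)
  case (insert l S)
  then show ?case using norm2_add_le[of d "f l" "\<Sum>l\<in>S. f l"] by simp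
qed (simp_all add: norm2_def L2_set_def)

lemma norm_le_norm2:
  assumes "x \<in> Rn d"
  shows "norm x \<le> sqrt (real d) * norm2 d x"
  using L2_set_mult_ineq[of "coord x" "\<lambda>_. 1" "{..<d}"] norm_Rn[OF assms]
  by (simp add: norm2_def L2_set_def mult.commute)

lemma norm_sum_scaleR_le:
  fixes v :: "nat \<Rightarrow> 'a::real_normed_vector"
  assumes "\<And>l. l \<in> S \<Longrightarrow> \<bar>a l\<bar> \<le> B" "\<And>l. l \<in> S \<Longrightarrow> norm (v l) \<le> K" "card S \<le> s" "0 \<le> B" "0 \<le> K"
  shows "norm (\<Sum>l\<in>S. a l *\<^sub>R v l) \<le> real s * B * K"
proof -
  have "norm (\<Sum>l\<in>S. a l *\<^sub>R v l) \<le> (\<Sum>l\<in>S. B * K)"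
    using assms by (intro order_trans[OF norm_sum] sum_mono) (auto intro!: mult_mono)
  also have "\<dots> \<le> real s * B * K"
    using assms by (simp add: mult.assoc mult_right_mono)
  finally show ?thesis .
qed

text \<open>\<open>p = n + 1\<close>. The constants are \<open>2 * L\<close> because the identity is
  added to the score. Size and derivatives are controlled separately: linear growth for
  \<open>V\<close>, uniform bounds from the first derivatives on.\<close>

locale rk_field =
  fixes ta tb :: real and d n :: nat and V :: "real \<Rightarrow> rvec \<Rightarrow> rvec" and L :: real
  assumes tab: "ta < tb" and d: "1 \<le> d" and L: "1 \<le> L"
    and V_in: "\<And>t x. t \<in> {ta..tb} \<Longrightarrow> x \<in> Rn d \<Longrightarrow> V t x \<in> Rn d"
    and V_Ck: "Ck_on {ta..tb} d (Suc (Suc n)) V"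
    and V_bd: "\<And>i l. i < d \<Longrightarrow> l \<in> letters d \<Longrightarrow>
      pd_bounded {ta..tb} d (Suc n) (2 * L) (pd {ta..tb} l (\<lambda>t x. coord (V t x) i))"
    and V_growth: "\<And>t x. t \<in> {ta..tb} \<Longrightarrow> x \<in> Rn d \<Longrightarrow> norm2 d (V t x) \<le> 2 * L * (sqrt (real d) + norm2 d x)"
begin

abbreviation "I \<equiv> {ta..tb}"

abbreviation Vc :: "nat \<Rightarrow> real \<Rightarrow> rvec \<Rightarrow> real" where
  "Vc i \<equiv> \<lambda>t x. coord (V t x) i"

lemma Vc_Ck: "Ck_on I d (Suc (Suc n)) (Vc i)"
  by (rule Ck_on_bounded_linear[OF bounded_linear_coord tab V_Ck])

lemma Vc_t_Ck: "Ck_on I d (Suc n) (partial_t I (Vc i))"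
  and Vc_x_Ck: "q < d \<Longrightarrow> Ck_on I d (Suc n) (\<lambda>t. partial_x q (Vc i t))"
  using Ck_on_partial_t[OF Vc_Ck] Ck_on_partial_x[OF Vc_Ck] by auto

lemma Vc_t_bd: "i < d \<Longrightarrow> pd_bounded I d (Suc n) (2 * L) (partial_t I (Vc i))"
  and Vc_x_bd: "i < d \<Longrightarrow> q < d \<Longrightarrow> pd_bounded I d (Suc n) (2 * L) (\<lambda>t. partial_x q (Vc i t))"
  using V_bd[of i None] V_bd[of i "Some q"] by (auto simp: letters_def)

lemma Vc_x_le: "i < d \<Longrightarrow> q < d \<Longrightarrow> t \<in> I \<Longrightarrow> x \<in> Rn d \<Longrightarrow> \<bar>partial_x q (Vc i t) x\<bar> \<le> 2 * L"
  using pd_boundedD[OF Vc_x_bd] by blast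

text \<open>The price of one derivative in \<open>r\<close>: up to a constant, \<open>M x\<close> bounds the \<open>l\<^sup>1\<close> norm of the stages by Cauchy--Schwarz,
  and also the factor \<open>d L\<close> lost in passing from the maximum norm to the \<open>l\<^sup>1\<close> norm.\<close>

definition M :: "rvec \<Rightarrow> real" where
  "M x = L * sqrt (real d) * (sqrt (real d) + norm2 d x)"

lemma dL_le_M: "real d * L \<le> M x"
proof -
  have "real d * L = L * sqrt (real d) * (sqrt (real d) + 0)" by simp
  also have "\<dots> \<le> M x" unfolding M_def using L by (intro mult_left_mono add_left_mono) auto
  finally show ?thesis .
qed

lemma dL_ge_1: "1 \<le> real d * L"
  using mult_mono[of 1 "real d" 1 L] d L by simp

lemma M_ge_1: "1 \<le> M x"
  using dL_le_M[of x] dL_ge_1 by simp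

lemma M_nonneg [simp]: "0 \<le> M x"
  using M_ge_1[of x] by simp

lemma has_derivative_V_along:
  assumes \<sigma>: "(\<sigma> has_real_derivative \<sigma>') (at r within S)" and u: "(u has_vector_derivative u') (at r within S)"
    and "\<And>r. r \<in> S \<Longrightarrow> \<sigma> r \<in> I" "\<And>r. r \<in> S \<Longrightarrow> u r \<in> Rn d" and r: "r \<in> S"
  shows "((\<lambda>r. V (\<sigma> r) (u r)) has_vector_derivative
    \<sigma>' *\<^sub>R partial_t I V (\<sigma> r) (u r) + (\<Sum>q<d. coord u' q *\<^sub>R partial_x q (V (\<sigma> r)) (u r))) (at r within S)"
  by (rule has_derivative_along_curve[OF tab V_Ck assms])

lemma coord_partial_t: "t \<in> I \<Longrightarrow> x \<in> Rn d \<Longrightarrow> coord (partial_t I V t x) i = partial_t I (Vc i) t x"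
  unfolding partial_t_def[of I "Vc i"]
  using has_vector_derivative_coord[OF Ck_on_has_partial_t[OF V_Ck]] vector_derivative_within_Icc[OF tab] by metis

lemma coord_partial_x:
  assumes "t \<in> I" "x \<in> Rn d" "q < d"
  shows "coord (partial_x q (V t) x) i = partial_x q (Vc i t) x"
  unfolding partial_x_def[of q "Vc i t"]
  by (rule vector_derivative_at[symmetric])
    (use has_vector_derivative_coord[OF Ck_on_has_partial_x[OF V_Ck assms, where v=0]] in simp)

text \<open>The gradient in the maximum norm is paired with \<open>x - y\<close> in the
  \<open>l^1\<close> norm, hence no factor \<open>d\<close>. Needed for the Picard iteration and for
  comparing \<open>V\<close> along the exact and the numerical solution.\<close>

lemma coord_V_lipschitz:
  assumes "i < d" "t \<in> I" "x \<in> Rn d" "y \<in> Rn d"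
  shows "\<bar>coord (V t x) i - coord (V t y) i\<bar> \<le> 2 * L * norm (x - y)"
proof -
  have "norm (Vc i t x - Vc i t y) \<le> 2 * L * norm (x - y)"
  proof (rule differentiable_bound[OF convex_Rn])
    fix z assume z: "z \<in> Rn d"
    show "(Vc i t has_derivative (\<lambda>v. \<Sum>q<d. coord v q *\<^sub>R partial_x q (Vc i t) z)) (at z within Rn d)"
    proof (rule has_derivative_partials)
      show "has_partial q (Vc i t) y (partial_x q (Vc i t) y)"
        if "q < d" "y \<in> Rn d" for q y
        using Ck_on_has_partial_x[OF Vc_Ck assms(2) that(2,1), where v=0] by simp
      show "continuous_on (Rn d) (partial_x q (Vc i t))" if "q < d" for q
        using continuous_on_along[OF Vc_x_Ck[OF that], of "Rn d" "\<lambda>_. t" "\<lambda>x. x"] assms(2)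
        by (auto intro: continuous_intros)
    qed fact
    show "onorm (\<lambda>v. \<Sum>q<d. coord v q *\<^sub>R partial_x q (Vc i t) z) \<le> 2 * L"
    proof (rule onorm_bound)
      show "0 \<le> 2 * L" using L by simp
      show "norm (\<Sum>q<d. coord v q *\<^sub>R partial_x q (Vc i t) z) \<le> 2 * L * norm v" for v
        using Vc_x_le[OF assms(1) _ assms(2) z] L by (intro norm_sum_coord_le) auto
    qed
  qed (use assms in auto)
  then show ?thesis by simp
qed

end

text \<open>Row \<open>s + 1\<close> of the tableau holds the weights of the method, so the argument of the stage \<open>s + 1\<close> is the
  one-step map and its value is the field there.\<close>

locale rk_stages = rk_field +
  fixes s :: nat and a :: "nat \<Rightarrow> nat \<Rightarrow> real" and c :: "nat \<Rightarrow> real" and B t0 h :: real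
  assumes h: "0 < h" and t0: "ta \<le> t0" "t0 + h \<le> tb" and B: "1 \<le> B"
    and a_le: "\<And>j l. 1 \<le> l \<Longrightarrow> l < j \<Longrightarrow> j \<le> Suc s \<Longrightarrow> \<bar>a j l\<bar> \<le> B"
    and c_in: "\<And>j. j \<in> {1..Suc s} \<Longrightarrow> c j \<in> {0..1}"
    and s: "1 \<le> s"
    and step: "8 * real s * B * h * real d * L \<le> 1"
begin

abbreviation "J \<equiv> {0..h}"

definition k :: "nat \<Rightarrow> real \<Rightarrow> rvec \<Rightarrow> rvec" where
  "k j r x = rk_stage V a c t0 r x j"

definition u :: "nat \<Rightarrow> real \<Rightarrow> rvec \<Rightarrow> rvec" where
  "u j r x = x + r *\<^sub>R (\<Sum>l\<in>{1..<j}. a j l *\<^sub>R k l r x)"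

lemma k_eq: "k j r x = V (t0 + r * c j) (u j r x)"
  unfolding k_def u_def by (rule rk_stage.simps)

lemma time_in:
  assumes "j \<in> {1..Suc s}" "r \<in> J"
  shows "t0 + r * c j \<in> I"
proof -
  have "r * c j \<le> h * 1" using assms c_in[OF assms(1)] by (intro mult_mono) auto
  moreover have "0 \<le> r * c j" using assms c_in[OF assms(1)] by auto
  ultimately show ?thesis using t0 by auto
qed

lemma k_in:
  assumes "j \<in> {1..Suc s}" "r \<in> J" "x \<in> Rn d"
  shows "k j r x \<in> Rn d"
  using assms(1)
proof (induction j rule: less_induct)
  case (less j)
  have "u j r x \<in> Rn d" unfolding u_def
    using less by (intro Rn_add Rn_scaleR Rn_sum assms) auto
  then show ?case unfolding k_eq by (intro V_in time_in assms less)
qed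

lemma u_in:
  assumes "j \<in> {1..Suc s}" "r \<in> J" "x \<in> Rn d"
  shows "u j r x \<in> Rn d"
  unfolding u_def using assms by (intro Rn_add Rn_scaleR Rn_sum k_in) auto

text \<open>The step condition in the form in which displacements use it: in both applications
  \<open>K\<close> is four times some quantity, so the displacement is at most half of that
  quantity.\<close>

lemma hsB: "r \<in> J \<Longrightarrow> 0 \<le> K \<Longrightarrow> r * (real s * B * (real d * L * K)) \<le> K / 8"
proof -
  assume r: "r \<in> J" and K: "0 \<le> K"
  have "r * (real s * B * (real d * L * K)) \<le> h * (real s * B * (real d * L * K))"
    using r K B L by (intro mult_right_mono) auto
  also have "\<dots> = (8 * real s * B * h * real d * L) * (K / 8)" by simp
  also have "\<dots> \<le> 1 * (K / 8)" using step K by (intro mult_right_mono) auto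
  finally show ?thesis by simp
qed

lemma hdL: "h * (real d * L) \<le> 1"
proof -
  have "1 * (h * (real d * L)) \<le> (8 * real s * B) * (h * (real d * L))"
  proof (rule mult_right_mono)
    have "1 * 1 \<le> (8 * real s) * B" using s B by (intro mult_mono) auto
    then show "1 \<le> 8 * real s * B" by simp
  qed (use h L in auto)
  also have "\<dots> \<le> 1" using step by (simp add: mult.assoc)
  finally show ?thesis by simp
qed

lemma sB_ge_1: "1 \<le> real s * B"
  using mult_mono[of 1 "real s" 1 B] s B by simp

lemma card_stages: "j \<in> {1..Suc s} \<Longrightarrow> card {1..<j} \<le> s"
  by auto

lemma norm2_u_minus_le:
  assumes j: "j \<in> {1..Suc s}" and r: "r \<in> J"
    and k: "\<And>l. l \<in> {1..<j} \<Longrightarrow> norm2 d (k l r x) \<le> 4 * L * (sqrt (real d) + norm2 d x)"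
  shows "norm2 d (u j r x - x) \<le> (sqrt (real d) + norm2 d x) / 2"
proof -
  let ?m = "sqrt (real d) + norm2 d x"
  have "norm2 d (\<Sum>l\<in>{1..<j}. a j l *\<^sub>R k l r x) \<le> (\<Sum>l\<in>{1..<j}. B * (4 * L * ?m))"
    using j a_le k B L unfolding norm2_scaleR[symmetric]
    by (intro order_trans[OF norm2_sum_le] sum_mono) (auto simp: norm2_scaleR intro!: mult_mono)
  also have "\<dots> \<le> real s * (B * (4 * L * ?m))"
    using card_stages[OF j] B L by (auto intro!: mult_right_mono)
  also have "\<dots> \<le> real s * B * (real d * L * (4 * ?m))"
  proof -
    have "real s * (B * (4 * L * ?m)) = 1 * (real s * B * (L * (4 * ?m)))" by simp
    also have "\<dots> \<le> real d * (real s * B * (L * (4 * ?m)))" using d B L by (intro mult_right_mono) auto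
    finally show ?thesis by (simp add: ac_simps)
  qed
  finally have "norm2 d (u j r x - x) \<le> r * (real s * B * (real d * L * (4 * ?m)))"
    using r by (auto simp: u_def norm2_scaleR intro: mult_left_mono)
  also have "\<dots> \<le> ?m / 2" using hsB[OF r, of "4 * ?m"] by simp
  finally show ?thesis .
qed

text \<open>The bound reproduces itself: if earlier stages obey it, the argument moves by at most
  half of \<open>sqrt d + norm2 d x\<close>, so the growth bound \<open>2 * L\<close> at most
  doubles.\<close>

lemma norm2_k_le:
  assumes "j \<in> {1..Suc s}" "r \<in> J" "x \<in> Rn d"
  shows "norm2 d (k j r x) \<le> 4 * L * (sqrt (real d) + norm2 d x)"
  using assms(1)
proof (induction j rule: less_induct)
  case (less j)
  let ?m = "sqrt (real d) + norm2 d x"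
  have "norm2 d (u j r x) \<le> norm2 d x + norm2 d (u j r x - x)"
    using norm2_add_le[of d x "u j r x - x"] by simp
  also have "norm2 d (u j r x - x) \<le> ?m / 2"
    using less by (intro norm2_u_minus_le assms) auto
  finally have "norm2 d (u j r x) \<le> norm2 d x + ?m / 2" by simp
  moreover have "0 \<le> sqrt (real d)" "0 \<le> norm2 d x" by simp_all
  ultimately have "sqrt (real d) + norm2 d (u j r x) \<le> 2 * ?m" by argo
  then have "2 * L * (sqrt (real d) + norm2 d (u j r x)) \<le> 2 * L * (2 * ?m)"
    using L by (intro mult_left_mono) auto
  then show ?case
    using V_growth[OF time_in[OF less.prems assms(2)] u_in[OF less.prems assms(2,3)]] unfolding k_eq by (simp add: algebra_simps)
qed

lemma norm2_u_le:
  assumes "j \<in> {1..Suc s}" "r \<in> J" "x \<in> Rn d"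
  shows "norm2 d (u j r x - x) \<le> (sqrt (real d) + norm2 d x) / 2"
  using assms by (intro norm2_u_minus_le norm2_k_le) auto

lemma norm_k_le:
  assumes "j \<in> {1..Suc s}" "r \<in> J" "x \<in> Rn d"
  shows "norm (k j r x) \<le> 4 * M x"
proof -
  have "norm (k j r x) \<le> sqrt (real d) * norm2 d (k j r x)"
    using k_in[OF assms] by (rule norm_le_norm2)
  also have "\<dots> \<le> sqrt (real d) * (4 * L * (sqrt (real d) + norm2 d x))"
    using norm2_k_le[OF assms] by (intro mult_left_mono) auto
  finally show ?thesis by (simp add: M_def ac_simps)
qed

lemma continuous_u_aux:
  assumes "\<And>l. l \<in> {1..<j} \<Longrightarrow> continuous_on (J \<times> Rn d) (\<lambda>(r, x). k l r x)"
  shows "continuous_on (J \<times> Rn d) (\<lambda>(r, x). u j r x)"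
  using assms unfolding u_def case_prod_unfold by (intro continuous_intros)

lemma continuous_k:
  assumes "j \<in> {1..Suc s}"
  shows "continuous_on (J \<times> Rn d) (\<lambda>(r, x). k j r x)"
  using assms
proof (induction j rule: less_induct)
  case (less j)
  have "continuous_on (J \<times> Rn d) (\<lambda>z. V (t0 + fst z * c j) (u j (fst z) (snd z)))"
    using continuous_u_aux[of j] less time_in u_in
    by (intro continuous_on_along[OF V_Ck]) (auto simp: case_prod_unfold intro!: continuous_intros)
  then show ?case by (simp add: k_eq case_prod_unfold)
qed

lemma continuous_u: "j \<in> {1..Suc s} \<Longrightarrow> continuous_on (J \<times> Rn d) (\<lambda>(r, x). u j r x)"
  by (intro continuous_u_aux continuous_k) auto

end

section \<open>Time derivatives of the stages\<close>

lemma has_vector_derivative_in_Rn: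
  assumes "a < b" "r \<in> {a..b}" "\<And>r. r \<in> {a..b} \<Longrightarrow> f r \<in> Rn d" "(f has_vector_derivative f') (at r within {a..b})"
  shows "f' \<in> Rn d"
  unfolding Rn_iff
proof (intro allI impI)
  fix i assume i: "d \<le> i"
  have "((\<lambda>r. 0) has_vector_derivative coord f' i) (at r within {a..b})"
    by (rule has_vector_derivative_transform[OF assms(2) _ has_vector_derivative_coord[OF assms(4), of i]])
      (use assms(3) i in \<open>auto simp: Rn_iff\<close>)
  then show "coord f' i = 0"
    using has_vector_derivative_unique_Icc[OF assms(1,2)] has_vector_derivative_const by blast
qed

text \<open>Read off from \<open>stage_deriv_Suc\<close>: if \<open>S\<close> serves for the earlier
  stages, \<open>C = s B (n + 2) S\<close> bounds the velocity of the argument in units of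
  \<open>M\<close>, where \<open>n + 2\<close> is \<open>n + 1\<close> for \<open>r k'\<close> plus
  \<open>1\<close> for \<open>k\<close>. The previous value is added to keep the sequence
  increasing. The start \<open>4\<close> is the constant of \<open>norm_k_le\<close>.\<close>

primrec stage_const :: "nat \<Rightarrow> nat \<Rightarrow> real \<Rightarrow> nat \<Rightarrow> real" where
  "stage_const n s B 0 = 4"
| "stage_const n s B (Suc j) = stage_const n s B j +
    2 * comp_const (real s * B * (real (n + 2) * stage_const n s B j)) (Suc n) *
      (1 + 2 ^ n * (real s * B * (real (n + 2) * stage_const n s B j)))"

text \<open>Read off from \<open>stage_tangent_Suc\<close>. \<open>K\<close> bounds derivatives of
  the field along the stages and is fixed beforehand; the \<open>1\<close> is the unit vector in
  \<open>ux\<close>. Here \<open>n + 2\<close> is the count of \<open>rbd_times_r\<close> at order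
  \<open>n + 1\<close>.\<close>

primrec tangent_const :: "nat \<Rightarrow> nat \<Rightarrow> real \<Rightarrow> real \<Rightarrow> nat \<Rightarrow> real" where
  "tangent_const n s B K 0 = 0"
| "tangent_const n s B K (Suc j) = tangent_const n s B K j +
    2 ^ Suc n * (2 * K * (1 + real s * B * (real (n + 2) * tangent_const n s B K j)))"

text \<open>A suffix \<open>d\<close> marks a derivative in \<open>r\<close>, a suffix \<open>x\<close> with index \<open>q\<close> a derivative in \<open>x\<^sub>q\<close>.\<close>

context rk_stages
begin

definition kd :: "nat \<Rightarrow> real \<Rightarrow> rvec \<Rightarrow> rvec" where
  "kd j r x = vector_derivative (\<lambda>r. k j r x) (at r within J)"

definition ud :: "nat \<Rightarrow> real \<Rightarrow> rvec \<Rightarrow> rvec" where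
  "ud j r x = (\<Sum>l\<in>{1..<j}. a j l *\<^sub>R (r *\<^sub>R kd l r x + k l r x))"

lemma u_alt: "u j r x = x + (\<Sum>l\<in>{1..<j}. a j l *\<^sub>R (r *\<^sub>R k l r x))"
  unfolding u_def scaleR_sum_right by (simp add: mult.commute[of r])

text \<open>The bound is coordinatewise and keeps one explicit \<open>L\<close>; this
  \<open>L\<close> survives as the factor in front of the final estimate.\<close>

definition stage_deriv :: "real \<Rightarrow> nat \<Rightarrow> bool" where
  "stage_deriv S j \<longleftrightarrow>
    (\<forall>r\<in>J. \<forall>x\<in>Rn d. ((\<lambda>r. k j r x) has_vector_derivative kd j r x) (at r within J)) \<and>
    (\<forall>i<d. rbd h (Rn d) M n (\<lambda>x. S * L * M x) (\<lambda>r x. coord (kd j r x) i))"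

lemma kd_in:
  assumes "stage_deriv S j" "j \<in> {1..Suc s}" "r \<in> J" "x \<in> Rn d"
  shows "kd j r x \<in> Rn d"
proof (rule has_vector_derivative_in_Rn[OF h assms(3)])
  show "((\<lambda>r. k j r x) has_vector_derivative kd j r x) (at r within J)"
    using assms unfolding stage_deriv_def by blast
qed (rule k_in[OF assms(2) _ assms(4)])

lemma sum_abs_a_le: "j \<in> {1..Suc s} \<Longrightarrow> 0 \<le> K \<Longrightarrow> (\<Sum>l\<in>{1..<j}. \<bar>a j l\<bar> * K) \<le> real s * B * K"
proof -
  assume j: "j \<in> {1..Suc s}" and K: "0 \<le> K"
  have "(\<Sum>l\<in>{1..<j}. \<bar>a j l\<bar> * K) \<le> (\<Sum>l\<in>{1..<j}. B * K)"
    using j a_le K by (intro sum_mono mult_right_mono) auto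
  also have "\<dots> \<le> real s * (B * K)"
    using card_stages[OF j] B K by (auto intro!: mult_right_mono)
  finally show ?thesis by (simp add: mult.assoc)
qed

lemma rbd_lincomb:
  assumes j: "j \<in> {1..Suc s}" and g: "\<And>l. l \<in> {1..<j} \<Longrightarrow> rbd h (Rn d) M m A (g l)" and A: "\<And>x. 0 \<le> A x"
  shows "rbd h (Rn d) M m (\<lambda>x. real s * B * A x) (\<lambda>r x. \<Sum>l\<in>{1..<j}. a j l *\<^sub>R g l r x)"
proof (rule rbd_mono)
  show "rbd h (Rn d) M m (\<lambda>x. \<Sum>l\<in>{1..<j}. \<bar>a j l\<bar> * A x) (\<lambda>r x. \<Sum>l\<in>{1..<j}. a j l *\<^sub>R g l r x)"
    by (intro rbd_sum rbd_scaleR g) auto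
qed (use sum_abs_a_le[OF j] A in auto)

text \<open>In the \<open>l^1\<close> norm the velocity loses \<open>d\<close>, and
  \<open>d * L\<close> counts as one more \<open>M\<close>. So \<open>k j\<close> itself obeys a
  geometric bound with \<open>n + 1\<close> derivatives, starting from the direct estimate
  \<open>4 * M x\<close>.\<close>

lemma rbd_k:
  assumes j: "j \<in> {1..Suc s}" and S: "4 \<le> S" and D: "stage_deriv S j"
  shows "rbd h (Rn d) M (Suc n) (\<lambda>x. S * M x) (k j)" "rbd h (Rn d) M n (\<lambda>x. real d * (S * L * M x)) (kd j)"
proof -
  show kd: "rbd h (Rn d) M n (\<lambda>x. real d * (S * L * M x)) (kd j)"
    using D kd_in[OF D j] by (intro rbd_vec) (auto simp: stage_deriv_def)
  show "rbd h (Rn d) M (Suc n) (\<lambda>x. S * M x) (k j)"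
  proof (rule rbd_SucI)
    have "norm (k j r x) \<le> S * M x" if "r \<in> J" "x \<in> Rn d" for r x
      using norm_k_le[OF j that] mult_right_mono[OF S, of "M x"] by simp
    then show "rbd h (Rn d) M 0 (\<lambda>x. S * M x) (k j)"
      using continuous_k[OF j] by auto
    show "((\<lambda>r. k j r x) has_vector_derivative kd j r x) (at r within J)" if "r \<in> J" "x \<in> Rn d" for r x
      using D that by (simp add: stage_deriv_def)
    have "real d * (S * L * M x) \<le> S * M x * M x" for x
      using mult_right_mono[OF dL_le_M[of x], of "S * M x"] S by (simp add: ac_simps)
    then show "rbd h (Rn d) M n (\<lambda>x. S * M x * M x) (kd j)"
      by (intro rbd_mono[OF kd]) auto
  qed
qed

lemma stage_deriv_u:
  assumes j: "j \<in> {1..Suc s}" and S: "4 \<le> S" and D: "\<And>l. l \<in> {1..<j} \<Longrightarrow> stage_deriv S l"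
  shows "\<And>r x. r \<in> J \<Longrightarrow> x \<in> Rn d \<Longrightarrow> ((\<lambda>r. u j r x) has_vector_derivative ud j r x) (at r within J)"
    and "rbd h (Rn d) M n (\<lambda>x. real s * B * (real (n + 2) * S) * M x) (ud j)"
proof -
  fix r x assume rx: "r \<in> J" "x \<in> Rn d"
  have "((\<lambda>r. x + (\<Sum>l\<in>{1..<j}. a j l *\<^sub>R (r *\<^sub>R k l r x))) has_vector_derivative
      0 + (\<Sum>l\<in>{1..<j}. a j l *\<^sub>R (r *\<^sub>R kd l r x + 1 *\<^sub>R k l r x))) (at r within J)"
    using D rx
    by (intro has_vector_derivative_add has_vector_derivative_const has_vector_derivative_sum
        bounded_linear.has_vector_derivative[OF bounded_linear_scaleR_right] has_vector_derivative_scaleR DERIV_ident)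
      (auto simp: stage_deriv_def)
  then show "((\<lambda>r. u j r x) has_vector_derivative ud j r x) (at r within J)"
    by (simp only: u_alt ud_def add_0_left scaleR_one)
next
  have "rbd h (Rn d) M n (\<lambda>x. real (Suc n) * (S * M x) + S * M x) (\<lambda>r x. r *\<^sub>R kd l r x + k l r x)"
    if l: "l \<in> {1..<j}" for l
  proof (rule rbd_add)
    note l' = rbd_k[of l S, OF _ S D[OF l]]
    show "rbd h (Rn d) M n (\<lambda>x. S * M x) (k l)"
      by (rule rbd_SucD, rule l') (use l j in auto)
    show "rbd h (Rn d) M n (\<lambda>x. real (Suc n) * (S * M x)) (\<lambda>r x. r *\<^sub>R kd l r x)"
    proof (rule rbd_times_r)
      show "rbd h (Rn d) M n (\<lambda>x. real d * (S * L * M x)) (kd l)"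
        using l j by (intro l') auto
      show "h * (real d * (S * L * M x)) \<le> S * M x" for x
        using mult_right_mono[OF hdL, of "S * M x"] S by (simp add: ac_simps)
      show "real d * (S * L * M x) \<le> S * M x * M x" for x
        using mult_right_mono[OF dL_le_M[of x], of "S * M x"] S by (simp add: ac_simps)
    qed (use h in auto)
  qed
  then have "rbd h (Rn d) M n (\<lambda>x. real s * B * (real (Suc n) * (S * M x) + S * M x)) (ud j)"
    unfolding ud_def using S by (intro rbd_lincomb j) auto
  then show "rbd h (Rn d) M n (\<lambda>x. real s * B * (real (n + 2) * S) * M x) (ud j)"
    by (rule rbd_mono) (auto simp: algebra_simps)
qed

lemma rbd_along_u:
  assumes j: "j \<in> {1..Suc s}" and S: "4 \<le> S" and D: "\<And>l. l \<in> {1..<j} \<Longrightarrow> stage_deriv S l"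
    and g: "Ck_on I d (Suc n) g" "pd_bounded I d (Suc n) (2 * L) g"
  shows "rbd h (Rn d) M (Suc n) (\<lambda>x. comp_const (real s * B * (real (n + 2) * S)) (Suc n) * (2 * L)) (\<lambda>r x. g (t0 + r * c j) (u j r x))"
proof (rule rbd_compose[OF tab])
  show "rbd h (Rn d) M n (\<lambda>x. real s * B * (real (n + 2) * S) * M x) (ud j)"
    using stage_deriv_u(2)[OF j S D] .
  show "((\<lambda>r. u j r x) has_vector_derivative ud j r x) (at r within J)" if "r \<in> J" "x \<in> Rn d" for r x
    using stage_deriv_u(1)[OF j S D that] .
qed (use j g h S B s L c_in[OF j] time_in u_in continuous_u M_ge_1 in auto)

lemma stage_deriv_Suc:
  assumes j: "j \<in> {1..Suc s}" and S: "4 \<le> S" and D: "\<And>l. l \<in> {1..<j} \<Longrightarrow> stage_deriv S l"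
    and S': "2 * comp_const (real s * B * (real (n + 2) * S)) (Suc n) * (1 + 2 ^ n * (real s * B * (real (n + 2) * S))) \<le> S'"
  shows "stage_deriv S' j"
proof -
  define C where "C = real s * B * (real (n + 2) * S)"
  define K where "K = comp_const C (Suc n)"
  have C: "0 \<le> C" using S B s by (simp add: C_def)
  have K: "1 \<le> K" unfolding K_def by (rule comp_const_ge_1[OF C])
  let ?D = "\<lambda>r x. c j *\<^sub>R partial_t I V (t0 + r * c j) (u j r x) +
    (\<Sum>q<d. coord (ud j r x) q *\<^sub>R partial_x q (V (t0 + r * c j)) (u j r x))"
  have hvd: "((\<lambda>r. k j r x) has_vector_derivative ?D r x) (at r within J)" if "r \<in> J" "x \<in> Rn d" for r x
    unfolding k_eq
    by (rule has_derivative_V_along) (use that j time_in u_in stage_deriv_u(1)[OF j S D] in \<open>auto intro!: derivative_eq_intros\<close>)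
  then have kd: "kd j r x = ?D r x" if "r \<in> J" "x \<in> Rn d" for r x
    unfolding kd_def using that vector_derivative_within_Icc[OF h] by blast
  have "rbd h (Rn d) M n (\<lambda>x. S' * L * M x) (\<lambda>r x. coord (kd j r x) i)" if i: "i < d" for i
  proof (rule rbd_cong)
    have "rbd h (Rn d) M n (\<lambda>x. \<bar>c j\<bar> * (K * (2 * L))) (\<lambda>r x. c j *\<^sub>R partial_t I (Vc i) (t0 + r * c j) (u j r x))"
      unfolding K_def C_def using i Vc_t_Ck Vc_t_bd by (intro rbd_scaleR rbd_SucD[OF rbd_along_u] j S D)
    moreover have "rbd h (Rn d) M n (\<lambda>x. 2 ^ n * ((K * (2 * L)) * (C * M x)))
        (\<lambda>r x. \<Sum>q<d. coord (ud j r x) q *\<^sub>R partial_x q (Vc i (t0 + r * c j)) (u j r x))"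
    proof (rule rbd_pair)
      show "rbd h (Rn d) M n (\<lambda>x. K * (2 * L)) (\<lambda>r x. partial_x q (Vc i (t0 + r * c j)) (u j r x))" if "q < d" for q
        unfolding K_def C_def by (intro rbd_SucD[OF rbd_along_u] j S D Vc_x_Ck Vc_x_bd that i)
      show "rbd h (Rn d) M n (\<lambda>x. C * M x) (ud j)"
        unfolding C_def using stage_deriv_u(2)[OF j S D] .
    qed (use K L h in auto)
    ultimately have "rbd h (Rn d) M n (\<lambda>x. \<bar>c j\<bar> * (K * (2 * L)) + 2 ^ n * ((K * (2 * L)) * (C * M x)))
      (\<lambda>r x. c j *\<^sub>R partial_t I (Vc i) (t0 + r * c j) (u j r x) +
        (\<Sum>q<d. coord (ud j r x) q *\<^sub>R partial_x q (Vc i (t0 + r * c j)) (u j r x)))"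
      by (rule rbd_add)
    then show "rbd h (Rn d) M n (\<lambda>x. S' * L * M x)
      (\<lambda>r x. c j *\<^sub>R partial_t I (Vc i) (t0 + r * c j) (u j r x) +
        (\<Sum>q<d. coord (ud j r x) q *\<^sub>R partial_x q (Vc i (t0 + r * c j)) (u j r x)))"
    proof (rule rbd_mono)
      fix x
      have "\<bar>c j\<bar> * (K * (2 * L)) \<le> M x * (K * (2 * L))"
        using c_in[OF j] M_ge_1[of x] K L by (intro mult_right_mono) auto
      then have "\<bar>c j\<bar> * (K * (2 * L)) + 2 ^ n * ((K * (2 * L)) * (C * M x)) \<le> 2 * K * (1 + 2 ^ n * C) * (L * M x)"
        by (simp add: algebra_simps)
      also have "\<dots> \<le> S' * (L * M x)"
        using S' L unfolding K_def C_def by (intro mult_right_mono) auto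
      finally show "\<bar>c j\<bar> * (K * (2 * L)) + 2 ^ n * ((K * (2 * L)) * (C * M x)) \<le> S' * L * M x"
        by (simp add: mult.assoc)
    qed auto
    show "c j *\<^sub>R partial_t I (Vc i) (t0 + r * c j) (u j r x) +
        (\<Sum>q<d. coord (ud j r x) q *\<^sub>R partial_x q (Vc i (t0 + r * c j)) (u j r x)) = coord (kd j r x) i"
      if "r \<in> J" "x \<in> Rn d" for r x
      using that j time_in u_in by (simp add: kd coord_partial_t coord_partial_x)
  qed
  then show ?thesis
    using hvd kd by (simp add: stage_deriv_def)
qed

lemma stage_const_Suc_ge:
  assumes "4 \<le> stage_const n s B j"
  shows "stage_const n s B j \<le> stage_const n s B (Suc j)"
proof -
  define C where "C = real s * B * (real (n + 2) * stage_const n s B j)"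
  have C: "0 \<le> C" using assms B by (simp add: C_def)
  have "0 \<le> 2 * comp_const C (Suc n) * (1 + 2 ^ n * C)"
    using C comp_const_ge_1[OF C, of "Suc n"] by (intro mult_nonneg_nonneg) (auto simp del: comp_const.simps)
  then show ?thesis by (simp add: C_def del: comp_const.simps)
qed

lemma stage_const_ge_4: "4 \<le> stage_const n s B j"
proof (induction j)
  case (Suc j)
  then show ?case using stage_const_Suc_ge[OF Suc] by linarith
qed simp

lemmas stage_const_mono = stage_const_Suc_ge[OF stage_const_ge_4]

lemma stage_deriv_mono: "stage_deriv S j \<Longrightarrow> S \<le> S' \<Longrightarrow> stage_deriv S' j"
  unfolding stage_deriv_def using L
  by (auto intro!: mult_right_mono elim!: rbd_mono)

lemma stage_deriv_upto: "m \<le> Suc s \<Longrightarrow> j \<in> {1..m} \<Longrightarrow> stage_deriv (stage_const n s B m) j"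
proof (induction m arbitrary: j)
  case (Suc m)
  show ?case
  proof (cases "j = Suc m")
    case True
    show ?thesis
    proof (rule stage_deriv_Suc[OF _ stage_const_ge_4[of m]])
      show "2 * comp_const (real s * B * (real (n + 2) * stage_const n s B m)) (Suc n) *
        (1 + 2 ^ n * (real s * B * (real (n + 2) * stage_const n s B m))) \<le> stage_const n s B (Suc m)"
        using stage_const_ge_4[of m] by simp
    qed (use Suc True in auto)
  next
    case False
    then show ?thesis using Suc stage_const_mono by (intro stage_deriv_mono[OF Suc.IH]) auto
  qed
qed simp

abbreviation "SC \<equiv> stage_const n s B (Suc s)"
abbreviation "KC \<equiv> comp_const (real s * B * (real (n + 2) * SC)) (Suc n)"

lemma stage_deriv_all: "j \<in> {1..Suc s} \<Longrightarrow> stage_deriv SC j"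
  by (rule stage_deriv_upto) auto

lemma has_derivative_k: "j \<in> {1..Suc s} \<Longrightarrow> r \<in> J \<Longrightarrow> x \<in> Rn d \<Longrightarrow> ((\<lambda>r. k j r x) has_vector_derivative kd j r x) (at r within J)"
  and rbd_kd: "j \<in> {1..Suc s} \<Longrightarrow> i < d \<Longrightarrow> rbd h (Rn d) M n (\<lambda>x. SC * L * M x) (\<lambda>r x. coord (kd j r x) i)"
  using stage_deriv_all by (auto simp: stage_deriv_def)

lemma has_derivative_u: "j \<in> {1..Suc s} \<Longrightarrow> r \<in> J \<Longrightarrow> x \<in> Rn d \<Longrightarrow> ((\<lambda>r. u j r x) has_vector_derivative ud j r x) (at r within J)"
  by (rule stage_deriv_u(1)[OF _ stage_const_ge_4 stage_deriv_all]) auto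

lemma rbd_along_stage:
  assumes "j \<in> {1..Suc s}" "Ck_on I d (Suc n) g" "pd_bounded I d (Suc n) (2 * L) g"
  shows "rbd h (Rn d) M (Suc n) (\<lambda>x. KC * (2 * L)) (\<lambda>r x. g (t0 + r * c j) (u j r x))"
  using assms by (intro rbd_along_u stage_const_ge_4 stage_deriv_all) auto

section \<open>Derivatives of the stages in the initial value\<close>

definition kx :: "nat \<Rightarrow> nat \<Rightarrow> real \<Rightarrow> rvec \<Rightarrow> rvec" where
  "kx q j r x = partial_x q (k j r) x"

definition ux :: "nat \<Rightarrow> nat \<Rightarrow> real \<Rightarrow> rvec \<Rightarrow> rvec" where
  "ux q j r x = unit_vec q + r *\<^sub>R (\<Sum>l\<in>{1..<j}. a j l *\<^sub>R kx q l r x)"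

lemma ux_alt: "ux q j r x = unit_vec q + (\<Sum>l\<in>{1..<j}. a j l *\<^sub>R (r *\<^sub>R kx q l r x))"
  unfolding ux_def scaleR_sum_right by (simp add: mult.commute[of r])

text \<open>All \<open>n + 2\<close> derivatives of \<open>V\<close> are spent here: one in
  \<open>x\<close>, \<open>n + 1\<close> in \<open>r\<close>. Before any time derivative is taken
  the bound contains no \<open>M\<close>, because the first derivatives of \<open>V\<close> are
  bounded uniformly.\<close>

definition stage_tangent :: "nat \<Rightarrow> real \<Rightarrow> nat \<Rightarrow> bool" where
  "stage_tangent q S j \<longleftrightarrow>
    (\<forall>r\<in>J. \<forall>x\<in>Rn d. has_partial q (k j r) x (kx q j r x)) \<and>
    (\<forall>i<d. rbd h (Rn d) M (Suc n) (\<lambda>x. S * L) (\<lambda>r x. coord (kx q j r x) i))"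

lemma kx_in:
  assumes "stage_tangent q S j" "j \<in> {1..Suc s}" "r \<in> J" "x \<in> Rn d" "q < d"
  shows "kx q j r x \<in> Rn d"
proof (rule has_vector_derivative_in_Rn[of "-1" 1 0 "\<lambda>\<xi>. k j r (x + \<xi> *\<^sub>R unit_vec q)"])
  show "((\<lambda>\<xi>. k j r (x + \<xi> *\<^sub>R unit_vec q)) has_vector_derivative kx q j r x) (at 0 within {-1..1})"
    using assms by (auto simp: stage_tangent_def intro: has_vector_derivative_at_within)
qed (use assms k_in in auto)

lemma stage_tangent_u:
  assumes j: "j \<in> {1..Suc s}" and q: "q < d" and S: "0 \<le> S" and D: "\<And>l. l \<in> {1..<j} \<Longrightarrow> stage_tangent q S l"
  shows "\<And>r x. r \<in> J \<Longrightarrow> x \<in> Rn d \<Longrightarrow> has_partial q (u j r) x (ux q j r x)"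
    and "rbd h (Rn d) M (Suc n) (\<lambda>x. 1 + real s * B * (real (n + 2) * S)) (ux q j)"
proof -
  fix r x assume rx: "r \<in> J" "x \<in> Rn d"
  have "((\<lambda>\<xi>. x + \<xi> *\<^sub>R unit_vec q + r *\<^sub>R (\<Sum>l\<in>{1..<j}. a j l *\<^sub>R k l r (x + \<xi> *\<^sub>R unit_vec q))) has_vector_derivative
      unit_vec q + r *\<^sub>R (\<Sum>l\<in>{1..<j}. a j l *\<^sub>R kx q l r x)) (at 0)"
  proof (intro has_vector_derivative_add has_vector_derivative_sum
        bounded_linear.has_vector_derivative[OF bounded_linear_scaleR_right])
    show "((\<lambda>\<xi>. x + \<xi> *\<^sub>R unit_vec q) has_vector_derivative unit_vec q) (at 0)"
      by (auto intro!: derivative_eq_intros)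
  qed (use D rx in \<open>auto simp: stage_tangent_def\<close>)
  then show "has_partial q (u j r) x (ux q j r x)"
    by (simp add: u_def ux_def)
next
  have "rbd h (Rn d) M (Suc n) (\<lambda>x. real (n + 2) * S) (\<lambda>r x. r *\<^sub>R kx q l r x)" if l: "l \<in> {1..<j}" for l
  proof -
    have "rbd h (Rn d) M (Suc n) (\<lambda>x. real (Suc (Suc n)) * S) (\<lambda>r x. r *\<^sub>R kx q l r x)"
    proof (rule rbd_times_r)
      show "rbd h (Rn d) M (Suc n) (\<lambda>x. real d * (S * L)) (kx q l)"
        using D[OF l] kx_in[OF D[OF l] _ _ _ q] l j by (intro rbd_vec) (auto simp: stage_tangent_def)
      show "h * (real d * (S * L)) \<le> S"
        using mult_right_mono[OF hdL S] by (simp add: ac_simps)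
      show "real d * (S * L) \<le> S * M x" for x
        using mult_right_mono[OF dL_le_M[of x] S] by (simp add: ac_simps)
    qed (use h in auto)
    then show ?thesis by simp
  qed
  then have "rbd h (Rn d) M (Suc n) (\<lambda>x. real s * B * (real (n + 2) * S)) (\<lambda>r x. \<Sum>l\<in>{1..<j}. a j l *\<^sub>R (r *\<^sub>R kx q l r x))"
    using S by (intro rbd_lincomb j) auto
  from rbd_add[OF _ this, of "\<lambda>_. 1" "\<lambda>r x. unit_vec q"]
  show "rbd h (Rn d) M (Suc n) (\<lambda>x. 1 + real s * B * (real (n + 2) * S)) (ux q j)"
    by (simp add: ux_alt[abs_def] rbd_const del: scaleR_scaleR)
qed

lemma kx_formula:
  assumes j: "j \<in> {1..Suc s}" and q: "q < d" and rx: "r \<in> J" "x \<in> Rn d"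
    and D: "has_partial q (u j r) x (ux q j r x)"
  shows "has_partial q (k j r) x (kx q j r x)"
    and "kx q j r x = (\<Sum>q'<d. coord (ux q j r x) q' *\<^sub>R partial_x q' (V (t0 + r * c j)) (u j r x))"
proof -
  let ?D = "\<Sum>q'<d. coord (ux q j r x) q' *\<^sub>R partial_x q' (V (t0 + r * c j)) (u j r x)"
  have "((\<lambda>\<xi>. V (t0 + r * c j) (u j r (x + \<xi> *\<^sub>R unit_vec q))) has_vector_derivative
      0 *\<^sub>R partial_t I V (t0 + r * c j) (u j r (x + 0 *\<^sub>R unit_vec q)) +
      (\<Sum>q'<d. coord (ux q j r x) q' *\<^sub>R partial_x q' (V (t0 + r * c j)) (u j r (x + 0 *\<^sub>R unit_vec q)))) (at 0)"
    by (rule has_derivative_V_along[of "\<lambda>_. t0 + r * c j"])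
      (use D rx q time_in[OF j rx(1)] u_in[OF j rx(1)] in auto)
  then have hvd: "has_partial q (k j r) x (?D)"
    by (simp add: k_eq)
  then show "kx q j r x = ?D"
    unfolding kx_def partial_x_def by (rule vector_derivative_at)
  with hvd show "has_partial q (k j r) x (kx q j r x)"
    by simp
qed

lemma stage_tangent_Suc:
  assumes j: "j \<in> {1..Suc s}" and q: "q < d" and S: "0 \<le> S" and D: "\<And>l. l \<in> {1..<j} \<Longrightarrow> stage_tangent q S l"
    and S': "2 ^ Suc n * (2 * KC * (1 + real s * B * (real (n + 2) * S))) \<le> S'"
  shows "stage_tangent q S' j"
proof -
  note U = stage_tangent_u[OF j q S D]
  have K: "has_partial q (k j r) x (kx q j r x)"
    "kx q j r x = (\<Sum>q'<d. coord (ux q j r x) q' *\<^sub>R partial_x q' (V (t0 + r * c j)) (u j r x))"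
    if "r \<in> J" "x \<in> Rn d" for r x
    using kx_formula[OF j q that U(1)[OF _ that]] by auto
  have KC: "0 \<le> KC"
    using comp_const_ge_1[of "real s * B * (real (n + 2) * SC)" "Suc n"] B stage_const_ge_4[of "Suc s"] by simp
  have "rbd h (Rn d) M (Suc n) (\<lambda>x. S' * L) (\<lambda>r x. coord (kx q j r x) i)" if i: "i < d" for i
  proof (rule rbd_cong)
    show "rbd h (Rn d) M (Suc n) (\<lambda>x. S' * L)
      (\<lambda>r x. \<Sum>q'<d. coord (ux q j r x) q' *\<^sub>R partial_x q' (Vc i (t0 + r * c j)) (u j r x))"
    proof (rule rbd_mono)
      show "rbd h (Rn d) M (Suc n) (\<lambda>x. 2 ^ Suc n * ((KC * (2 * L)) * (1 + real s * B * (real (n + 2) * S))))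
        (\<lambda>r x. \<Sum>q'<d. coord (ux q j r x) q' *\<^sub>R partial_x q' (Vc i (t0 + r * c j)) (u j r x))"
      proof (rule rbd_pair)
        show "rbd h (Rn d) M (Suc n) (\<lambda>x. KC * (2 * L)) (\<lambda>r x. partial_x q' (Vc i (t0 + r * c j)) (u j r x))"
          if "q' < d" for q'
          using that i by (intro rbd_along_stage j Vc_x_Ck Vc_x_bd)
        show "rbd h (Rn d) M (Suc n) (\<lambda>x. 1 + real s * B * (real (n + 2) * S)) (ux q j)"
          by (rule U(2))
      qed (use KC L h in auto)
      show "2 ^ Suc n * ((KC * (2 * L)) * (1 + real s * B * (real (n + 2) * S))) \<le> S' * L"
        using mult_right_mono[OF S', of L] L by (simp add: ac_simps del: comp_const.simps)
    qed auto
    show "(\<Sum>q'<d. coord (ux q j r x) q' *\<^sub>R partial_x q' (Vc i (t0 + r * c j)) (u j r x)) = coord (kx q j r x) i"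
      if "r \<in> J" "x \<in> Rn d" for r x
      using that time_in[OF j] u_in[OF j] by (simp add: K(2) coord_partial_x)
  qed
  then show ?thesis
    using K(1) by (simp add: stage_tangent_def)
qed

lemma KC_ge_1: "1 \<le> KC"
  using stage_const_ge_4[of "Suc s"] B by (intro comp_const_ge_1) simp

lemma tangent_const_nonneg: "0 \<le> tangent_const n s B KC j"
  by (induction j) (use KC_ge_1 B in \<open>auto simp del: comp_const.simps stage_const.simps\<close>)

lemma stage_tangent_upto: "m \<le> Suc s \<Longrightarrow> j \<in> {1..m} \<Longrightarrow> q < d \<Longrightarrow> stage_tangent q (tangent_const n s B KC m) j"
proof (induction m arbitrary: j)
  case (Suc m)
  let ?T = "tangent_const n s B KC"
  have step: "2 ^ Suc n * (2 * KC * (1 + real s * B * (real (n + 2) * ?T m))) + ?T m = ?T (Suc m)"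
    by simp
  show ?case
  proof (cases "j = Suc m")
    case True
    show ?thesis
    proof (rule stage_tangent_Suc[OF _ _ tangent_const_nonneg[of m]])
      show "2 ^ Suc n * (2 * KC * (1 + real s * B * (real (n + 2) * ?T m))) \<le> ?T (Suc m)"
        using step tangent_const_nonneg[of m] by linarith
    qed (use Suc True in auto)
  next
    case False
    have "0 \<le> 2 ^ Suc n * (2 * KC * (1 + real s * B * (real (n + 2) * ?T m)))"
      using tangent_const_nonneg[of m] KC_ge_1 B
      by (intro mult_nonneg_nonneg add_nonneg_nonneg) auto
    then have "?T m \<le> ?T (Suc m)" using step by linarith
    then have "?T m * L \<le> ?T (Suc m) * L" using L by (intro mult_right_mono) auto
    then show ?thesis
      using Suc.IH[of j] Suc.prems False
      by (auto simp: stage_tangent_def simp del: tangent_const.simps elim!: rbd_mono)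
  qed
qed simp

abbreviation "TC \<equiv> tangent_const n s B KC (Suc s)"

lemma stage_tangent_all: "j \<in> {1..Suc s} \<Longrightarrow> q < d \<Longrightarrow> stage_tangent q TC j"
  by (rule stage_tangent_upto) auto

lemma has_partial_k: "j \<in> {1..Suc s} \<Longrightarrow> q < d \<Longrightarrow> r \<in> J \<Longrightarrow> x \<in> Rn d \<Longrightarrow>
    has_partial q (k j r) x (kx q j r x)"
  and rbd_kx: "j \<in> {1..Suc s} \<Longrightarrow> q < d \<Longrightarrow> i < d \<Longrightarrow> rbd h (Rn d) M (Suc n) (\<lambda>x. TC * L) (\<lambda>r x. coord (kx q j r x) i)"
  using stage_tangent_all by (auto simp: stage_tangent_def)

lemma has_partial_u: "j \<in> {1..Suc s} \<Longrightarrow> q < d \<Longrightarrow> r \<in> J \<Longrightarrow> x \<in> Rn d \<Longrightarrow>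
    has_partial q (u j r) x (ux q j r x)"
  and continuous_ux: "j \<in> {1..Suc s} \<Longrightarrow> q < d \<Longrightarrow> continuous_on (J \<times> Rn d) (\<lambda>(r, x). ux q j r x)"
  using stage_tangent_u[OF _ _ tangent_const_nonneg stage_tangent_all, of j q] rbd_cont by auto

lemma kx_in_Rn: "j \<in> {1..Suc s} \<Longrightarrow> q < d \<Longrightarrow> r \<in> J \<Longrightarrow> x \<in> Rn d \<Longrightarrow> kx q j r x \<in> Rn d"
  by (rule kx_in[OF stage_tangent_all])

text \<open>A bound through \<open>TC\<close> is too coarse to give \<open>1 / 2\<close>. Explicit
  constants that reproduce themselves, as in \<open>norm2_k_le\<close>, are needed to make the
  one-step map a contractive perturbation of the identity.\<close>

lemma norm_ux_minus_le_aux: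
  assumes "j \<in> {1..Suc s}" "q < d" "r \<in> J" "x \<in> Rn d"
    and "\<And>l. l \<in> {1..<j} \<Longrightarrow> norm (kx q l r x) \<le> real d * L * 4"
  shows "norm (ux q j r x - unit_vec q) \<le> 1 / 2"
proof -
  have "norm (\<Sum>l\<in>{1..<j}. a j l *\<^sub>R kx q l r x) \<le> real s * B * (real d * L * 4)"
    using assms B L by (intro norm_sum_scaleR_le a_le) auto
  then have "r * norm (\<Sum>l\<in>{1..<j}. a j l *\<^sub>R kx q l r x) \<le> r * (real s * B * (real d * L * 4))"
    using assms by (intro mult_left_mono) auto
  also have "\<dots> \<le> 4 / 8" using assms by (intro hsB) auto
  finally show ?thesis using assms by (simp add: ux_def)
qed

lemma norm_kx_le:
  assumes "j \<in> {1..Suc s}" "q < d" "r \<in> J" "x \<in> Rn d"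
  shows "norm (kx q j r x) \<le> real d * L * 4"
  using assms(1)
proof (induction j rule: less_induct)
  case (less j)
  have "norm (ux q j r x - unit_vec q) \<le> 1 / 2"
    using less by (intro norm_ux_minus_le_aux assms) auto
  then have ux: "norm (ux q j r x) \<le> 2"
    using norm_triangle_ineq[of "ux q j r x - unit_vec q" "unit_vec q"] by simp
  have "\<bar>coord (kx q j r x) i\<bar> \<le> 2 * L * 2" if "i < d" for i
  proof -
    have "coord (kx q j r x) i = (\<Sum>q'<d. coord (ux q j r x) q' *\<^sub>R partial_x q' (Vc i (t0 + r * c j)) (u j r x))"
      using kx_formula(2)[OF less.prems assms(2-4) has_partial_u[OF less.prems assms(2-4)]] less.prems assms time_in u_in
      by (simp add: coord_partial_x)
    also have "norm \<dots> \<le> 2 * L * 2"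
      using ux Vc_x_le[OF that _ time_in[OF less.prems assms(3)] u_in[OF less.prems assms(3,4)]] L
      by (intro norm_sum_coord_le) auto
    finally show ?thesis by simp
  qed
  then have "(\<Sum>i<d. \<bar>coord (kx q j r x) i\<bar>) \<le> (\<Sum>i<d. 2 * L * 2)" by (intro sum_mono) auto
  then show ?case using norm_Rn[OF kx_in_Rn[OF less.prems assms(2-4)]] by simp
qed

lemma norm_ux_minus_le: "j \<in> {1..Suc s} \<Longrightarrow> q < d \<Longrightarrow> r \<in> J \<Longrightarrow> x \<in> Rn d \<Longrightarrow> norm (ux q j r x - unit_vec q) \<le> 1 / 2"
  by (intro norm_ux_minus_le_aux norm_kx_le) auto

end

section \<open>Taylor coefficients and their derivatives\<close>

definition is_jets ::
    "real \<Rightarrow> nat \<Rightarrow> nat \<Rightarrow> nat \<Rightarrow> (rvec \<Rightarrow> real) \<Rightarrow> (real \<Rightarrow> rvec \<Rightarrow> real) \<Rightarrow> (real \<Rightarrow> rvec \<Rightarrow> real) \<Rightarrow>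
     (nat \<Rightarrow> rvec \<Rightarrow> real) \<Rightarrow> (nat \<Rightarrow> rvec \<Rightarrow> real) \<Rightarrow> bool" where
  "is_jets h d q n K g \<kappa> c e \<longleftrightarrow>
    (\<forall>m<n. \<forall>x\<in>Rn d. has_partial q (c m) x (e m x)) \<and>
    (\<forall>r\<in>{0..h}. \<forall>x\<in>Rn d. \<bar>g r x - (\<Sum>m<n. c m x * r ^ m)\<bar> \<le> K x * r ^ n \<and>
      \<bar>\<kappa> r x - (\<Sum>m<n. e m x * r ^ m)\<bar> \<le> K x * r ^ n)"

lemma is_jetsD:
  assumes "is_jets h d q n K g \<kappa> c e"
  shows "\<And>m x. m < n \<Longrightarrow> x \<in> Rn d \<Longrightarrow> has_partial q (c m) x (e m x)"
    and "\<And>r x. r \<in> {0..h} \<Longrightarrow> x \<in> Rn d \<Longrightarrow> \<bar>g r x - (\<Sum>m<n. c m x * r ^ m)\<bar> \<le> K x * r ^ n"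
    and "\<And>r x. r \<in> {0..h} \<Longrightarrow> x \<in> Rn d \<Longrightarrow> \<bar>\<kappa> r x - (\<Sum>m<n. e m x * r ^ m)\<bar> \<le> K x * r ^ n"
  using assms unfolding is_jets_def by blast+

text \<open>Taylor expansions of \<open>g\<close> and of \<open>\<kappa> = \<partial>\<^sub>qg\<close> in which the coefficients of the second are the derivatives of
  those of the first. Only the remainder is controlled, so the relation survives multiplication by
  \<open>r\<close> at the cost of no derivative.\<close>

definition jet_pair :: "real \<Rightarrow> nat \<Rightarrow> nat \<Rightarrow> nat \<Rightarrow> (rvec \<Rightarrow> real) \<Rightarrow> (real \<Rightarrow> rvec \<Rightarrow> real) \<Rightarrow> (real \<Rightarrow> rvec \<Rightarrow> real) \<Rightarrow> bool" where
  "jet_pair h d q n K g \<kappa> \<longleftrightarrow> (\<exists>c e. is_jets h d q n K g \<kappa> c e)"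

lemma jet_pair_add:
  assumes "jet_pair h d q n K g \<kappa>" "jet_pair h d q n K' g' \<kappa>'"
  shows "jet_pair h d q n (\<lambda>x. K x + K' x) (\<lambda>r x. g r x + g' r x) (\<lambda>r x. \<kappa> r x + \<kappa>' r x)"
proof -
  obtain c e where "is_jets h d q n K g \<kappa> c e"
    using assms(1) unfolding jet_pair_def by blast
  note c = is_jetsD[OF this]
  obtain c' e' where "is_jets h d q n K' g' \<kappa>' c' e'"
    using assms(2) unfolding jet_pair_def by blast
  note c' = is_jetsD[OF this]
  show ?thesis unfolding jet_pair_def is_jets_def
  proof (rule exI[of _ "\<lambda>m x. c m x + c' m x"], rule exI[of _ "\<lambda>m x. e m x + e' m x"], intro conjI allI ballI impI)
    fix r x assume rx: "r \<in> {0..h}" "x \<in> Rn d"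
    show "\<bar>g r x + g' r x - (\<Sum>m<n. (c m x + c' m x) * r ^ m)\<bar> \<le> (K x + K' x) * r ^ n"
      using c(2)[OF rx] c'(2)[OF rx] by (simp add: distrib_right sum.distrib)
    show "\<bar>\<kappa> r x + \<kappa>' r x - (\<Sum>m<n. (e m x + e' m x) * r ^ m)\<bar> \<le> (K x + K' x) * r ^ n"
      using c(3)[OF rx] c'(3)[OF rx] by (simp add: distrib_right sum.distrib)
  qed (use c c' in \<open>auto intro!: has_vector_derivative_add\<close>)
qed

lemma jet_pair_scale:
  assumes "jet_pair h d q n K g \<kappa>"
  shows "jet_pair h d q n (\<lambda>x. \<bar>b\<bar> * K x) (\<lambda>r x. b * g r x) (\<lambda>r x. b * \<kappa> r x)"
proof -
  obtain c e where "is_jets h d q n K g \<kappa> c e"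
    using assms(1) unfolding jet_pair_def by blast
  note c = is_jetsD[OF this]
  show ?thesis unfolding jet_pair_def is_jets_def
  proof (rule exI[of _ "\<lambda>m x. b * c m x"], rule exI[of _ "\<lambda>m x. b * e m x"], intro conjI allI ballI impI)
    fix r x assume rx: "r \<in> {0..h}" "x \<in> Rn d"
    have "b * g r x - (\<Sum>m<n. b * c m x * r ^ m) = b * (g r x - (\<Sum>m<n. c m x * r ^ m))"
      "b * \<kappa> r x - (\<Sum>m<n. b * e m x * r ^ m) = b * (\<kappa> r x - (\<Sum>m<n. e m x * r ^ m))"
      by (simp_all add: sum_distrib_left right_diff_distrib mult.assoc)
    then show "\<bar>b * g r x - (\<Sum>m<n. b * c m x * r ^ m)\<bar> \<le> \<bar>b\<bar> * K x * r ^ n"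
      "\<bar>b * \<kappa> r x - (\<Sum>m<n. b * e m x * r ^ m)\<bar> \<le> \<bar>b\<bar> * K x * r ^ n"
      using c(2,3)[OF rx] by (simp_all add: abs_mult mult.assoc mult_left_mono)
  next
    fix m x assume "m < n" "x \<in> Rn d"
    then show "((\<lambda>\<xi>. b * c m (x + \<xi> *\<^sub>R unit_vec q)) has_vector_derivative b * e m x) (at 0)"
      by (intro bounded_linear.has_vector_derivative[OF bounded_linear_mult_right] c)
  qed
qed

lemma jet_pair_zero: "jet_pair h d q n (\<lambda>x. 0) (\<lambda>r x. 0) (\<lambda>r x. 0)"
  unfolding jet_pair_def is_jets_def by (intro exI[of _ "\<lambda>m x. 0"]) auto

lemma jet_pair_sum:
  assumes "\<And>l. l \<in> S \<Longrightarrow> jet_pair h d q n (K l) (g l) (\<kappa> l)"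
  shows "jet_pair h d q n (\<lambda>x. \<Sum>l\<in>S. K l x) (\<lambda>r x. \<Sum>l\<in>S. g l r x) (\<lambda>r x. \<Sum>l\<in>S. \<kappa> l r x)"
  using assms
  by (induction S rule: infinite_finite_induct) (auto intro!: jet_pair_add jet_pair_zero)

lemma jet_pair_mono:
  assumes "jet_pair h d q n K g \<kappa>" "\<And>x. x \<in> Rn d \<Longrightarrow> K x \<le> K' x"
  shows "jet_pair h d q n K' g \<kappa>"
proof -
  have le: "K x * r ^ n \<le> K' x * r ^ n" if "r \<in> {0..h}" "x \<in> Rn d" for r x
    using assms(2)[OF that(2)] that by (intro mult_right_mono) auto
  obtain c e where "is_jets h d q n K g \<kappa> c e"
    using assms(1) unfolding jet_pair_def by blast
  note c = is_jetsD[OF this]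
  show ?thesis unfolding jet_pair_def is_jets_def
    by (rule exI[of _ c], rule exI[of _ e], intro conjI allI ballI impI c(1) order_trans[OF c(2) le] order_trans[OF c(3) le])
qed

lemma jet_pair_times_r:
  assumes "jet_pair h d q n K g \<kappa>"
  shows "jet_pair h d q (Suc n) K (\<lambda>r x. r * g r x) (\<lambda>r x. r * \<kappa> r x)"
proof -
  obtain c e where "is_jets h d q n K g \<kappa> c e"
    using assms(1) unfolding jet_pair_def by blast
  note c = is_jetsD[OF this]
  define c' where "c' m x = (case m of 0 \<Rightarrow> 0 | Suc m \<Rightarrow> c m x)" for m x
  define e' where "e' m x = (case m of 0 \<Rightarrow> 0 | Suc m \<Rightarrow> e m x)" for m x
  have shift: "(\<Sum>m<Suc n. (case m of 0 \<Rightarrow> 0 | Suc m \<Rightarrow> z m) * r ^ m) = r * (\<Sum>m<n. z m * r ^ m)"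
    for z :: "nat \<Rightarrow> real" and r
    unfolding sum.lessThan_Suc_shift by (simp add: sum_distrib_left ac_simps)
  show ?thesis unfolding jet_pair_def is_jets_def
  proof (rule exI[of _ c'], rule exI[of _ e'], intro conjI allI ballI impI)
    fix r x assume rx: "r \<in> {0..h}" "x \<in> Rn d"
    have "r * g r x - (\<Sum>m<Suc n. c' m x * r ^ m) = r * (g r x - (\<Sum>m<n. c m x * r ^ m))"
      "r * \<kappa> r x - (\<Sum>m<Suc n. e' m x * r ^ m) = r * (\<kappa> r x - (\<Sum>m<n. e m x * r ^ m))"
      unfolding c'_def e'_def shift by (simp_all add: right_diff_distrib)
    then show "\<bar>r * g r x - (\<Sum>m<Suc n. c' m x * r ^ m)\<bar> \<le> K x * r ^ Suc n"
      "\<bar>r * \<kappa> r x - (\<Sum>m<Suc n. e' m x * r ^ m)\<bar> \<le> K x * r ^ Suc n"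
      using mult_left_mono[OF c(2)[OF rx], of r] mult_left_mono[OF c(3)[OF rx], of r] rx
      by (simp_all add: abs_mult ac_simps)
  next
    fix m x assume "m < Suc n" "x \<in> Rn d"
    then show "has_partial q (c' m) x (e' m x)"
      using c(1) by (cases m) (auto simp: c'_def e'_def)
  qed
qed

lemma jet_integrate:
  fixes g :: "real \<Rightarrow> real"
  assumes g': "\<And>r. r \<in> {0..h} \<Longrightarrow> (g has_vector_derivative g' r) (at r within {0..h})"
    and K: "\<And>r. r \<in> {0..h} \<Longrightarrow> \<bar>g' r - (\<Sum>m<n. c m * r ^ m)\<bar> \<le> K * r ^ n" "0 \<le> K" and r: "r \<in> {0..h}"
  shows "\<bar>g r - (\<Sum>m<Suc n. (case m of 0 \<Rightarrow> g 0 | Suc m \<Rightarrow> c m / real (Suc m)) * r ^ m)\<bar> \<le> K * r ^ Suc n"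
proof -
  define \<phi> where "\<phi> \<rho> = g \<rho> - (\<Sum>m<n. c m / real (Suc m) * \<rho> ^ Suc m)" for \<rho>
  have \<phi>': "(\<phi> has_derivative (\<lambda>v. v * (g' \<rho> - (\<Sum>m<n. c m * \<rho> ^ m)))) (at \<rho> within {0..r})" if "\<rho> \<in> {0..r}" for \<rho>
  proof -
    have "((\<lambda>\<rho>. c m / real (Suc m) * \<rho> ^ Suc m) has_vector_derivative c m * \<rho> ^ m) (at \<rho> within {0..r})" for m
    proof -
      have "((\<lambda>\<rho>. c m / real (Suc m) * \<rho> ^ Suc m) has_real_derivative
          c m / real (Suc m) * (real (Suc m) * \<rho> ^ m)) (at \<rho> within {0..r})"
        using DERIV_pow[of "Suc m" \<rho> "{0..r}"] by (intro DERIV_cmult) simp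
      moreover have "c m / real (Suc m) * (real (Suc m) * \<rho> ^ m) = c m * \<rho> ^ m" by simp
      ultimately show ?thesis by (simp add: has_real_derivative_iff_has_vector_derivative)
    qed
    then have "(\<phi> has_vector_derivative g' \<rho> - (\<Sum>m<n. c m * \<rho> ^ m)) (at \<rho> within {0..r})"
      unfolding \<phi>_def using that r
      by (intro has_vector_derivative_diff has_vector_derivative_sum has_vector_derivative_within_subset[OF g']) auto
    then show ?thesis by (simp add: has_vector_derivative_def)
  qed
  have "norm (\<phi> r - \<phi> 0) \<le> K * r ^ n * norm (r - 0)"
  proof (rule differentiable_bound[OF _ \<phi>'])
    fix \<rho> assume \<rho>: "\<rho> \<in> {0..r}"
    have "\<bar>g' \<rho> - (\<Sum>m<n. c m * \<rho> ^ m)\<bar> \<le> K * \<rho> ^ n" using K(1)[of \<rho>] \<rho> r by auto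
    also have "\<dots> \<le> K * r ^ n" using \<rho> K(2) by (intro mult_left_mono power_mono) auto
    finally show "onorm (\<lambda>v. v * (g' \<rho> - (\<Sum>m<n. c m * \<rho> ^ m))) \<le> K * r ^ n"
      by (intro onorm_le) (auto simp: abs_mult mult.commute[of "K * r ^ n"] intro: mult_left_mono)
  qed (use r in auto)
  moreover have "g r - (\<Sum>m<Suc n. (case m of 0 \<Rightarrow> g 0 | Suc m \<Rightarrow> c m / real (Suc m)) * r ^ m) = \<phi> r - \<phi> 0"
    unfolding sum.lessThan_Suc_shift \<phi>_def by simp
  ultimately show ?thesis using r by (simp add: ac_simps)
qed

text \<open>\<open>g'\<close> is known only as a time derivative. Its derivative in \<open>x\<close>
  is produced from the time derivative of \<open>\<kappa>\<close> by
  \<open>has_vector_derivative_swap\<close>, so the defect, which contains stage velocities, can be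
  differentiated in \<open>x\<close>.\<close>

lemma partial_of_time_derivative:
  fixes g \<kappa> :: "real \<Rightarrow> rvec \<Rightarrow> real"
  assumes h: "0 < h" and q: "q < d"
    and g': "\<And>r x. r \<in> {0..h} \<Longrightarrow> x \<in> Rn d \<Longrightarrow> ((\<lambda>r. g r x) has_vector_derivative g' r x) (at r within {0..h})"
    and \<kappa>': "\<And>r x. r \<in> {0..h} \<Longrightarrow> x \<in> Rn d \<Longrightarrow> ((\<lambda>r. \<kappa> r x) has_vector_derivative \<kappa>' r x) (at r within {0..h})"
    and cont: "continuous_on ({0..h} \<times> Rn d) (\<lambda>(r, x). \<kappa>' r x)"
    and \<kappa>: "\<And>r x. r \<in> {0..h} \<Longrightarrow> x \<in> Rn d \<Longrightarrow> has_partial q (g r) x (\<kappa> r x)"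
    and rx: "r \<in> {0..h}" "x \<in> Rn d"
  shows "has_partial q (g' r) x (\<kappa>' r x)"
proof -
  have line: "x + \<xi> *\<^sub>R unit_vec q \<in> Rn d" for \<xi>
    using rx q by simp
  have "((\<lambda>\<xi>. g' r (x + \<xi> *\<^sub>R unit_vec q)) has_vector_derivative \<kappa>' r (x + 0 *\<^sub>R unit_vec q)) (at 0 within {-1..1})"
  proof (rule has_vector_derivative_swap[where a=0 and b=h and g="\<lambda>r \<xi>. g r (x + \<xi> *\<^sub>R unit_vec q)"
        and g\<xi>="\<lambda>r \<xi>. \<kappa> r (x + \<xi> *\<^sub>R unit_vec q)" and g\<xi>t="\<lambda>r \<xi>. \<kappa>' r (x + \<xi> *\<^sub>R unit_vec q)"])
    show "continuous_on ({0..h} \<times> {-1..1}) (\<lambda>(r, \<xi>). \<kappa>' r (x + \<xi> *\<^sub>R unit_vec q))"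
      unfolding case_prod_unfold
      by (intro continuous_on_compose2[OF cont[unfolded case_prod_unfold],
            where f="\<lambda>z. (fst z, x + snd z *\<^sub>R unit_vec q)", simplified])
        (use line in \<open>auto intro!: continuous_intros\<close>)
    show "((\<lambda>\<xi>. g r (x + \<xi> *\<^sub>R unit_vec q)) has_vector_derivative \<kappa> r (x + \<xi> *\<^sub>R unit_vec q)) (at \<xi> within {-1..1})"
      if "r \<in> {0..h}" for r \<xi>
      by (rule has_vector_derivative_at_within, rule has_vector_derivative_shift_line)
        (use \<kappa> that line in auto)
  qed (use h rx line g' \<kappa>' in auto)
  then show ?thesis by (simp add: at_within_Icc_at)
qed

text \<open>The constants of integration are \<open>g 0\<close> and \<open>\<kappa> 0\<close>, so
  \<open>\<kappa>\<close> must be the derivative of \<open>g\<close> at \<open>r = 0\<close>; all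
  other coefficients inherit the relation from \<open>g'\<close> and \<open>\<kappa>'\<close>. The
  gain \<open>1 / (n + 1)\<close> in the remainder is given away to keep \<open>K\<close>.\<close>

lemma jet_pair_integrate:
  fixes g \<kappa> :: "real \<Rightarrow> rvec \<Rightarrow> real"
  assumes h: "0 < h" and J: "jet_pair h d q n K g' \<kappa>'" and K: "\<And>x. x \<in> Rn d \<Longrightarrow> 0 \<le> K x"
    and g': "\<And>r x. r \<in> {0..h} \<Longrightarrow> x \<in> Rn d \<Longrightarrow> ((\<lambda>r. g r x) has_vector_derivative g' r x) (at r within {0..h})"
    and \<kappa>': "\<And>r x. r \<in> {0..h} \<Longrightarrow> x \<in> Rn d \<Longrightarrow> ((\<lambda>r. \<kappa> r x) has_vector_derivative \<kappa>' r x) (at r within {0..h})"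
    and \<kappa>: "\<And>x. x \<in> Rn d \<Longrightarrow> has_partial q (g 0) x (\<kappa> 0 x)"
  shows "jet_pair h d q (Suc n) K g \<kappa>"
proof -
  obtain c e where "is_jets h d q n K g' \<kappa>' c e"
    using J unfolding jet_pair_def by blast
  note c = is_jetsD[OF this]
  define c' where "c' m x = (case m of 0 \<Rightarrow> g 0 x | Suc m \<Rightarrow> c m x / real (Suc m))" for m x
  define e' where "e' m x = (case m of 0 \<Rightarrow> \<kappa> 0 x | Suc m \<Rightarrow> e m x / real (Suc m))" for m x
  show ?thesis unfolding jet_pair_def is_jets_def
  proof (rule exI[of _ c'], rule exI[of _ e'], intro conjI allI ballI impI)
    fix m x assume m: "m < Suc n" "x \<in> Rn d"
    show "has_partial q (c' m) x (e' m x)"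
    proof (cases m)
      case 0
      then show ?thesis using \<kappa> m by (simp add: c'_def e'_def)
    next
      case (Suc m')
      have "((\<lambda>\<xi>. c m' (x + \<xi> *\<^sub>R unit_vec q) / real (Suc m')) has_vector_derivative e m' x / real (Suc m')) (at 0)"
        using c(1)[of m' x] m Suc by (intro bounded_linear.has_vector_derivative[OF bounded_linear_divide]) auto
      then show ?thesis by (simp add: Suc c'_def e'_def)
    qed
  next
    fix r x assume rx: "r \<in> {0..h}" "x \<in> Rn d"
    show "\<bar>g r x - (\<Sum>m<Suc n. c' m x * r ^ m)\<bar> \<le> K x * r ^ Suc n"
      unfolding c'_def by (rule jet_integrate[OF g' c(2) K]) (use rx in auto)
    show "\<bar>\<kappa> r x - (\<Sum>m<Suc n. e' m x * r ^ m)\<bar> \<le> K x * r ^ Suc n"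
      unfolding e'_def by (rule jet_integrate[OF \<kappa>' c(3) K]) (use rx in auto)
  qed
qed

lemma jet_pair_of_rbd:
  assumes h: "0 < h" and q: "q < d" and M: "\<And>x. x \<in> Rn d \<Longrightarrow> 0 \<le> M x"
    and "rbd h (Rn d) M n A g" "rbd h (Rn d) M n A' \<kappa>"
    and "\<And>r x. r \<in> {0..h} \<Longrightarrow> x \<in> Rn d \<Longrightarrow> has_partial q (g r) x (\<kappa> r x)"
    and "\<And>x. x \<in> Rn d \<Longrightarrow> A x * M x ^ n \<le> K x" "\<And>x. x \<in> Rn d \<Longrightarrow> A' x * M x ^ n \<le> K x"
  shows "jet_pair h d q n K g \<kappa>"
  using assms(4-)
proof (induction n arbitrary: g \<kappa> A A')
  case 0
  then show ?case
    using rbd_bound[OF 0(1)] rbd_bound[OF 0(2)] by (fastforce simp: jet_pair_def is_jets_def)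
next
  case (Suc n)
  from rbd_SucE[OF Suc.prems(1)] obtain g' where
    g': "\<And>r x. r \<in> {0..h} \<Longrightarrow> x \<in> Rn d \<Longrightarrow> ((\<lambda>r. g r x) has_vector_derivative g' r x) (at r within {0..h})"
    "rbd h (Rn d) M n (\<lambda>x. A x * M x) g'" by blast
  from rbd_SucE[OF Suc.prems(2)] obtain \<kappa>' where
    \<kappa>': "\<And>r x. r \<in> {0..h} \<Longrightarrow> x \<in> Rn d \<Longrightarrow> ((\<lambda>r. \<kappa> r x) has_vector_derivative \<kappa>' r x) (at r within {0..h})"
    "rbd h (Rn d) M n (\<lambda>x. A' x * M x) \<kappa>'" by blast
  have swap: "has_partial q (g' r) x (\<kappa>' r x)"
    if "r \<in> {0..h}" "x \<in> Rn d" for r x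
    using h q g'(1) \<kappa>'(1) rbd_cont[OF \<kappa>'(2)] Suc.prems(3) that by (rule partial_of_time_derivative)
  have "jet_pair h d q n K g' \<kappa>'"
    using g'(2) \<kappa>'(2) swap by (rule Suc.IH) (use Suc.prems(4,5) in \<open>auto simp: mult.assoc\<close>)
  then show ?case
  proof (rule jet_pair_integrate[OF h _ _ g'(1) \<kappa>'(1)])
    show "0 \<le> K x" if "x \<in> Rn d" for x
    proof -
      have "0 \<le> A x" using order_trans[OF norm_ge_zero rbd_bound[OF Suc.prems(1), of 0 x]] h that by simp
      then have "0 \<le> A x * M x ^ Suc n" using M[OF that] by (intro mult_nonneg_nonneg zero_le_power)
      then show ?thesis using Suc.prems(4)[OF that] by (rule order_trans)
    qed
  qed (use Suc.prems(3) h in auto)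
qed

section \<open>Vanishing of Taylor coefficients\<close>

definition small_o :: "nat \<Rightarrow> (real \<Rightarrow> 'a::real_normed_vector) \<Rightarrow> bool" where
  "small_o n f \<longleftrightarrow> (\<forall>\<epsilon>>0. \<forall>\<^sub>F r in at_right 0. norm (f r) \<le> \<epsilon> * r ^ n)"

lemma small_o_add:
  assumes "small_o n f" "small_o n g"
  shows "small_o n (\<lambda>r. f r + g r)"
  unfolding small_o_def
proof (intro allI impI)
  fix \<epsilon> :: real assume "\<epsilon> > 0"
  then have "\<forall>\<^sub>F r in at_right 0. norm (f r) \<le> \<epsilon> / 2 * r ^ n" "\<forall>\<^sub>F r in at_right 0. norm (g r) \<le> \<epsilon> / 2 * r ^ n"
    using assms half_gt_zero unfolding small_o_def by blast+
  then show "\<forall>\<^sub>F r in at_right 0. norm (f r + g r) \<le> \<epsilon> * r ^ n"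
  proof eventually_elim
    case (elim r)
    then show ?case using norm_triangle_ineq[of "f r" "g r"] by (simp add: field_simps)
  qed
qed

lemma small_o_bound:
  assumes "small_o n f" "\<forall>\<^sub>F r in at_right 0. norm (g r) \<le> C * norm (f r)" "0 < C"
  shows "small_o n g"
  unfolding small_o_def
proof (intro allI impI)
  fix \<epsilon> :: real assume "\<epsilon> > 0"
  then have "\<forall>\<^sub>F r in at_right 0. norm (f r) \<le> \<epsilon> / C * r ^ n"
    using assms divide_pos_pos unfolding small_o_def by blast
  with assms(2) show "\<forall>\<^sub>F r in at_right 0. norm (g r) \<le> \<epsilon> * r ^ n"
  proof eventually_elim
    case (elim r)
    then show ?case using mult_left_mono[OF elim(2), of C] assms(3) by simp
  qed
qed

lemma small_o_power_Suc: "small_o n (\<lambda>r. K * r ^ Suc n :: real)"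
  unfolding small_o_def
proof (intro allI impI)
  fix \<epsilon> :: real assume "\<epsilon> > 0"
  have "((\<lambda>r. \<bar>K\<bar> * r) \<longlongrightarrow> \<bar>K\<bar> * 0) (at_right 0)"
    by (intro tendsto_intros)
  then have "\<forall>\<^sub>F r in at_right 0. \<bar>K\<bar> * r < \<epsilon>"
    using \<open>\<epsilon> > 0\<close> by (intro order_tendstoD(2)) auto
  with eventually_at_right_less[of 0] show "\<forall>\<^sub>F r in at_right 0. norm (K * r ^ Suc n) \<le> \<epsilon> * r ^ n"
  proof eventually_elim
    case (elim r)
    then show ?case using mult_right_mono[of "\<bar>K\<bar> * r" \<epsilon> "r ^ n"] by (simp add: abs_mult power_abs mult.assoc)
  qed
qed

text \<open>The constant coefficient is the limit at \<open>0\<close>, hence zero; dividing by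
  \<open>r\<close> lowers the order.\<close>

lemma small_o_polynomial:
  fixes c :: "nat \<Rightarrow> real"
  assumes "small_o n (\<lambda>r. \<Sum>m<Suc n. c m * r ^ m)" "m \<le> n"
  shows "c m = 0"
  using assms
proof (induction n arbitrary: c m)
  case 0
  then have "\<forall>\<^sub>F r in at_right (0::real). \<bar>c 0\<bar> \<le> \<epsilon>" if "\<epsilon> > 0" for \<epsilon>
    using that by (auto simp: small_o_def)
  then have "\<bar>c 0\<bar> \<le> \<epsilon>" if "\<epsilon> > 0" for \<epsilon>
    using that by (simp add: eventually_const trivial_limit_at_right_real)
  then have "\<bar>c 0\<bar> \<le> 0" by (rule field_le_epsilon) simp
  then show ?case using 0 by simp
next
  case (Suc n)
  let ?f = "\<lambda>r. \<Sum>m<Suc (Suc n). c m * r ^ m"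
  have split: "?f r = c 0 + r * (\<Sum>m<Suc n. c (Suc m) * r ^ m)" for r
    unfolding sum.lessThan_Suc_shift[of _ "Suc n"] by (simp add: sum_distrib_left algebra_simps del: sum.lessThan_Suc)
  have "(?f \<longlongrightarrow> ?f 0) (at_right 0)"
    by (intro tendsto_intros)
  moreover have "(?f \<longlongrightarrow> 0) (at_right 0)"
  proof (rule Lim_null_comparison)
    show "\<forall>\<^sub>F r in at_right 0. norm (?f r) \<le> 1 * r ^ Suc n"
      using Suc.prems(1) unfolding small_o_def by (rule allE[of _ 1]) simp
    have "((\<lambda>r::real. 1 * r ^ Suc n) \<longlongrightarrow> 1 * 0 ^ Suc n) (at_right 0)" by (intro tendsto_intros)
    then show "((\<lambda>r::real. 1 * r ^ Suc n) \<longlongrightarrow> 0) (at_right 0)" by simp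
  qed
  ultimately have "?f 0 = 0"
    using tendsto_unique trivial_limit_at_right_real by blast
  then have c0: "c 0 = 0" unfolding split by simp
  have "small_o n (\<lambda>r. \<Sum>m<Suc n. c (Suc m) * r ^ m)"
    unfolding small_o_def
  proof (intro allI impI)
    fix \<epsilon> :: real assume "\<epsilon> > 0"
    then have "\<forall>\<^sub>F r in at_right 0. norm (?f r) \<le> \<epsilon> * r ^ Suc n"
      using Suc.prems(1) unfolding small_o_def by blast
    with eventually_at_right_less[of 0]
    show "\<forall>\<^sub>F r in at_right 0. norm (\<Sum>m<Suc n. c (Suc m) * r ^ m) \<le> \<epsilon> * r ^ n"
    proof eventually_elim
      case (elim r)
      then have "r * norm (\<Sum>m<Suc n. c (Suc m) * r ^ m) \<le> r * (\<epsilon> * r ^ n)"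
        unfolding split c0 by (simp add: abs_mult ac_simps del: sum.lessThan_Suc)
      then show ?case using elim(1) by (simp only: mult_le_cancel_left_pos)
    qed
  qed
  note IH = Suc.IH[OF this]
  show ?case
  proof (cases m)
    case (Suc m')
    then show ?thesis using IH[of m'] Suc.prems(2) by simp
  qed (simp add: c0)
qed

lemma jet_pair_small_o:
  assumes h: "0 < h" and J: "jet_pair h d q (Suc n) K f \<kappa>" and o: "\<And>x. x \<in> Rn d \<Longrightarrow> small_o n (\<lambda>r. f r x)"
    and q: "q < d" and rx: "r \<in> {0..h}" "x \<in> Rn d"
  shows "\<bar>f r x\<bar> \<le> K x * r ^ Suc n" "\<bar>\<kappa> r x\<bar> \<le> K x * r ^ Suc n"
proof -
  obtain c e where "is_jets h d q (Suc n) K f \<kappa> c e"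
    using J unfolding jet_pair_def by blast
  note c = is_jetsD[OF this]
  have c0: "c m x = 0" if x: "x \<in> Rn d" and m: "m < Suc n" for m x
  proof -
    \<comment> \<open>The Taylor remainder is of order \<open>n + 1\<close>, hence
      \<open>o(r^n)\<close>; adding \<open>f\<close> leaves the Taylor polynomial alone.\<close>
    have "small_o n (\<lambda>r. (\<Sum>m<Suc n. c m x * r ^ m) - f r x)"
    proof (rule small_o_bound[OF small_o_power_Suc])
      have "\<forall>\<^sub>F r in at_right 0. r < h"
        using h by (intro eventually_at_right_field[THEN iffD2]) auto
      with eventually_at_right_less[of 0]
      show "\<forall>\<^sub>F r in at_right 0. norm ((\<Sum>m<Suc n. c m x * r ^ m) - f r x) \<le> 1 * norm (K x * r ^ Suc n)"
      proof eventually_elim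
        case (elim r)
        then show ?case using c(2)[of r x] x by (auto simp: abs_minus_commute simp del: sum.lessThan_Suc)
      qed
    qed simp
    from small_o_add[OF this o[OF x]] have "small_o n (\<lambda>r. \<Sum>m<Suc n. c m x * r ^ m)" by simp
    then show ?thesis using small_o_polynomial m by (metis less_Suc_eq_le)
  qed
  have e0: "e m x = 0" if x: "x \<in> Rn d" and m: "m < Suc n" for m x
  proof -
    have "(\<lambda>\<xi>. c m (x + \<xi> *\<^sub>R unit_vec q)) = (\<lambda>\<xi>. 0)"
      using c0 m x q by (intro ext) auto
    then show ?thesis
      using c(1)[OF m x] vector_derivative_at[of "\<lambda>_. 0" "e m x" 0] by simp
  qed
  show "\<bar>f r x\<bar> \<le> K x * r ^ Suc n" using c(2)[OF rx] c0[OF rx(2)] by simp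
  show "\<bar>\<kappa> r x\<bar> \<le> K x * r ^ Suc n" using c(3)[OF rx] e0[OF rx(2)] by simp
qed

lemma small_o_integrate:
  fixes f :: "real \<Rightarrow> 'a::real_normed_vector"
  assumes h: "0 < h" and f': "\<And>r. r \<in> {0..h} \<Longrightarrow> (f has_vector_derivative f' r) (at r within {0..h})"
    and f0: "f 0 = 0" and o: "small_o n f'"
  shows "small_o (Suc n) f"
  unfolding small_o_def
proof (intro allI impI)
  fix \<epsilon> :: real assume \<epsilon>: "\<epsilon> > 0"
  then have "\<forall>\<^sub>F r in at_right 0. norm (f' r) \<le> \<epsilon> * r ^ n"
    using o unfolding small_o_def by blast
  then obtain \<delta> where \<delta>: "\<delta> > 0" "\<And>r. 0 < r \<Longrightarrow> r < \<delta> \<Longrightarrow> norm (f' r) \<le> \<epsilon> * r ^ n"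
    unfolding eventually_at_right_field by auto
  have cont: "continuous_on {0..h} f"
    using f' by (meson continuous_on_eq_continuous_within has_vector_derivative_continuous)
  have "norm (f r) \<le> \<epsilon> * r ^ Suc n" if r: "0 < r" "r < min \<delta> h" for r
  proof -
    have "norm (f r - f 0) \<le> \<epsilon> * r ^ n * r - \<epsilon> * r ^ n * 0"
    proof (rule differentiable_bound_general[where \<phi>'="\<lambda>_. \<epsilon> * r ^ n"])
      fix \<rho> assume \<rho>: "0 < \<rho>" "\<rho> < r"
      show "((\<lambda>\<rho>. \<epsilon> * r ^ n * \<rho>) has_vector_derivative \<epsilon> * r ^ n) (at \<rho>)"
        by (auto intro!: derivative_eq_intros)
      show "(f has_vector_derivative f' \<rho>) (at \<rho>)"
        using f'[of \<rho>] \<rho> r by (simp add: at_within_Icc_at)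
      have "norm (f' \<rho>) \<le> \<epsilon> * \<rho> ^ n" using \<delta>(2)[of \<rho>] \<rho> r by simp
      also have "\<dots> \<le> \<epsilon> * r ^ n" using \<rho> \<epsilon> by (intro mult_left_mono power_mono) auto
      finally show "norm (f' \<rho>) \<le> \<epsilon> * r ^ n" .
    qed (use r in \<open>auto intro!: continuous_intros continuous_on_subset[OF cont]\<close>)
    then show ?thesis by (simp add: f0 ac_simps)
  qed
  then show "\<forall>\<^sub>F r in at_right 0. norm (f r) \<le> \<epsilon> * r ^ Suc n"
    unfolding eventually_at_right_field using \<delta>(1) h by (intro exI[of _ "min \<delta> h"]) auto
qed

lemma nth_deriv_cong:
  assumes "\<And>r. r \<in> I \<Longrightarrow> f r = g r" "r \<in> I"
  shows "nth_deriv I k f r = nth_deriv I k g r"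
  using assms(2)
proof (induction k arbitrary: r)
  case (Suc k)
  then show ?case
    using vector_derivative_within_cong[of r I "nth_deriv I k f" "nth_deriv I k g"]
    by (simp add: nth_deriv_def)
qed (simp add: nth_deriv_def assms)

lemma nth_deriv_Suc:
  assumes "0 < h" "\<And>r. r \<in> {0..h} \<Longrightarrow> (f has_vector_derivative f' r) (at r within {0..h})" "r \<in> {0..h}"
  shows "nth_deriv {0..h} (Suc k) f r = nth_deriv {0..h} k f' r"
proof -
  have "nth_deriv {0..h} (Suc k) f r = nth_deriv {0..h} k (\<lambda>t. vector_derivative f (at t within {0..h})) r"
    unfolding nth_deriv_def funpow_Suc_right by simp
  also have "\<dots> = nth_deriv {0..h} k f' r"
    using vector_derivative_within_Icc[OF assms(1) _ assms(2)] assms(3) by (intro nth_deriv_cong) auto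
  finally show ?thesis .
qed

text \<open>\<open>rbd\<close> over the one-point set \<open>{x}\<close> serves qualitatively, as a
  certificate that \<open>n\<close> continuous derivatives exist. Without it the equations between
  \<open>nth_deriv\<close> could be equations between arbitrary values.\<close>

lemma small_o_of_nth_deriv:
  fixes f g :: "real \<Rightarrow> rvec" and x :: "'x::topological_space"
  assumes h: "0 < h" and "rbd h {x} M n A (\<lambda>r _. f r)" "rbd h {x} M' n A' (\<lambda>r _. g r)"
    and "\<And>k. k \<le> n \<Longrightarrow> nth_deriv {0..h} k f 0 = nth_deriv {0..h} k g 0"
  shows "small_o n (\<lambda>r. f r - g r)"
  using assms(2-)
proof (induction n arbitrary: A A' f g)
  case 0
  have cont: "continuous_on {0..h} f" if "rbd h {x} M 0 A (\<lambda>r _. f r)" for f :: "real \<Rightarrow> rvec" and M A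
  proof -
    have "continuous_on {0..h} (\<lambda>r. (\<lambda>(r, _). f r) (r, x))"
      by (rule continuous_on_compose2[OF rbd_cont[OF that]]) (auto intro!: continuous_intros)
    then show ?thesis by simp
  qed
  have eq: "f 0 = g 0" using "0.prems"(3)[of 0] by (simp add: nth_deriv_def)
  have "continuous_on {0..h} (\<lambda>r. f r - g r)"
    using "0.prems" by (intro continuous_intros cont)
  then have "((\<lambda>r. f r - g r) \<longlongrightarrow> f 0 - g 0) (at 0 within {0..h})"
    using h by (auto simp: continuous_on_def)
  then have lim: "((\<lambda>r. f r - g r) \<longlongrightarrow> 0) (at_right 0)"
    using h eq by (simp add: at_within_Icc_at_right)
  show ?case unfolding small_o_def
  proof (intro allI impI)
    fix \<epsilon> :: real assume "\<epsilon> > 0"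
    with lim have "\<forall>\<^sub>F r in at_right 0. dist (f r - g r) 0 < \<epsilon>" by (rule tendstoD)
    then show "\<forall>\<^sub>F r in at_right 0. norm (f r - g r) \<le> \<epsilon> * r ^ 0"
      by eventually_elim (simp add: dist_norm)
  qed
next
  case (Suc n)
  from rbd_SucE[OF Suc.prems(1)] obtain f' where
    f': "\<And>r y. r \<in> {0..h} \<Longrightarrow> y \<in> {x} \<Longrightarrow> (f has_vector_derivative f' r y) (at r within {0..h})"
    "rbd h {x} M n (\<lambda>x. A x * M x) f'" by blast
  from rbd_SucE[OF Suc.prems(2)] obtain g' where
    g': "\<And>r y. r \<in> {0..h} \<Longrightarrow> y \<in> {x} \<Longrightarrow> (g has_vector_derivative g' r y) (at r within {0..h})"
    "rbd h {x} M' n (\<lambda>x. A' x * M' x) g'" by blast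
  have "small_o n (\<lambda>r. f' r x - g' r x)"
  proof (rule Suc.IH)
    show "rbd h {x} M n (\<lambda>x. A x * M x) (\<lambda>r _. f' r x)" using f'(2) by (rule rbd_cong) simp
    show "rbd h {x} M' n (\<lambda>x. A' x * M' x) (\<lambda>r _. g' r x)" using g'(2) by (rule rbd_cong) simp
    show "nth_deriv {0..h} k (\<lambda>r. f' r x) 0 = nth_deriv {0..h} k (\<lambda>r. g' r x) 0" if "k \<le> n" for k
      using Suc.prems(3)[of "Suc k"] that h
        nth_deriv_Suc[OF h f'(1)[OF _ singletonI], of 0 k] nth_deriv_Suc[OF h g'(1)[OF _ singletonI], of 0 k] by simp
  qed
  moreover have "f 0 - g 0 = 0" using Suc.prems(3)[of 0] by (simp add: nth_deriv_def)
  ultimately show ?case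
    using has_vector_derivative_diff[OF f'(1) g'(1)] by (intro small_o_integrate[OF h]) auto
qed

section \<open>Maps close to the identity\<close>

text \<open>Serves twice: for the nonlinear map and, with \<open>DE x\<close> in place of
  \<open>f\<close>, for inverting its derivative.\<close>

lemma perturbed_identity_ex1:
  assumes f: "\<And>x. x \<in> Rn d \<Longrightarrow> f x \<in> Rn d"
    and lip: "\<And>x y. x \<in> Rn d \<Longrightarrow> y \<in> Rn d \<Longrightarrow> norm (f x - f y) \<le> 1 / 2 * norm (x - y)"
    and y: "y \<in> Rn d"
  shows "\<exists>!x. x \<in> Rn d \<and> x + f x = y"
proof -
  have "\<exists>!x. x \<in> Rn d \<and> y - f x = x"
  proof (rule Banach_fix[OF complete_Rn, of d "1 / 2" "\<lambda>x. y - f x"])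
    show "dist (y - f x) (y - f x') \<le> 1 / 2 * dist x x'" if "x \<in> Rn d" "x' \<in> Rn d" for x x'
      using lip[OF that] by (simp add: dist_norm norm_minus_commute)
  qed (use f y Rn_0 in auto)
  moreover have "y - f x = x \<longleftrightarrow> x + f x = y" for x by (auto simp: algebra_simps)
  ultimately show ?thesis by simp
qed

text \<open>The operator norm belonging to \<open>l^1\<close> is the largest \<open>l^1\<close> norm
  of a column, so bounding each partial derivative by \<open>1 / 2\<close> already makes
  \<open>E\<close> a contraction.\<close>

locale near_identity =
  fixes d :: nat and E :: "rvec \<Rightarrow> rvec" and Ex :: "nat \<Rightarrow> rvec \<Rightarrow> rvec"
  assumes E_in: "\<And>x. x \<in> Rn d \<Longrightarrow> E x \<in> Rn d"
    and E_partial: "\<And>q x. q < d \<Longrightarrow> x \<in> Rn d \<Longrightarrow> has_partial q E x (Ex q x)"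
    and Ex_cont: "\<And>q. q < d \<Longrightarrow> continuous_on (Rn d) (Ex q)"
    and Ex_le: "\<And>q x. q < d \<Longrightarrow> x \<in> Rn d \<Longrightarrow> norm (Ex q x) \<le> 1 / 2"
begin

definition F :: "rvec \<Rightarrow> rvec" where "F x = x + E x"

definition G :: "rvec \<Rightarrow> rvec" where "G = inv_into (Rn d) F"

definition DE :: "rvec \<Rightarrow> rvec \<Rightarrow> rvec" where
  "DE x v = (\<Sum>q<d. coord v q *\<^sub>R Ex q x)"

lemma Ex_in: "q < d \<Longrightarrow> x \<in> Rn d \<Longrightarrow> Ex q x \<in> Rn d"
  by (rule has_vector_derivative_in_Rn[of "-1" 1 0 "\<lambda>\<xi>. E (x + \<xi> *\<^sub>R unit_vec q)"])
    (auto intro!: E_in has_vector_derivative_at_within[OF E_partial])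

lemma DE_in: "x \<in> Rn d \<Longrightarrow> DE x v \<in> Rn d"
  unfolding DE_def by (intro Rn_sum Rn_scaleR Ex_in) auto

lemma norm_DE_le: "x \<in> Rn d \<Longrightarrow> norm (DE x v) \<le> 1 / 2 * norm v"
  unfolding DE_def using Ex_le by (intro norm_sum_coord_le) auto

lemma DE_diff: "DE x (v - w) = DE x v - DE x w"
  and DE_add: "DE x (v + w) = DE x v + DE x w"
  and DE_scaleR: "DE x (c *\<^sub>R v) = c *\<^sub>R DE x v"
  by (simp_all add: DE_def scaleR_diff_left scaleR_add_left sum_subtractf sum.distrib scaleR_sum_right)

lemma E_has_derivative: "x \<in> Rn d \<Longrightarrow> (E has_derivative DE x) (at x within Rn d)"
  unfolding DE_def[abs_def] by (rule has_derivative_partials) (auto intro: E_partial Ex_cont)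

lemma E_lipschitz:
  assumes "x \<in> Rn d" "y \<in> Rn d"
  shows "norm (E x - E y) \<le> 1 / 2 * norm (x - y)"
proof (rule differentiable_bound[OF convex_Rn E_has_derivative _ assms])
  show "onorm (DE z) \<le> 1 / 2" if "z \<in> Rn d" for z
    using norm_DE_le[OF that] by (intro onorm_bound) auto
qed

lemma F_in: "x \<in> Rn d \<Longrightarrow> F x \<in> Rn d"
  by (simp add: F_def E_in)

lemma bij_F: "bij_betw F (Rn d) (Rn d)"
proof -
  have ex1: "\<exists>!x. x \<in> Rn d \<and> F x = y" if "y \<in> Rn d" for y
    unfolding F_def by (rule perturbed_identity_ex1[OF E_in E_lipschitz that])
  then show ?thesis
    unfolding bij_betw_def inj_on_def using F_in by (auto simp: image_iff) metis+
qed

lemma G_in: "y \<in> Rn d \<Longrightarrow> G y \<in> Rn d"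
  and F_G: "y \<in> Rn d \<Longrightarrow> F (G y) = y"
  and G_F: "x \<in> Rn d \<Longrightarrow> G (F x) = x"
  using bij_F unfolding G_def
  by (auto simp: bij_betw_def inv_into_into f_inv_into_f intro: inv_into_f_f)

lemma norm_le_perturbed: "x \<in> Rn d \<Longrightarrow> norm v \<le> 2 * norm (v + DE x v)"
  using norm_DE_le[of x v] norm_triangle_ineq4[of "v + DE x v" "DE x v"] by simp

lemma G_lipschitz:
  assumes "y \<in> Rn d" "y' \<in> Rn d"
  shows "norm (G y - G y') \<le> 2 * norm (y - y')"
proof -
  have "G y - G y' = (y - y') - (E (G y) - E (G y'))"
    using F_G[OF assms(1)] F_G[OF assms(2)] by (simp add: F_def algebra_simps)
  then show ?thesis
    using E_lipschitz[OF G_in[OF assms(1)] G_in[OF assms(2)]]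
      norm_triangle_ineq4[of "y - y'" "E (G y) - E (G y')"] by simp
qed

lemma G_cont: "continuous_on (Rn d) G"
proof (rule continuous_onI)
  fix y e :: real and z assume "z \<in> Rn d" "0 < e"
  then show "\<exists>\<delta>>0. \<forall>z'\<in>Rn d. dist z' z < \<delta> \<longrightarrow> dist (G z') (G z) \<le> e"
    using G_lipschitz by (intro exI[of _ "e / 2"]) (fastforce simp: dist_norm)
qed

text \<open>The inverse of \<open>id + DE x\<close>, preceded by the projection
  \<open>cut d\<close>, because a derivative has to be a bounded linear map on the whole type and
  not only on \<open>Rn d\<close>.\<close>

definition H :: "rvec \<Rightarrow> rvec \<Rightarrow> rvec" where
  "H x w = (THE v. v \<in> Rn d \<and> v + DE x v = cut d w)"

lemma DE_ex1: "x \<in> Rn d \<Longrightarrow> \<exists>!v. v \<in> Rn d \<and> v + DE x v = cut d w"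
  by (rule perturbed_identity_ex1) (use norm_DE_le[of x] cut_in_Rn in \<open>auto simp: DE_in simp flip: DE_diff\<close>)

lemma H_in: "x \<in> Rn d \<Longrightarrow> H x w \<in> Rn d"
  and H_eq: "x \<in> Rn d \<Longrightarrow> H x w + DE x (H x w) = cut d w"
  unfolding H_def using theI'[OF DE_ex1] by blast+

lemma H_unique: "x \<in> Rn d \<Longrightarrow> v \<in> Rn d \<Longrightarrow> v + DE x v = cut d w \<Longrightarrow> H x w = v"
  unfolding H_def using DE_ex1 by (intro the1_equality) auto

lemma norm_H_le: "x \<in> Rn d \<Longrightarrow> norm (H x w) \<le> 2 * norm w"
  using norm_le_perturbed[of x "H x w"] norm_cut_le[of d w] H_eq[of x w] by simp

lemma cut_add: "cut d (v + w) = cut d v + cut d w"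
  and cut_scaleR: "cut d (c *\<^sub>R v) = c *\<^sub>R cut d v"
  by (simp_all add: cut_def scaleR_add_left sum.distrib scaleR_sum_right)

lemma bounded_linear_H:
  assumes x: "x \<in> Rn d"
  shows "bounded_linear (H x)"
proof (rule bounded_linear_intro)
  note H = H_in[OF x] H_eq[OF x]
  show "H x (v + w) = H x v + H x w" for v w
    by (rule H_unique[OF x]) (use H(1) H(2)[of v, symmetric] H(2)[of w, symmetric] in \<open>auto simp: cut_add DE_add\<close>)
  show "H x (c *\<^sub>R v) = c *\<^sub>R H x v" for c v
    by (rule H_unique[OF x]) (use H(1) H(2)[of v, symmetric] in \<open>auto simp: cut_scaleR DE_scaleR scaleR_add_right\<close>)
  show "norm (H x w) \<le> norm w * 2" for w
    using norm_H_le[OF x, of w] by simp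
qed

lemma G_has_derivative:
  assumes y: "y \<in> Rn d"
  shows "(G has_derivative H (G y)) (at y within Rn d)"
  unfolding has_derivative_within_alt
proof (intro conjI allI impI)
  let ?x = "G y"
  have x: "?x \<in> Rn d" using y by (rule G_in)
  show "bounded_linear (H ?x)" using x by (rule bounded_linear_H)
  fix e :: real assume "e > 0"
  \<comment> \<open>Two factors \<open>2\<close> are lost below: one in inverting
    \<open>id + DE\<close>, one through the Lipschitz constant of \<open>G\<close>.\<close>
  then have "0 < e / 4" by simp
  then obtain \<delta> where \<delta>: "\<delta> > 0"
    "\<And>x'. x' \<in> Rn d \<Longrightarrow> norm (x' - ?x) < \<delta> \<Longrightarrow> norm (E x' - E ?x - DE ?x (x' - ?x)) \<le> e / 4 * norm (x' - ?x)"
    using E_has_derivative[OF x, unfolded has_derivative_within_alt] by blast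
  show "\<exists>\<delta>>0. \<forall>y'\<in>Rn d. norm (y' - y) < \<delta> \<longrightarrow> norm (G y' - G y - H ?x (y' - y)) \<le> e * norm (y' - y)"
  proof (intro exI[of _ "\<delta> / 2"] conjI ballI impI)
    fix y' assume y': "y' \<in> Rn d" and near: "norm (y' - y) < \<delta> / 2"
    let ?x' = "G y'" and ?v = "G y' - G y - H (G y) (y' - y)"
    have x': "?x' \<in> Rn d" using y' by (rule G_in)
    have xx': "norm (?x' - ?x) \<le> 2 * norm (y' - y)" using G_lipschitz[OF y' y] .
    have yE: "y' - y = (?x' - ?x) + (E ?x' - E ?x)"
      using F_G[OF y] F_G[OF y'] by (simp add: F_def algebra_simps)
    have cut: "H ?x (y' - y) + DE ?x (H ?x (y' - y)) = y' - y"
      using H_eq[OF x, of "y' - y"] cut_eq[of "y' - y" d] y y' by simp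
    have "?v + DE ?x ?v = (?x' - ?x) + DE ?x (?x' - ?x) - (H ?x (y' - y) + DE ?x (H ?x (y' - y)))"
      by (simp add: DE_diff)
    also have "\<dots> = (?x' - ?x) + DE ?x (?x' - ?x) - (y' - y)"
      unfolding cut ..
    also have "\<dots> = - (E ?x' - E ?x - DE ?x (?x' - ?x))"
      by (subst yE) simp
    finally have "norm ?v \<le> 2 * norm (E ?x' - E ?x - DE ?x (?x' - ?x))"
      using norm_le_perturbed[OF x, of ?v] by (simp add: norm_minus_commute)
    also have "\<dots> \<le> 2 * (e / 4 * norm (?x' - ?x))"
      using \<delta>(2)[OF x'] xx' near by simp
    also have "\<dots> \<le> 2 * (e / 4 * (2 * norm (y' - y)))"
      using xx' \<open>e > 0\<close> by (intro mult_left_mono) auto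
    finally show "norm ?v \<le> e * norm (y' - y)" by simp
  qed (use \<delta> in auto)
qed

lemma has_derivative_line:
  assumes f: "(f has_derivative f') (at y within Rn d)" and y: "y \<in> Rn d" and j: "j < d"
  shows "has_partial j f y (f' (unit_vec j))"
proof -
  interpret f': bounded_linear f' using f by (rule has_derivative_bounded_linear)
  have "((\<lambda>\<xi>. y + \<xi> *\<^sub>R unit_vec j) has_derivative (\<lambda>h. h *\<^sub>R unit_vec j)) (at 0)"
    by (auto intro!: derivative_eq_intros)
  moreover have "(f has_derivative f') (at (y + 0 *\<^sub>R unit_vec j) within (\<lambda>\<xi>. y + \<xi> *\<^sub>R unit_vec j) ` UNIV)"
    using f y j by (auto intro: has_derivative_subset)
  ultimately have "((\<lambda>\<xi>. f (y + \<xi> *\<^sub>R unit_vec j)) has_derivative (\<lambda>h. f' (h *\<^sub>R unit_vec j))) (at 0)"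
    by (rule has_derivative_in_compose)
  then show ?thesis by (simp add: has_vector_derivative_def f'.scaleR)
qed

text \<open>Resolvent argument: the difference of two values solves the linear equation at
  \<open>G z\<close>, with the difference of the two operators applied to a fixed vector as
  right-hand side. Continuity of \<open>Ex\<close> along \<open>G\<close> is then enough.\<close>

lemma H_G_cont:
  assumes j: "j < d"
  shows "continuous_on (Rn d) (\<lambda>y. H (G y) (unit_vec j))"
  unfolding continuous_on_def
proof
  fix y assume y: "y \<in> Rn d"
  let ?w = "\<lambda>y. H (G y) (unit_vec j)"
  have DE_cont: "continuous_on (Rn d) (\<lambda>z. DE (G z) (?w y))"
    unfolding DE_def using G_in
    by (intro continuous_intros continuous_on_compose2[OF Ex_cont G_cont]) auto
  have "((\<lambda>z. 2 * norm (DE (G z) (?w y) - DE (G y) (?w y))) \<longlongrightarrow> 2 * norm (DE (G y) (?w y) - DE (G y) (?w y))) (at y within Rn d)"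
    using DE_cont y unfolding continuous_on_def by (intro tendsto_intros) auto
  then have lim: "((\<lambda>z. 2 * norm (DE (G z) (?w y) - DE (G y) (?w y))) \<longlongrightarrow> 0) (at y within Rn d)" by simp
  have "norm (?w z - ?w y) \<le> 2 * norm (DE (G z) (?w y) - DE (G y) (?w y))" if z: "z \<in> Rn d" for z
  proof -
    have "(?w z - ?w y) + DE (G z) (?w z - ?w y) = (?w z + DE (G z) (?w z)) - (?w y + DE (G y) (?w y)) + DE (G y) (?w y) - DE (G z) (?w y)"
      by (simp add: DE_diff)
    also have "\<dots> = DE (G y) (?w y) - DE (G z) (?w y)"
      using H_eq[OF G_in[OF z]] H_eq[OF G_in[OF y]] by simp
    finally show ?thesis
      using norm_le_perturbed[OF G_in[OF z], of "?w z - ?w y"] by (simp add: norm_minus_commute)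
  qed
  then have "\<forall>\<^sub>F z in at y within Rn d. norm (?w z - ?w y) \<le> 2 * norm (DE (G z) (?w y) - DE (G y) (?w y))"
    by (auto simp: eventually_at intro: exI[of _ 1])
  from Lim_null_comparison[OF this lim] show "(?w \<longlongrightarrow> ?w y) (at y within Rn d)"
    by (simp add: LIM_zero_iff)
qed

lemma diffeomorphism_F: "diffeomorphism d F"
  unfolding diffeomorphism_def C1_map_def
proof (intro conjI allI impI bij_F)
  have F': "(F has_derivative (\<lambda>v. v + DE x v)) (at x within Rn d)" if "x \<in> Rn d" for x
    unfolding F_def[abs_def] using E_has_derivative[OF that] by (auto intro!: derivative_eq_intros)
  then show "F differentiable_on Rn d"
    unfolding differentiable_on_def differentiable_def by blast
  show "inv_into (Rn d) F differentiable_on Rn d"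
    using G_has_derivative unfolding differentiable_on_def differentiable_def G_def[symmetric] by blast
  fix j assume j: "j < d"
  have "partial_x j F x = unit_vec j + Ex j x" if "x \<in> Rn d" for x
    unfolding partial_x_def
    using vector_derivative_at[OF has_derivative_line[OF F'[OF that] that j]] j
    by (simp add: DE_def coord_unit_vec if_distrib[of "\<lambda>c. c *\<^sub>R _"] cong: if_cong)
  then show "continuous_on (Rn d) (partial_x j F)"
    by (intro continuous_on_eq[OF continuous_on_add[OF continuous_on_const Ex_cont[OF j]]]) simp
  have "partial_x j G y = H (G y) (unit_vec j)" if "y \<in> Rn d" for y
    unfolding partial_x_def
    using vector_derivative_at[OF has_derivative_line[OF G_has_derivative[OF that] that j]] .
  then show "continuous_on (Rn d) (partial_x j (inv_into (Rn d) F))"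
    unfolding G_def[symmetric] by (intro continuous_on_eq[OF H_G_cont[OF j]]) simp
qed

end

section \<open>Existence of the exact solution on one step\<close>

lemma continuous_on_discrete_times:
  fixes f :: "'b \<Rightarrow> real \<Rightarrow> 'a::topological_space"
  assumes "\<And>i. continuous_on UNIV (f i)"
  shows "continuous_on UNIV (\<lambda>(i, r). f (of_discrete i) r)"
proof -
  have "continuous_on (\<Union>i\<in>UNIV. {i} \<times> UNIV) (\<lambda>(i, r). f (of_discrete i) r)"
  proof (rule continuous_on_open_UN)
    show "open ({i} \<times> (UNIV :: real set))" for i :: "'b discrete"
      by (intro open_Times open_discrete open_UNIV)
    have "continuous_on ({i} \<times> UNIV) (\<lambda>z. f (of_discrete i) (snd z))" for i
      by (intro continuous_on_compose2[OF assms] continuous_intros) auto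
    then show "continuous_on ({i} \<times> UNIV) (\<lambda>(i, r). f (of_discrete i) r)" for i
      by (rule continuous_on_eq) auto
  qed
  moreover have "(\<Union>i\<in>UNIV. {i} \<times> UNIV) = (UNIV :: ('b discrete \<times> real) set)" by auto
  ultimately show ?thesis by simp
qed

context rk_field
begin

text \<open>Picard iteration as a fixed point. The type of \<open>\<real>\<^sup>d\<close>-valued functions is not complete, so a curve is represented by its
  coordinates, a bounded continuous function of (index, time).\<close>

lemma ex_solution:
  assumes h: "0 < h" and t0: "ta \<le> t0" "t0 + h \<le> tb" and small: "h * (2 * real d * L) \<le> 1 / 2" and x: "x \<in> Rn d"
  shows "\<exists>\<Phi>. \<Phi> 0 = x \<and> (\<forall>r\<in>{0..h}. \<Phi> r \<in> Rn d \<and> (\<Phi> has_vector_derivative V (t0 + r) (\<Phi> r)) (at r within {0..h}))"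
proof -
  define vec :: "((nat discrete \<times> real) \<Rightarrow>\<^sub>C real) \<Rightarrow> real \<Rightarrow> rvec" where
    "vec \<phi> r = (\<Sum>l<d. apply_bcontfun \<phi> (discrete l, r) *\<^sub>R unit_vec l)" for \<phi> r
  define P where "P \<phi> i r = coord x i + integral {0..r} (\<lambda>u. Vc i (t0 + u) (vec \<phi> u))" for \<phi> i r
  \<comment> \<open>Bounded continuous functions live on a whole type: time is clamped to
    \<open>[0, h]\<close>, and \<open>Q\<close> sets the coordinates from \<open>d\<close> on to
    \<open>0\<close>.\<close>
  define cl where "cl r = max 0 (min h r)" for r
  define Q where "Q \<phi> = (\<lambda>(i, r). if of_discrete i < d then P \<phi> (of_discrete i) (cl r) else 0)" for \<phi>
  have cl: "cl r \<in> {0..h}" for r using h by (auto simp: cl_def)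
  have vec_in: "vec \<phi> r \<in> Rn d" for \<phi> r
    unfolding vec_def by (intro Rn_sum Rn_scaleR Rn_unit_vec) auto
  have coord_vec: "coord (vec \<phi> r) i = apply_bcontfun \<phi> (discrete i, r)" if "i < d" for \<phi> r i
    using that by (simp add: vec_def coord_unit_vec if_distrib cong: if_cong)
  have t_in: "t0 + u \<in> I" if "u \<in> {0..h}" for u using that t0 by auto
  have vec_cont: "continuous_on {0..h} (vec \<phi>)" for \<phi>
    unfolding vec_def
    by (intro continuous_intros continuous_on_compose2[OF continuous_on_apply_bcontfun[of UNIV]]) auto
  have cont: "continuous_on {0..h} (\<lambda>u. Vc i (t0 + u) (vec \<phi> u))" for \<phi> i
    by (rule continuous_on_along[OF Vc_Ck])
      (use vec_in t_in vec_cont in \<open>auto intro!: continuous_intros\<close>)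
  have P_cont: "continuous_on {0..h} (P \<phi> i)" for \<phi> i
    unfolding P_def by (intro continuous_intros indefinite_integral_continuous_1 integrable_continuous_real cont)
  have Q: "Q \<phi> \<in> bcontfun" for \<phi>
    unfolding bcontfun_def
  proof safe
    have "continuous_on UNIV (\<lambda>r. if i < d then P \<phi> i (cl r) else 0)" for i
    proof -
      have "continuous_on UNIV (\<lambda>r. P \<phi> i (cl r))"
        by (intro continuous_on_compose2[OF P_cont]) (use cl in \<open>auto simp: cl_def intro!: continuous_intros\<close>)
      then show ?thesis by (cases "i < d") auto
    qed
    then show "continuous_on UNIV (Q \<phi>)"
      unfolding Q_def by (rule continuous_on_discrete_times[where f="\<lambda>i r. if i < d then P \<phi> i (cl r) else 0"])
    have "Q \<phi> (i, r) \<in> insert 0 (\<Union>i<d. P \<phi> i ` {0..h})" for i r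
      using cl[of r] by (cases "of_discrete i < d") (auto simp: Q_def simp del: atLeastAtMost_iff)
    then have "range (Q \<phi>) \<subseteq> insert 0 (\<Union>i<d. P \<phi> i ` {0..h})"
      by auto
    moreover have "bounded (\<Union>i<d. P \<phi> i ` {0..h})"
      using compact_continuous_image[OF P_cont compact_Icc] by (auto intro: compact_imp_bounded)
    ultimately show "bounded (range (Q \<phi>))"
      using bounded_subset bounded_insert by blast
  qed
  \<comment> \<open>The \<open>l^1\<close> distance is at most \<open>d\<close> times the uniform
    distance of the coordinates. With Lipschitz constant \<open>2 * L\<close> and interval length at
    most \<open>h\<close> the factor is \<open>h * (2 * d * L)\<close>, so one Picard step already
    contracts.\<close>
  have "dist (Bcontfun (Q \<phi>)) (Bcontfun (Q \<psi>)) \<le> 1 / 2 * dist \<phi> \<psi>" for \<phi> \<psi>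
  proof (rule dist_bound)
    fix z :: "nat discrete \<times> real"
    obtain i r where z: "z = (discrete i, r)" by (metis of_discrete_inverse surj_pair)
    show "dist (apply_bcontfun (Bcontfun (Q \<phi>)) z) (apply_bcontfun (Bcontfun (Q \<psi>)) z) \<le> 1 / 2 * dist \<phi> \<psi>"
    proof (cases "i < d")
      case True
      let ?D = "\<lambda>u. Vc i (t0 + u) (vec \<phi> u) - Vc i (t0 + u) (vec \<psi> u)"
      have sub: "{0..cl r} \<subseteq> {0..h}" using cl[of r] by auto
      have le: "norm (?D u) \<le> 2 * real d * L * dist \<phi> \<psi>" if "u \<in> {0..cl r}" for u
      proof -
        have "norm (?D u) \<le> 2 * L * norm (vec \<phi> u - vec \<psi> u)"
          using coord_V_lipschitz[OF True t_in vec_in vec_in] sub that by auto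
        also have "norm (vec \<phi> u - vec \<psi> u) = (\<Sum>l<d. \<bar>apply_bcontfun \<phi> (discrete l, u) - apply_bcontfun \<psi> (discrete l, u)\<bar>)"
          by (subst norm_Rn[of _ d]) (auto simp: coord_vec vec_in)
        also have "\<dots> \<le> (\<Sum>l<d. dist \<phi> \<psi>)"
          using dist_bounded[of \<phi> _ \<psi>] by (intro sum_mono) (simp add: dist_real_def)
        finally show ?thesis using L by (simp add: ac_simps mult_left_mono)
      qed
      have "Q \<phi> z - Q \<psi> z = integral {0..cl r} ?D"
        using True integrable_continuous_real[OF continuous_on_subset[OF cont sub]]
        by (simp add: z Q_def discrete_inverse P_def integral_diff)
      also have "norm \<dots> \<le> 2 * real d * L * dist \<phi> \<psi> * (cl r - 0)"
        using cl[of r] le by (intro integral_bound continuous_intros continuous_on_subset[OF cont sub]) auto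
      also have "\<dots> \<le> 2 * real d * L * dist \<phi> \<psi> * h"
        using cl[of r] L by (intro mult_left_mono) auto
      also have "\<dots> \<le> 1 / 2 * dist \<phi> \<psi>"
        using mult_right_mono[OF small zero_le_dist[of \<phi> \<psi>]] by (simp add: ac_simps)
      finally show ?thesis by (simp add: Bcontfun_inverse[OF Q] dist_real_def)
    next
      case False
      then have "Q \<phi> z = 0" "Q \<psi> z = 0" by (simp_all add: z Q_def discrete_inverse)
      then show ?thesis by (simp add: Bcontfun_inverse[OF Q])
    qed
  qed
  then have "\<exists>!\<phi>. Bcontfun (Q \<phi>) = \<phi>"
    by (intro banach_fix_type[where c="1 / 2" and f="\<lambda>\<phi>. Bcontfun (Q \<phi>)"]) auto
  then obtain \<phi> where \<phi>: "Bcontfun (Q \<phi>) = \<phi>" by blast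
  have fix_eq: "apply_bcontfun \<phi> (discrete i, r) = P \<phi> i r" if "i < d" "r \<in> {0..h}" for i r
  proof -
    have "apply_bcontfun \<phi> (discrete i, r) = Q \<phi> (discrete i, r)"
      using Bcontfun_inverse[OF Q, of \<phi>] unfolding \<phi> by simp
    also have "\<dots> = P \<phi> i (cl r)" using that by (simp add: Q_def discrete_inverse)
    also have "cl r = r" using that by (auto simp: cl_def)
    finally show ?thesis .
  qed
  have eq: "vec \<phi> r = (\<Sum>l<d. P \<phi> l r *\<^sub>R unit_vec l)" if "r \<in> {0..h}" for r
    unfolding vec_def using that fix_eq by (intro sum.cong) auto
  have "vec \<phi> 0 = x"
    using eq[of 0] h Rn_expand[OF x] by (simp add: P_def)
  moreover have "(vec \<phi> has_vector_derivative V (t0 + r) (vec \<phi> r)) (at r within {0..h})" if r: "r \<in> {0..h}" for r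
  proof (rule has_vector_derivative_transform[OF r eq])
    have "((\<lambda>r. \<Sum>l<d. P \<phi> l r *\<^sub>R unit_vec l) has_vector_derivative
        (\<Sum>l<d. Vc l (t0 + r) (vec \<phi> r) *\<^sub>R unit_vec l)) (at r within {0..h})"
    proof (intro has_vector_derivative_sum bounded_linear.has_vector_derivative[OF bounded_linear_scaleR_left])
      show "(P \<phi> l has_vector_derivative Vc l (t0 + r) (vec \<phi> r)) (at r within {0..h})" for l
        unfolding P_def using integral_has_vector_derivative[OF cont r] by (auto intro!: derivative_eq_intros)
    qed
    then show "((\<lambda>r. \<Sum>l<d. P \<phi> l r *\<^sub>R unit_vec l) has_vector_derivative V (t0 + r) (vec \<phi> r)) (at r within {0..h})"
      using Rn_expand[OF V_in[OF t_in[OF r] vec_in], symmetric] by simp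
  qed
  ultimately show ?thesis using vec_in by blast
qed

end

section \<open>The defect of the method\<close>

lemma continuous_on_family:
  assumes "continuous_on (S \<times> X) (\<lambda>(r, x). g r x)"
  shows "r \<in> S \<Longrightarrow> continuous_on X (g r)" and "x \<in> X \<Longrightarrow> continuous_on S (\<lambda>r. g r x)"
proof -
  show "continuous_on X (g r)" if "r \<in> S"
  proof -
    have "continuous_on X (\<lambda>x. (\<lambda>(r, x). g r x) (r, x))"
      by (rule continuous_on_compose2[OF assms]) (use that in \<open>auto intro!: continuous_intros\<close>)
    then show ?thesis by simp
  qed
  show "continuous_on S (\<lambda>r. g r x)" if "x \<in> X"
  proof -
    have "continuous_on S (\<lambda>r. (\<lambda>(r, x). g r x) (r, x))"
      by (rule continuous_on_compose2[OF assms]) (use that in \<open>auto intro!: continuous_intros\<close>)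
    then show ?thesis by simp
  qed
qed

lemma continuous_on_time_const:
  assumes "continuous_on S g"
  shows "continuous_on (S \<times> X) (\<lambda>(r, x). g r)"
  unfolding case_prod_unfold by (intro continuous_on_compose2[OF assms] continuous_intros) auto

lemma ex_rbd_0:
  fixes g :: "real \<Rightarrow> 'a::real_normed_vector"
  assumes "continuous_on {0..h} g"
  shows "\<exists>A\<ge>0. rbd h X M 0 (\<lambda>_. A) (\<lambda>r _. g r)"
proof -
  have "bounded (g ` {0..h})"
    by (intro compact_imp_bounded compact_continuous_image assms compact_Icc)
  then obtain A where "\<forall>y\<in>g ` {0..h}. norm y \<le> A" unfolding bounded_iff by blast
  then show ?thesis
    using continuous_on_time_const[OF assms] by (intro exI[of _ "max 0 A"]) (auto simp: max.coboundedI2)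
qed

lemma ex_rbd_Suc:
  fixes g :: "real \<Rightarrow> 'a::real_normed_vector"
  assumes g': "\<And>r. r \<in> {0..h} \<Longrightarrow> (g has_vector_derivative g' r) (at r within {0..h})"
    and bd: "rbd h X M n (\<lambda>x. A) (\<lambda>r _. g' r)" and M: "\<And>x. x \<in> X \<Longrightarrow> 1 \<le> M x"
  shows "\<exists>A'\<ge>A. rbd h X M (Suc n) (\<lambda>_. A') (\<lambda>r _. g r)"
proof -
  have "continuous_on {0..h} g"
    using g' by (meson continuous_on_eq_continuous_within has_vector_derivative_continuous)
  then obtain A0 where A0: "0 \<le> A0" "rbd h X M 0 (\<lambda>_. A0) (\<lambda>r _. g r)" using ex_rbd_0 by blast
  have M0: "0 \<le> M x" if "x \<in> X" for x using M[OF that] by simp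
  have "rbd h X M (Suc n) (\<lambda>_. max A A0) (\<lambda>r _. g r)"
  proof (rule rbd_SucI[OF _ g'])
    show "rbd h X M 0 (\<lambda>_. max A A0) (\<lambda>r _. g r)" using A0(2) M0 by (rule_tac rbd_mono) auto
    have "A \<le> max A A0 * M x" if "x \<in> X" for x
      using mult_mono[of "max A A0" "max A A0" 1 "M x"] M[OF that] A0(1) by simp
    then show "rbd h X M n (\<lambda>x. max A A0 * M x) (\<lambda>r _. g' r)" using bd M0 by (rule_tac rbd_mono) auto
  qed
  then show ?thesis by (intro exI[of _ "max A A0"]) auto
qed

context rk_field
begin

text \<open>Bootstrap: if \<open>\<Phi>'\<close> has \<open>m\<close> derivatives, then so do the
  first derivatives of \<open>V\<close> along \<open>\<Phi>\<close>, and the chain rule gives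
  \<open>\<Phi>'\<close> one more. \<open>A\<close> may depend on everything, and \<open>{x}\<close>
  is a dummy parameter set; the result only certifies that the derivatives of \<open>\<Phi>\<close>
  in the order condition are genuine.\<close>

lemma ex_rbd_solution:
  assumes h: "0 < h" and t0: "ta \<le> t0" "t0 + h \<le> tb"
    and \<Phi>: "\<And>r. r \<in> {0..h} \<Longrightarrow> \<Phi> r \<in> Rn d"
      "\<And>r. r \<in> {0..h} \<Longrightarrow> (\<Phi> has_vector_derivative V (t0 + r) (\<Phi> r)) (at r within {0..h})"
    and m: "m \<le> Suc n"
  shows "\<exists>A\<ge>0. rbd h {x::rvec} (\<lambda>_. 1) m (\<lambda>_. A) (\<lambda>r _. V (t0 + r) (\<Phi> r))"
  using m
proof (induction m)
  case 0
  have "continuous_on {0..h} \<Phi>"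
    using \<Phi>(2) by (meson continuous_on_eq_continuous_within has_vector_derivative_continuous)
  then have "continuous_on {0..h} (\<lambda>r. V (t0 + r) (\<Phi> r))"
    using t0 \<Phi>(1) by (intro continuous_on_along[OF V_Ck]) (auto intro!: continuous_intros)
  then show ?case by (rule ex_rbd_0)
next
  case (Suc m)
  then obtain A where A: "0 \<le> A" "rbd h {x} (\<lambda>_. 1) m (\<lambda>_. A) (\<lambda>r _. V (t0 + r) (\<Phi> r))" by auto
  let ?\<psi> = "\<lambda>r. V (t0 + r) (\<Phi> r)"
  let ?D = "\<lambda>r. 1 *\<^sub>R partial_t I V (t0 + r) (\<Phi> r) + (\<Sum>q<d. coord (?\<psi> r) q *\<^sub>R partial_x q (V (t0 + r)) (\<Phi> r))"
  let ?Di = "\<lambda>i r. partial_t I (Vc i) (t0 + r) (\<Phi> r) + (\<Sum>q<d. coord (?\<psi> r) q *\<^sub>R partial_x q (Vc i (t0 + r)) (\<Phi> r))"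
  define K where "K = comp_const A m * (2 * L)"
  have K: "0 \<le> K" using comp_const_ge_1[OF A(1), of m] L by (simp add: K_def)
  have tin: "t0 + r \<in> I" if "r \<in> {0..h}" for r using that t0 by auto
  have \<Phi>_cont: "continuous_on {0..h} \<Phi>"
    using \<Phi>(2) by (meson continuous_on_eq_continuous_within has_vector_derivative_continuous)
  have D: "(?\<psi> has_vector_derivative ?D r) (at r within {0..h})" if "r \<in> {0..h}" for r
    by (rule has_derivative_V_along) (use \<Phi> tin that in \<open>auto intro!: derivative_eq_intros\<close>)
  have along: "rbd h {x} (\<lambda>_. 1) m (\<lambda>_. K) (\<lambda>r _. g (t0 + r) (\<Phi> r))"
    if g: "Ck_on I d (Suc n) g" "pd_bounded I d (Suc n) (2 * L) g" for g
  proof -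
    have "rbd h {x} (\<lambda>_. 1) m (\<lambda>_. comp_const A m * (2 * L)) (\<lambda>r y. g (t0 + r * 1) ((\<lambda>r _. \<Phi> r) r y))"
    proof (rule rbd_compose[OF tab])
      show "rbd h {x} (\<lambda>_. 1) m (\<lambda>_. A * 1) (\<lambda>r _. ?\<psi> r)" using A by simp
      show "pd_bounded I d m (2 * L) g"
        using g(2) Suc.prems by (auto simp: pd_bounded_def)
      show "Ck_on I d m g" using Ck_on_le[OF g(1)] Suc.prems by simp
    qed (use h A L \<Phi> tin continuous_on_time_const[OF \<Phi>_cont] in auto)
    then show ?thesis by (simp add: K_def)
  qed
  have Di: "rbd h {x} (\<lambda>_. 1) m (\<lambda>_. K + 2 ^ m * (K * A)) (\<lambda>r _. ?Di i r)" if i: "i < d" for i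
  proof (rule rbd_add)
    show "rbd h {x} (\<lambda>_. 1) m (\<lambda>_. 2 ^ m * (K * A)) (\<lambda>r _. \<Sum>q<d. coord (?\<psi> r) q *\<^sub>R partial_x q (Vc i (t0 + r)) (\<Phi> r))"
      using K h A(2) by (intro rbd_pair along Vc_x_Ck Vc_x_bd i) auto
  qed (intro along Vc_t_Ck Vc_t_bd i)
  have "rbd h {x} (\<lambda>_. 1) m (\<lambda>_. real d * (K + 2 ^ m * (K * A))) (\<lambda>r _. ?D r)"
  proof (rule rbd_vec)
    show "rbd h {x} (\<lambda>_. 1) m (\<lambda>_. K + 2 ^ m * (K * A)) (\<lambda>r _. coord (?D r) i)" if "i < d" for i
      by (rule rbd_cong[OF Di[OF that]]) (use \<Phi>(1) tin in \<open>simp add: coord_partial_t coord_partial_x\<close>)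
    show "?D r \<in> Rn d" if "r \<in> {0..h}" for r
      using that \<Phi>(1) tin V_in by (intro has_vector_derivative_in_Rn[OF h that _ D]) auto
  qed auto
  from ex_rbd_Suc[OF D this] obtain A' where
    "A' \<ge> real d * (K + 2 ^ m * (K * A))" "rbd h {x} (\<lambda>_. 1) (Suc m) (\<lambda>_. A') (\<lambda>r _. ?\<psi> r)" by auto
  moreover have "0 \<le> real d * (K + 2 ^ m * (K * A))" using K A(1) by simp
  ultimately show ?case using order_trans by blast
qed

end

section \<open>Taylor expansion of the defect and of its derivative in \<open>x\<close>\<close>

context rk_stages
begin

definition kdx :: "nat \<Rightarrow> nat \<Rightarrow> nat \<Rightarrow> real \<Rightarrow> rvec \<Rightarrow> real" where
  "kdx q i j r x = partial_x q (\<lambda>y. coord (kd j r y) i) x"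

text \<open>Defined as the derivative in \<open>x\<close> of the stage velocity, but its existence
  and bounds come from the time derivative of the tangent \<open>kx\<close>.\<close>

lemma kdx:
  assumes j: "j \<in> {1..Suc s}" and q: "q < d" and i: "i < d"
  shows "r \<in> J \<Longrightarrow> x \<in> Rn d \<Longrightarrow> has_partial q (\<lambda>x. coord (kd j r x) i) x (kdx q i j r x)"
    and "r \<in> J \<Longrightarrow> x \<in> Rn d \<Longrightarrow> ((\<lambda>r. coord (kx q j r x) i) has_vector_derivative kdx q i j r x) (at r within J)"
    and "rbd h (Rn d) M n (\<lambda>x. TC * L * M x) (kdx q i j)"
proof -
  from rbd_SucE[OF rbd_kx[OF j q i]] obtain \<kappa>' where
    \<kappa>': "\<And>r x. r \<in> J \<Longrightarrow> x \<in> Rn d \<Longrightarrow> ((\<lambda>r. coord (kx q j r x) i) has_vector_derivative \<kappa>' r x) (at r within J)"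
    "rbd h (Rn d) M n (\<lambda>x. TC * L * M x) \<kappa>'" by blast
  have D: "has_partial q (\<lambda>x. coord (kd j r x) i) x (\<kappa>' r x)"
    if "r \<in> J" "x \<in> Rn d" for r x
  proof (rule partial_of_time_derivative[OF h q _ \<kappa>'(1) rbd_cont[OF \<kappa>'(2)] _ that])
    show "((\<lambda>r. coord (k j r x) i) has_vector_derivative coord (kd j r x) i) (at r within J)"
      if "r \<in> J" "x \<in> Rn d" for r x
      using that by (intro has_vector_derivative_coord has_derivative_k j)
    show "has_partial q (\<lambda>x. coord (k j r x) i) x (coord (kx q j r x) i)"
      if "r \<in> J" "x \<in> Rn d" for r x
      using that by (intro has_vector_derivative_coord has_partial_k j q)
  qed
  then have eq: "kdx q i j r x = \<kappa>' r x" if "r \<in> J" "x \<in> Rn d" for r x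
    unfolding kdx_def partial_x_def using that vector_derivative_at by blast
  show "r \<in> J \<Longrightarrow> x \<in> Rn d \<Longrightarrow> has_partial q (\<lambda>x. coord (kd j r x) i) x (kdx q i j r x)"
    using D eq by simp
  show "r \<in> J \<Longrightarrow> x \<in> Rn d \<Longrightarrow> ((\<lambda>r. coord (kx q j r x) i) has_vector_derivative kdx q i j r x) (at r within J)"
    using \<kappa>'(1) eq by simp
  show "rbd h (Rn d) M n (\<lambda>x. TC * L * M x) (kdx q i j)"
    by (rule rbd_cong[OF \<kappa>'(2)]) (simp add: eq)
qed

text \<open>One \<open>L\<close> and \<open>p = n + 1\<close> factors \<open>M\<close>: of these,
  one belongs to the first time derivative and \<open>n\<close> to the order of the expansion. The
  sum covers the stages by \<open>SC\<close> and their tangents by \<open>TC\<close>.\<close>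

definition K0 :: "rvec \<Rightarrow> real" where
  "K0 x = (SC + TC) * L * M x ^ Suc n"

lemma K0_nonneg: "0 \<le> K0 x"
  unfolding K0_def using stage_const_ge_4[of "Suc s"] tangent_const_nonneg[of "Suc s"] L
  by (intro mult_nonneg_nonneg) (auto simp del: stage_const.simps tangent_const.simps)

lemma jet_kd:
  assumes "j \<in> {1..Suc s}" "q < d" "i < d"
  shows "jet_pair h d q n K0 (\<lambda>r x. coord (kd j r x) i) (kdx q i j)"
proof (rule jet_pair_of_rbd[OF h assms(2) _ rbd_kd[OF assms(1,3)] kdx(3)[OF assms] kdx(1)[OF assms]])
  show "SC * L * M x * M x ^ n \<le> K0 x" "TC * L * M x * M x ^ n \<le> K0 x" for x
    unfolding K0_def using stage_const_ge_4[of "Suc s"] tangent_const_nonneg[of "Suc s"] L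
    by (auto simp: mult.assoc simp del: stage_const.simps tangent_const.simps intro!: mult_right_mono)
qed auto

text \<open>Integrating the expansion of \<open>kd\<close> keeps the remainder \<open>K0\<close>.
  Reading the expansion off \<open>rbd_k\<close> would leave \<open>M^(n + 2)\<close> where
  \<open>L M^(n + 1)\<close> is wanted, since a stage itself is only bounded by a multiple of
  \<open>M\<close>.\<close>

lemma jet_k:
  assumes "j \<in> {1..Suc s}" "q < d" "i < d"
  shows "jet_pair h d q (Suc n) K0 (\<lambda>r x. coord (k j r x) i) (\<lambda>r x. coord (kx q j r x) i)"
  by (rule jet_pair_integrate[OF h jet_kd[OF assms] K0_nonneg _ kdx(2)[OF assms]])
    (use h assms in \<open>auto intro!: has_vector_derivative_coord has_derivative_k has_partial_k\<close>)

abbreviation "N \<equiv> Suc s"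

text \<open>The defect \<open>\<partial>\<^sub>rF\<^sub>r - V(F\<^sub>r)\<close>.\<close>

definition f :: "real \<Rightarrow> rvec \<Rightarrow> rvec" where
  "f r x = ud N r x - k N r x"

definition fx :: "nat \<Rightarrow> nat \<Rightarrow> real \<Rightarrow> rvec \<Rightarrow> real" where
  "fx q i r x = (\<Sum>l\<in>{1..<N}. a N l * (r * kdx q i l r x + coord (kx q l r x) i)) - coord (kx q N r x) i"

lemma coord_f: "coord (f r x) i = (\<Sum>l\<in>{1..<N}. a N l * (r * coord (kd l r x) i + coord (k l r x) i)) - coord (k N r x) i"
  by (simp add: f_def ud_def)

text \<open>\<open>2 s B\<close> comes from the two terms \<open>r k'\<close> and \<open>k\<close>
  of each weighted stage, \<open>1\<close> from the field at the end point.\<close>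

lemma jet_f:
  assumes q: "q < d" and i: "i < d"
  shows "jet_pair h d q (Suc n) (\<lambda>x. (2 * real s * B + 1) * K0 x) (\<lambda>r x. coord (f r x) i) (fx q i)"
proof (rule jet_pair_mono)
  have summand: "jet_pair h d q (Suc n) (\<lambda>x. \<bar>a N l\<bar> * (K0 x + K0 x))
     (\<lambda>r x. a N l * (r * coord (kd l r x) i + coord (k l r x) i)) (\<lambda>r x. a N l * (r * kdx q i l r x + coord (kx q l r x) i))"
    if "l \<in> {1..<N}" for l
    using that by (intro jet_pair_scale jet_pair_add jet_pair_times_r jet_k jet_kd q i) auto
  have "jet_pair h d q (Suc n) (\<lambda>x. (\<Sum>l\<in>{1..<N}. \<bar>a N l\<bar> * (K0 x + K0 x)) + \<bar>-1\<bar> * K0 x)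
     (\<lambda>r x. (\<Sum>l\<in>{1..<N}. a N l * (r * coord (kd l r x) i + coord (k l r x) i)) + (-1) * coord (k N r x) i)
     (\<lambda>r x. (\<Sum>l\<in>{1..<N}. a N l * (r * kdx q i l r x + coord (kx q l r x) i)) + (-1) * coord (kx q N r x) i)"
    by (rule jet_pair_add[OF jet_pair_sum[OF summand] jet_pair_scale[OF jet_k[OF _ q i]]]) auto
  then show "jet_pair h d q (Suc n) (\<lambda>x. (\<Sum>l\<in>{1..<N}. \<bar>a N l\<bar> * (K0 x + K0 x)) + K0 x) (\<lambda>r x. coord (f r x) i) (fx q i)"
    by (simp add: coord_f fx_def[abs_def])
  show "(\<Sum>l\<in>{1..<N}. \<bar>a N l\<bar> * (K0 x + K0 x)) + K0 x \<le> (2 * real s * B + 1) * K0 x" for x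
    using sum_abs_a_le[of N "K0 x + K0 x"] K0_nonneg[of x] by (simp add: algebra_simps)
qed

lemma fx:
  assumes q: "q < d" and i: "i < d" and r: "r \<in> J"
  shows "x \<in> Rn d \<Longrightarrow> has_partial q (\<lambda>x. coord (f r x) i) x (fx q i r x)"
    and "continuous_on (Rn d) (fx q i r)"
proof -
  show "has_partial q (\<lambda>x. coord (f r x) i) x (fx q i r x)" if x: "x \<in> Rn d"
    unfolding coord_f fx_def using r x q i
    by (intro has_vector_derivative_diff has_vector_derivative_sum has_vector_derivative_add kdx(1)
        bounded_linear.has_vector_derivative[OF bounded_linear_mult_right] has_vector_derivative_coord has_partial_k) auto
  have "continuous_on (Rn d) (kdx q i l r)" "continuous_on (Rn d) (\<lambda>x. coord (kx q l r x) i)" if "l \<in> {1..N}" for l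
    using continuous_on_family(1)[OF rbd_cont[OF kdx(3)[OF that q i]] r]
      continuous_on_family(1)[OF rbd_cont[OF rbd_kx[OF that q i]] r] by auto
  then show "continuous_on (Rn d) (fx q i r)"
    unfolding fx_def[abs_def]
    by (intro continuous_on_diff continuous_on_sum continuous_on_mult continuous_on_add continuous_on_const) auto
qed

end

text \<open>The outer \<open>2\<close> bounds the derivative of the inverse map,
  \<open>2 ^ Suc n\<close> compares \<open>M\<close> at the preimage with its value at the point,
  and the rest is the constant in the remainder of \<open>jet_f\<close>.\<close>

definition error_const :: "nat \<Rightarrow> nat \<Rightarrow> real \<Rightarrow> real" where
  "error_const n s B = 2 * ((2 * real s * B + 1) *
     (stage_const n s B (Suc s) +
      tangent_const n s B (comp_const (real s * B * (real (n + 2) * stage_const n s B (Suc s))) (Suc n)) (Suc s)) *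
     2 ^ Suc n)"

locale rk_method = rk_stages +
  assumes c_last: "c (Suc s) = 1"
    and order: "\<And>x \<Phi>. x \<in> Rn d \<Longrightarrow> \<Phi> 0 = x \<Longrightarrow>
      (\<And>r. r \<in> {0..h} \<Longrightarrow> \<Phi> r \<in> Rn d \<and> (\<Phi> has_vector_derivative V (t0 + r) (\<Phi> r)) (at r within {0..h})) \<Longrightarrow>
      (\<And>m. m \<le> Suc n \<Longrightarrow> nth_deriv {0..h} m (\<lambda>r. x + r *\<^sub>R (\<Sum>l\<in>{1..s}. a (Suc s) l *\<^sub>R rk_stage V a c t0 r x l)) 0 = nth_deriv {0..h} m \<Phi> 0)"
begin

lemma N_in: "N \<in> {1..N}" by simp

lemma k_N: "k N r x = V (t0 + r) (u N r x)"
  by (simp add: k_eq c_last)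

text \<open>Insert \<open>V (t0 + r) (\<Phi> r) = \<Phi>' r\<close>. The difference of velocities is
  \<open>o(r^n)\<close> because derivatives \<open>1\<close> to \<open>n + 1\<close> of the two
  curves agree at \<open>0\<close>; the difference of the fields is \<open>o(r^n)\<close> by the
  Lipschitz bound, because derivatives \<open>0\<close> to \<open>n\<close> agree.\<close>

lemma small_o_f:
  assumes x: "x \<in> Rn d" and i: "i < d"
  shows "small_o n (\<lambda>r. coord (f r x) i)"
proof -
  have "h * (2 * real d * L) \<le> 1 / 2"
  proof -
    have "1 * (h * (real d * L)) \<le> (real s * B) * (h * (real d * L))"
      using sB_ge_1 h L by (intro mult_right_mono) auto
    then show ?thesis using step by (simp add: ac_simps)
  qed
  from ex_solution[OF h t0 this x] obtain \<Phi> where \<Phi>: "\<Phi> 0 = x"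
    "\<And>r. r \<in> J \<Longrightarrow> \<Phi> r \<in> Rn d" "\<And>r. r \<in> J \<Longrightarrow> (\<Phi> has_vector_derivative V (t0 + r) (\<Phi> r)) (at r within J)"
    by blast
  have nth: "nth_deriv J m (\<lambda>r. u N r x) 0 = nth_deriv J m \<Phi> 0" if "m \<le> Suc n" for m
  proof -
    have "(\<lambda>r. u N r x) = (\<lambda>r. x + r *\<^sub>R (\<Sum>l\<in>{1..s}. a (Suc s) l *\<^sub>R rk_stage V a c t0 r x l))"
      by (simp add: u_def k_def atLeastLessThanSuc_atLeastAtMost)
    moreover have "nth_deriv J m (\<lambda>r. x + r *\<^sub>R (\<Sum>l\<in>{1..s}. a (Suc s) l *\<^sub>R rk_stage V a c t0 r x l)) 0 = nth_deriv J m \<Phi> 0"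
      by (rule order[where \<Phi>=\<Phi>, OF x \<Phi>(1) _ that]) (use \<Phi>(2,3) in blast)
    ultimately show ?thesis by simp
  qed
  obtain A where A: "rbd h {x} (\<lambda>_. 1) n (\<lambda>_. A) (\<lambda>r _. V (t0 + r) (\<Phi> r))"
    using ex_rbd_solution[OF h t0 \<Phi>(2,3), of n x] by auto
  obtain A' where A': "rbd h {x} (\<lambda>_. 1) (Suc n) (\<lambda>_. A') (\<lambda>r _. \<Phi> r)"
    using ex_rbd_Suc[OF \<Phi>(3) A] by auto
  have ud: "rbd h {x} M n (\<lambda>y. real s * B * (real (n + 2) * SC) * M y) (\<lambda>r _. ud N r x)"
    by (rule rbd_cong[OF rbd_subset[OF stage_deriv_u(2)[OF N_in stage_const_ge_4 stage_deriv_all]]]) (use x in auto)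
  have ud': "rbd h {x} M n (\<lambda>y. real s * B * (real (n + 2) * SC) * M x) (\<lambda>r _. ud N r x)"
    by (rule rbd_mono[OF ud]) auto
  obtain A'' where A'': "rbd h {x} M (Suc n) (\<lambda>_. A'') (\<lambda>r _. u N r x)"
    using ex_rbd_Suc[OF has_derivative_u[OF N_in _ x] ud' M_ge_1] by auto
  have o1: "small_o n (\<lambda>r. ud N r x - V (t0 + r) (\<Phi> r))"
  proof (rule small_o_of_nth_deriv[OF h ud A])
    show "nth_deriv J m (\<lambda>r. ud N r x) 0 = nth_deriv J m (\<lambda>r. V (t0 + r) (\<Phi> r)) 0" if "m \<le> n" for m
      using nth[of "Suc m"] that h
        nth_deriv_Suc[OF h has_derivative_u[OF N_in _ x], of 0 m] nth_deriv_Suc[OF h \<Phi>(3), of 0 m] by simp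
  qed
  have o2: "small_o n (\<lambda>r. \<Phi> r - u N r x)"
    by (rule small_o_of_nth_deriv[OF h rbd_SucD[OF A'] rbd_SucD[OF A'']]) (use nth in simp)
  have "small_o n (\<lambda>r. coord (ud N r x - V (t0 + r) (\<Phi> r)) i)"
    by (rule small_o_bound[OF o1, where C=1]) (auto simp: abs_coord_le_norm simp del: coord_diff)
  moreover have "small_o n (\<lambda>r. coord (V (t0 + r) (\<Phi> r)) i - coord (V (t0 + r) (u N r x)) i)"
  proof (rule small_o_bound[OF o2])
    have "\<forall>\<^sub>F r in at_right 0. r < h"
      using h by (intro eventually_at_right_field[THEN iffD2]) auto
    with eventually_at_right_less[of 0]
    show "\<forall>\<^sub>F r in at_right 0. norm (coord (V (t0 + r) (\<Phi> r)) i - coord (V (t0 + r) (u N r x)) i) \<le> 2 * L * norm (\<Phi> r - u N r x)"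
    proof eventually_elim
      case (elim r)
      then have r: "r \<in> J" by simp
      show ?case
        using coord_V_lipschitz[OF i _ \<Phi>(2)[OF r] u_in[OF N_in r x], of "t0 + r"] r t0 by auto
    qed
  qed (use L in simp)
  ultimately have "small_o n (\<lambda>r. coord (ud N r x - V (t0 + r) (\<Phi> r)) i +
      (coord (V (t0 + r) (\<Phi> r)) i - coord (V (t0 + r) (u N r x)) i))"
    by (rule small_o_add)
  then show ?thesis by (simp add: f_def k_N)
qed

lemma f_bounds:
  assumes "q < d" "i < d" "r \<in> J" "x \<in> Rn d"
  shows "\<bar>coord (f r x) i\<bar> \<le> (2 * real s * B + 1) * K0 x * r ^ Suc n"
    and "\<bar>fx q i r x\<bar> \<le> (2 * real s * B + 1) * K0 x * r ^ Suc n"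
  using jet_pair_small_o[OF h jet_f[OF assms(1,2)] small_o_f[OF _ assms(2)] assms(1,3,4)] by blast+

section \<open>The velocity field of the one-step maps\<close>

definition E :: "real \<Rightarrow> rvec \<Rightarrow> rvec" where
  "E r x = u N r x - x"

lemma near_identity: "r \<in> J \<Longrightarrow> near_identity d (E r) (\<lambda>q x. ux q N r x - unit_vec q)"
proof
  assume r: "r \<in> J"
  show "E r x \<in> Rn d" if "x \<in> Rn d" for x
    unfolding E_def using that r by (intro Rn_diff u_in) auto
  fix q assume q: "q < d"
  show "has_partial q (E r) x (ux q N r x - unit_vec q)" if "x \<in> Rn d" for x
    unfolding E_def
  proof (rule has_vector_derivative_diff[OF has_partial_u[OF N_in q r that]])
    show "((\<lambda>\<xi>. x + \<xi> *\<^sub>R unit_vec q) has_vector_derivative unit_vec q) (at 0)"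
      by (auto intro!: derivative_eq_intros)
  qed
  show "continuous_on (Rn d) (\<lambda>x. ux q N r x - unit_vec q)"
    using continuous_on_family(1)[OF continuous_ux[OF N_in q] r] by (intro continuous_intros)
  show "norm (ux q N r x - unit_vec q) \<le> 1 / 2" if "x \<in> Rn d" for x
    using norm_ux_minus_le[OF N_in q r that] .
qed

lemma F_eq: "r \<in> J \<Longrightarrow> near_identity.F (E r) = u N r"
  using near_identity.F_def[OF near_identity] by (simp add: E_def fun_eq_iff)

lemma diffeomorphism_u: "r \<in> J \<Longrightarrow> diffeomorphism d (u N r)"
  using near_identity.diffeomorphism_F[OF near_identity] F_eq by simp

abbreviation Ginv :: "real \<Rightarrow> rvec \<Rightarrow> rvec" where
  "Ginv r \<equiv> inv_into (Rn d) (u N r)"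

lemma G_eq: "r \<in> J \<Longrightarrow> near_identity.G d (E r) = Ginv r"
  using near_identity.G_def[OF near_identity] F_eq by simp

lemma Ginv:
  assumes "r \<in> J"
  shows "y \<in> Rn d \<Longrightarrow> Ginv r y \<in> Rn d" "y \<in> Rn d \<Longrightarrow> u N r (Ginv r y) = y" "x \<in> Rn d \<Longrightarrow> Ginv r (u N r x) = x"
  using near_identity.G_in[OF near_identity[OF assms]] near_identity.F_G[OF near_identity[OF assms]]
    near_identity.G_F[OF near_identity[OF assms]] by (simp_all add: F_eq[OF assms] G_eq[OF assms])

text \<open>The defect is bounded in terms of the starting point, the theorem in terms of the end
  point. A step moves a point by at most half of \<open>sqrt d + norm2 d x\<close>, so the two
  weights differ by a factor of at most \<open>2\<close>.\<close>

lemma M_Ginv_le: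
  assumes r: "r \<in> J" and y: "y \<in> Rn d"
  shows "M (Ginv r y) * r \<le> 2 * ((sqrt (real d) + norm2 d y) * sqrt (real d) * h * L)"
proof -
  let ?x = "Ginv r y"
  have "norm2 d ?x \<le> norm2 d y + norm2 d (y - ?x)"
    using norm2_add_le[of d y "(-1) *\<^sub>R (y - ?x)"] norm2_scaleR[of d "-1" "y - ?x"] by simp
  also have "norm2 d (y - ?x) \<le> (sqrt (real d) + norm2 d ?x) / 2"
    using norm2_u_le[OF N_in r Ginv(1)[OF r y]] Ginv(2)[OF r y] by simp
  finally have "norm2 d ?x \<le> norm2 d y + (sqrt (real d) + norm2 d ?x) / 2" by simp
  then have le: "sqrt (real d) + norm2 d ?x \<le> 2 * (sqrt (real d) + norm2 d y)" by argo
  have "M ?x * r \<le> (L * sqrt (real d) * (2 * (sqrt (real d) + norm2 d y))) * h"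
    unfolding M_def using le L r by (intro mult_mono mult_left_mono) auto
  then show ?thesis by (simp add: ac_simps)
qed

definition W :: "real \<Rightarrow> rvec \<Rightarrow> rvec" where
  "W r y = ud N r (Ginv r y) - V (t0 + r) y"

lemma W_eq: "r \<in> J \<Longrightarrow> y \<in> Rn d \<Longrightarrow> W r y = f r (Ginv r y)"
  by (simp add: W_def f_def k_N Ginv)

text \<open>Stated for \<open>2 * e\<close> to serve both estimates: the Jacobian needs the
  \<open>2\<close> for the derivative of the inverse map, the field itself gives it away.\<close>

lemma pointwise_le:
  assumes r: "r \<in> J" and y: "y \<in> Rn d" and e: "0 \<le> e"
    "e \<le> (2 * real s * B + 1) * K0 (Ginv r y) * r ^ Suc n"
  shows "2 * e \<le> error_const n s B * L * ((sqrt (real d) + norm2 d y) * sqrt (real d) * h * L) ^ Suc n"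
proof -
  let ?R = "(sqrt (real d) + norm2 d y) * sqrt (real d) * h * L"
  have "(M (Ginv r y) * r) ^ Suc n \<le> (2 * ?R) ^ Suc n"
    using M_Ginv_le[OF r y] r by (intro power_mono) auto
  then have "(2 * real s * B + 1) * (SC + TC) * L * (M (Ginv r y) * r) ^ Suc n \<le> (2 * real s * B + 1) * (SC + TC) * L * (2 * ?R) ^ Suc n"
    using B L stage_const_ge_4[of N] tangent_const_nonneg[of N]
    by (intro mult_left_mono mult_nonneg_nonneg) (auto simp del: stage_const.simps tangent_const.simps)
  also have "(2 * real s * B + 1) * (SC + TC) * L * (M (Ginv r y) * r) ^ Suc n = (2 * real s * B + 1) * K0 (Ginv r y) * r ^ Suc n"
    unfolding K0_def power_mult_distrib by (simp only: ac_simps)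
  finally have "e \<le> (2 * real s * B + 1) * (SC + TC) * L * (2 * ?R) ^ Suc n"
    using e(2) by linarith
  then show ?thesis unfolding error_const_def power_mult_distrib[of 2] by (simp only: ac_simps)
qed

lemma W_le:
  assumes "r \<in> J" "y \<in> Rn d"
  shows "norm_inf d (W r y) \<le> error_const n s B * L * ((sqrt (real d) + norm2 d y) * sqrt (real d) * h * L) ^ Suc n"
  unfolding norm_inf_def
proof (rule Max.boundedI)
  fix z assume "z \<in> (\<lambda>i. \<bar>coord (W r y) i\<bar>) ` {..<d}"
  then obtain i where i: "i < d" "z = \<bar>coord (W r y) i\<bar>" by auto
  have "z \<le> (2 * real s * B + 1) * K0 (Ginv r y) * r ^ Suc n"
    using f_bounds(1)[OF i(1) i(1) assms(1) Ginv(1)[OF assms]] i(2) W_eq[OF assms] by simp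
  from pointwise_le[OF assms _ this] i(2)
  show "z \<le> error_const n s B * L * ((sqrt (real d) + norm2 d y) * sqrt (real d) * h * L) ^ Suc n" by simp
qed (use d in \<open>auto simp: lessThan_empty_iff\<close>)

text \<open>Entry \<open>(i, j)\<close> of the Jacobian pairs the gradient of the
  \<open>i\<close>-th coordinate of \<open>f\<close>, in the maximum norm, with the
  \<open>j\<close>-th column of the derivative of the inverse, whose \<open>l^1\<close> norm is at
  most \<open>2\<close>. So no factor \<open>d\<close> appears.\<close>

lemma W_derivative:
  assumes r: "r \<in> J" and y: "y \<in> Rn d"
  shows "W r differentiable (at y within Rn d)"
    and "jacobian_norm_inf d (W r) y \<le> error_const n s B * L * ((sqrt (real d) + norm2 d y) * sqrt (real d) * h * L) ^ Suc n"
proof -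
  note ni = near_identity[OF r]
  let ?x = "Ginv r y" and ?H = "near_identity.H d (\<lambda>q x. ux q N r x - unit_vec q) (Ginv r y)"
  have x: "?x \<in> Rn d" by (rule Ginv(1)[OF r y])
  have G': "(Ginv r has_derivative ?H) (at y within Rn d)"
    using near_identity.G_has_derivative[OF ni y] by (simp add: G_eq[OF r])
  have Hle: "norm (?H w) \<le> 2 * norm w" for w
    using near_identity.norm_H_le[OF ni x] .
  define D where "D i v = (\<Sum>q<d. coord v q *\<^sub>R fx q i r ?x)" for i v
  have f': "((\<lambda>x. coord (f r x) i) has_derivative D i) (at ?x within Rn d)" if "i < d" for i
    unfolding D_def using that r x by (intro has_derivative_partials fx) auto
  have Wi: "((\<lambda>y. coord (W r y) i) has_derivative (\<lambda>v. D i (?H v))) (at y within Rn d)" if i: "i < d" for i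
  proof (rule has_derivative_transform[OF y])
    show "((\<lambda>y. coord (f r (Ginv r y)) i) has_derivative (\<lambda>v. D i (?H v))) (at y within Rn d)"
      using Ginv(1)[OF r] by (intro has_derivative_in_compose[OF G' has_derivative_subset[OF f'[OF i]]]) auto
  qed (simp add: W_eq[OF r])
  have W_in: "W r z \<in> Rn d" if "z \<in> Rn d" for z
  proof -
    have "ud N r (Ginv r z) \<in> Rn d"
      using has_vector_derivative_in_Rn[OF h r _ has_derivative_u[OF N_in r Ginv(1)[OF r that]]]
        u_in[OF N_in _ Ginv(1)[OF r that]] by blast
    moreover have "V (t0 + r) z \<in> Rn d" using r t0 by (intro V_in that) auto
    ultimately show ?thesis unfolding W_def by (rule Rn_diff)
  qed
  have "(W r has_derivative (\<lambda>v. \<Sum>i<d. D i (?H v) *\<^sub>R unit_vec i)) (at y within Rn d)"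
  proof (rule has_derivative_transform[OF y Rn_expand[OF W_in]])
    show "((\<lambda>z. \<Sum>i<d. coord (W r z) i *\<^sub>R unit_vec i) has_derivative (\<lambda>v. \<Sum>i<d. D i (?H v) *\<^sub>R unit_vec i)) (at y within Rn d)"
      using Wi by (intro has_derivative_sum has_derivative_scaleR_left) auto
  qed
  then show "W r differentiable (at y within Rn d)"
    unfolding differentiable_def by blast
  show "jacobian_norm_inf d (W r) y \<le> error_const n s B * L * ((sqrt (real d) + norm2 d y) * sqrt (real d) * h * L) ^ Suc n"
    unfolding jacobian_norm_inf_def
  proof (rule Max.boundedI)
    fix z assume "z \<in> (\<lambda>(i, j). \<bar>partial_x j (\<lambda>y. coord (W r y) i) y\<bar>) ` ({..<d} \<times> {..<d})"
    then obtain i j where ij: "i < d" "j < d" "z = \<bar>partial_x j (\<lambda>y. coord (W r y) i) y\<bar>" by auto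
    let ?e = "(2 * real s * B + 1) * K0 ?x * r ^ Suc n"
    have e0: "0 \<le> ?e" using K0_nonneg[of ?x] B r by simp
    have "partial_x j (\<lambda>y. coord (W r y) i) y = D i (?H (unit_vec j))"
      unfolding partial_x_def
      by (rule vector_derivative_at[OF near_identity.has_derivative_line[OF ni Wi[OF ij(1)] y ij(2)]])
    also have "norm \<dots> \<le> ?e * 2"
      unfolding D_def
      using f_bounds(2)[OF _ ij(1) r x] Hle[of "unit_vec j"] e0 by (intro norm_sum_coord_le) auto
    finally have "z \<le> 2 * ?e" using ij(3) by simp
    also have "2 * ?e \<le> error_const n s B * L * ((sqrt (real d) + norm2 d y) * sqrt (real d) * h * L) ^ Suc n"
      by (rule pointwise_le[OF r y e0]) simp
    finally show "z \<le> error_const n s B * L * ((sqrt (real d) + norm2 d y) * sqrt (real d) * h * L) ^ Suc n" .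
  qed (use d in \<open>auto simp: lessThan_empty_iff\<close>)
qed

end

section \<open>From the score and the tableau to the abstract setting\<close>

lemma jacobian_norm_inf_cong:
  assumes "\<And>y. y \<in> Rn d \<Longrightarrow> f y = g y" "x \<in> Rn d"
  shows "jacobian_norm_inf d f x = jacobian_norm_inf d g x"
proof -
  have "partial_x j (\<lambda>y. coord (f y) i) x = partial_x j (\<lambda>y. coord (g y) i) x" if "j < d" for i j
  proof -
    have "f (x + u *\<^sub>R unit_vec j) = g (x + u *\<^sub>R unit_vec j)" for u
      using assms that by (intro assms(1)) auto
    then show ?thesis by (simp add: partial_x_def)
  qed
  then show ?thesis
    unfolding jacobian_norm_inf_def by (intro arg_cong[where f=Max] image_cong) auto
qed

lemma pd_bounded_mono: "pd_bounded I d n A g \<Longrightarrow> A \<le> A' \<Longrightarrow> pd_bounded I d n A' g"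
  unfolding pd_bounded_def by (meson order_trans)

lemma rk_B_bounds:
  assumes "1 \<le> s"
  shows "1 \<le> rk_B s a b" "\<And>i j. 1 \<le> i \<Longrightarrow> i < j \<Longrightarrow> j \<le> s \<Longrightarrow> \<bar>a j i\<bar> \<le> rk_B s a b"
    "\<And>j. j \<in> {1..s} \<Longrightarrow> \<bar>b j\<bar> \<le> rk_B s a b"
proof -
  let ?A = "{\<bar>a j i\<bar> | i j. 1 \<le> i \<and> i < j \<and> j \<le> s}"
  have "?A \<subseteq> (\<lambda>(i, j). \<bar>a j i\<bar>) ` ({..s} \<times> {..s})" by force
  then have fin: "finite (insert 0 ?A)" using finite_subset by blast
  have A: "0 \<le> Max (insert 0 ?A)" "\<And>i j. 1 \<le> i \<Longrightarrow> i < j \<Longrightarrow> j \<le> s \<Longrightarrow> \<bar>a j i\<bar> \<le> Max (insert 0 ?A)"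
    using fin by (auto intro!: Max_ge)
  have b: "\<bar>b j\<bar> \<le> Max ((\<lambda>j. \<bar>b j\<bar>) ` {1..s})" if "j \<in> {1..s}" for j
    using that by (intro Max_ge) auto
  have b0: "0 \<le> Max ((\<lambda>j. \<bar>b j\<bar>) ` {1..s})"
    using order_trans[OF abs_ge_zero b[of 1]] assms by simp
  show "1 \<le> rk_B s a b" using A(1) b0 by (simp add: rk_B_def)
  show "\<bar>a j i\<bar> \<le> rk_B s a b" if "1 \<le> i" "i < j" "j \<le> s" for i j
    using A(2)[OF that] b0 by (simp add: rk_B_def)
  show "\<bar>b j\<bar> \<le> rk_B s a b" if "j \<in> {1..s}" for j
    using b[OF that] A(1) by (simp add: rk_B_def)
qed

lemma pd_bounded_id_plus:
  assumes ab: "a < b" and C: "Ck_on {a..b} d (Suc (Suc n)) g" and l: "l \<in> letters d"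
    and bd: "pd_bounded {a..b} d (Suc n) L (pd {a..b} l g)" and L: "1 \<le> L"
  shows "pd_bounded {a..b} d (Suc n) (2 * L) (pd {a..b} l (\<lambda>t x. coord x i + g t x))"
proof -
  \<comment> \<open>The first derivative of the identity part of the field.
    \<open>L + \<bar>\<delta>\<bar> \<le> 2 * L\<close>, which is the constant in
    \<open>rk_field\<close>.\<close>
  define \<delta> :: real where "\<delta> = (if l = Some i then 1 else 0)"
  have "pd {a..b} l (\<lambda>t x. coord x i + g t x) t x = \<delta> + pd {a..b} l g t x" if tx: "t \<in> {a..b}" "x \<in> Rn d" for t x
    using l
  proof (cases rule: letters_cases)
    case 1
    have "((\<lambda>u. coord x i + g u x) has_vector_derivative partial_t {a..b} g t x) (at t within {a..b})"
      using Ck_on_has_partial_t[OF C tx] by (auto intro!: derivative_eq_intros)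
    then have "partial_t {a..b} (\<lambda>t x. coord x i + g t x) t x = partial_t {a..b} g t x"
      unfolding partial_t_def[of _ "\<lambda>t x. coord x i + g t x"] by (rule vector_derivative_within_Icc[OF ab tx(1)])
    then show ?thesis using 1 by (simp add: \<delta>_def)
  next
    case (2 j)
    have "((\<lambda>u. coord (x + u *\<^sub>R unit_vec j) i) has_vector_derivative coord (unit_vec j) i) (at 0)"
      by (rule has_vector_derivative_coord) (auto intro!: derivative_eq_intros)
    from has_vector_derivative_add[OF this Ck_on_has_partial_x[OF C tx 2(2), where v=0]]
    have "partial_x j (\<lambda>x. coord x i + g t x) x = coord (unit_vec j) i + partial_x j (g t) x"
      unfolding partial_x_def[of j "\<lambda>x. coord x i + g t x"] by (intro vector_derivative_at) simp
    then show ?thesis using 2 by (auto simp: \<delta>_def coord_unit_vec)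
  qed
  moreover have "pd_bounded {a..b} d (Suc n) (2 * L) (\<lambda>t x. \<delta> + pd {a..b} l g t x)"
    by (rule pd_bounded_mono[OF pd_bounded_add_const[OF ab Ck_on_pd[OF C l] bd]]) (use L in \<open>simp add: \<delta>_def\<close>)
  ultimately show ?thesis by (auto elim!: pd_bounded_cong)
qed

text \<open>The method is explicit: a stage reads its own row and earlier rows only, so the appended
  row changes none of the original stages.\<close>

lemma rk_stage_extended:
  assumes "\<And>j l. j \<le> s \<Longrightarrow> a' j l = a j l" "\<And>j. j \<le> s \<Longrightarrow> c' j = c j" "j \<le> s"
  shows "rk_stage V a' c' t0 r x j = rk_stage V a c t0 r x j"
  using assms(3)
proof (induction j rule: less_induct)
  case (less j)
  have "(\<Sum>l\<in>{1..<j}. a' j l *\<^sub>R rk_stage V a' c' t0 r x l) = (\<Sum>l\<in>{1..<j}. a j l *\<^sub>R rk_stage V a c t0 r x l)"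
    using less assms by (intro sum.cong) auto
  then show ?case
    using less.prems assms by (subst (1 2) rk_stage.simps) simp
qed

theorem propositionD1:
  shows "\<exists>C :: nat \<Rightarrow> nat \<Rightarrow> real \<Rightarrow> real.
    \<forall>(p::nat) (\<tau>::real) (T::real) (d::nat) (score :: real \<Rightarrow> rvec \<Rightarrow> rvec) (L::real)
      (V :: real \<Rightarrow> rvec \<Rightarrow> rvec) (s::nat) a b c (B::real) (t0::real) (h::real).
      p \<ge> 1 \<longrightarrow> 0 < \<tau> \<longrightarrow> \<tau> < T \<longrightarrow> d \<ge> 1 \<longrightarrow> L \<ge> 1 \<longrightarrow>
      (\<forall>t\<in>{0..T - \<tau>}. \<forall>x\<in>Rn d. score t x \<in> Rn d) \<longrightarrow>
      (\<forall>t\<in>{0..T - \<tau>}. \<forall>x\<in>Rn d. norm2 d (score t x) \<le> L * (sqrt (real d) + norm2 d x)) \<longrightarrow>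
      Ck_on {0..T - \<tau>} d (p + 1) score \<longrightarrow>
      (\<forall>t\<in>{0..T - \<tau>}. \<forall>x\<in>Rn d. \<forall>k \<alpha>. \<forall>j<d.
         1 \<le> k + (\<Sum>i<d. \<alpha> i) \<and> k + (\<Sum>i<d. \<alpha> i) \<le> p + 1 \<longrightarrow>
         \<bar>partial_t_alpha {0..T - \<tau>} d k \<alpha> (\<lambda>t x. coord (score t x) j) t x\<bar> \<le> L) \<longrightarrow>
      V = (\<lambda>t x. x + score t x) \<longrightarrow>
      s \<ge> 1 \<longrightarrow> (\<forall>j\<in>{1..s}. 0 \<le> c j \<and> c j \<le> 1) \<longrightarrow> rk_order p s a b c \<longrightarrow>
      B = rk_B s a b \<longrightarrow>
      0 \<le> t0 \<longrightarrow> 0 < h \<longrightarrow> t0 + h \<le> T - \<tau> \<longrightarrow>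
      8 * real s * B * h * real d * L \<le> 1 \<longrightarrow>
      (\<forall>r\<in>{0..h}. diffeomorphism d (rk_map V s a b c t0 r)) \<and>
      (\<forall>Y. Y t0 \<in> Rn d \<longrightarrow> (\<forall>r\<in>{0..h}. Y (t0 + r) = rk_map V s a b c t0 r (Y t0)) \<longrightarrow>
         (\<forall>t\<in>{t0..t0 + h}.
            (Y has_vector_derivative rk_velocity V s a b c d t0 h t (Y t)) (at t within {t0..t0 + h}))) \<and>
      (\<forall>t\<in>{t0..t0 + h}. \<forall>x\<in>Rn d.
         norm_inf d (rk_velocity V s a b c d t0 h t x - V t x)
           \<le> C p s B * L * ((sqrt (real d) + norm2 d x) * sqrt (real d) * h * L) ^ p \<and>
         (\<lambda>y. rk_velocity V s a b c d t0 h t y - V t y) differentiable (at x within Rn d) \<and>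
         jacobian_norm_inf d (\<lambda>y. rk_velocity V s a b c d t0 h t y - V t y) x
           \<le> C p s B * L * ((sqrt (real d) + norm2 d x) * sqrt (real d) * h * L) ^ p)"
proof (rule exI[of _ "\<lambda>p s B. error_const (p - 1) s B"], intro allI impI, goal_cases)
  case (1 p \<tau> T d score L V s a b c B t0 h)
  note p = 1(1) and T = 1(3) and d = 1(4) and L = 1(5) and score_in = 1(6) and growth = 1(7) and Ck = 1(8)
    and bd = 1(9) and V = 1(10) and s = 1(11) and c = 1(12) and order = 1(13) and B = 1(14)
    and t0 = 1(15) and h = 1(16) and t0h = 1(17) and step = 1(18)
  obtain n where n: "p = Suc n" using p by (cases p) auto
  define a' where "a' j l = (if j = Suc s then b l else a j l)" for j l
  define c' where "c' j = (if j = Suc s then 1 else c j)" for j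
  have tab: "0 < T - \<tau>" using T by simp
  have V_Ck: "Ck_on {0..T - \<tau>} d (Suc (Suc n)) V"
    unfolding V using Ck n by (intro Ck_on_add Ck_on_id tab) simp
  have stage: "rk_stage V a' c' t0 r x j = rk_stage V a c t0 r x j" if "j \<le> s" for r x j
    by (rule rk_stage_extended[where s=s]) (use that in \<open>auto simp: a'_def c'_def\<close>)
  have map_eq: "rk_map V s a b c t0 r x = x + r *\<^sub>R (\<Sum>l\<in>{1..s}. a' (Suc s) l *\<^sub>R rk_stage V a' c' t0 r x l)" for r x
    unfolding rk_map_def by (simp add: stage a'_def)
  interpret rk_method 0 "T - \<tau>" d n V L s a' c' B t0 h
  proof unfold_locales
    show "V t x \<in> Rn d" if "t \<in> {0..T - \<tau>}" "x \<in> Rn d" for t x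
      using score_in that by (simp add: V)
    show "pd_bounded {0..T - \<tau>} d (Suc n) (2 * L) (pd {0..T - \<tau>} l (\<lambda>t x. coord (V t x) i))"
      if i: "i < d" and l: "l \<in> letters d" for i l
    proof -
      have Ci: "Ck_on {0..T - \<tau>} d (Suc (Suc n)) (\<lambda>t x. coord (score t x) i)"
        using Ck n by (intro Ck_on_bounded_linear[OF bounded_linear_coord tab]) simp
      have "pd_bounded {0..T - \<tau>} d (Suc n) L (pd {0..T - \<tau>} l (\<lambda>t x. coord (score t x) i))"
        by (rule pd_bounded_of_partial_t_alpha[OF tab Ci _ l]) (use bd i n in simp)
      then show ?thesis
        unfolding V coord_add by (rule pd_bounded_id_plus[OF tab Ci l _ L])
    qed
    show "norm2 d (V t x) \<le> 2 * L * (sqrt (real d) + norm2 d x)" if "t \<in> {0..T - \<tau>}" "x \<in> Rn d" for t x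
    proof -
      have "norm2 d (V t x) \<le> norm2 d x + L * (sqrt (real d) + norm2 d x)"
        unfolding V using growth that by (intro order_trans[OF norm2_add_le] add_left_mono) auto
      moreover have "norm2 d x \<le> L * (sqrt (real d) + norm2 d x)"
        using mult_mono[of 1 L "norm2 d x" "sqrt (real d) + norm2 d x"] L by simp
      ultimately show ?thesis by simp
    qed
    show "\<bar>a' j l\<bar> \<le> B" if "1 \<le> l" "l < j" "j \<le> Suc s" for j l
      using rk_B_bounds[OF s, where a=a and b=b] that by (auto simp: a'_def B)
    show "1 \<le> B" using rk_B_bounds(1)[OF s] by (simp add: B)
    show "c' j \<in> {0..1}" if "j \<in> {1..Suc s}" for j
      using c that by (auto simp: c'_def)
    show "nth_deriv {0..h} m (\<lambda>r. x + r *\<^sub>R (\<Sum>l\<in>{1..s}. a' (Suc s) l *\<^sub>R rk_stage V a' c' t0 r x l)) 0 = nth_deriv {0..h} m \<Phi> 0"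
      if "x \<in> Rn d" "\<Phi> 0 = x" "\<And>r. r \<in> {0..h} \<Longrightarrow> \<Phi> r \<in> Rn d \<and> (\<Phi> has_vector_derivative V (t0 + r) (\<Phi> r)) (at r within {0..h})" "m \<le> Suc n"
      for x \<Phi> m
    proof -
      have "Ck_on {t0..t0 + h} d (p + 1) V"
        using Ck_on_subinterval[of 0 t0 "t0 + h" "T - \<tau>", OF _ _ _ V_Ck] t0 h t0h n by simp
      moreover have "\<forall>t\<in>{t0..t0 + h}. \<forall>y\<in>Rn d. V t y \<in> Rn d"
        using score_in t0 t0h by (simp add: V)
      ultimately show ?thesis
        using order[unfolded rk_order_def, rule_format, of d h t0 V x \<Phi> m] d h that n unfolding map_eq by blast
    qed
  qed (use tab d L V_Ck h t0 t0h s step in \<open>auto simp: c'_def\<close>)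
  have u_eq: "rk_map V s a b c t0 r = u N r" for r
    by (rule ext) (simp add: map_eq u_def k_def atLeastLessThanSuc_atLeastAtMost)
  have velocity: "rk_velocity V s a b c d t0 h t x = ud N (t - t0) (Ginv (t - t0) x)"
    if "t \<in> {t0..t0 + h}" "x \<in> Rn d" for t x
  proof -
    have r: "t - t0 \<in> J" using that by auto
    show ?thesis
      unfolding rk_velocity_def u_eq
      by (rule vector_derivative_within_Icc[OF h r has_derivative_u[OF N_in r Ginv(1)[OF r that(2)]]])
  qed
  show ?case
  proof (intro conjI ballI allI impI)
    show "diffeomorphism d (rk_map V s a b c t0 r)" if "r \<in> {0..h}" for r
      unfolding u_eq by (rule diffeomorphism_u[OF that])
  next
    fix Y t
    assume Y: "Y t0 \<in> Rn d" "\<forall>r\<in>{0..h}. Y (t0 + r) = rk_map V s a b c t0 r (Y t0)" and t: "t \<in> {t0..t0 + h}"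
    have Y_eq: "Y t = u N (t - t0) (Y t0)" if "t \<in> {t0..t0 + h}" for t
      using Y(2)[rule_format, of "t - t0"] that by (simp add: u_eq)
    have r: "t - t0 \<in> J" using t by auto
    have "(\<lambda>t. t - t0) ` {t0..t0 + h} \<subseteq> J" by auto
    then have "((\<lambda>r. u N r (Y t0)) has_vector_derivative ud N (t - t0) (Y t0)) (at (t - t0) within (\<lambda>t. t - t0) ` {t0..t0 + h})"
      by (rule has_vector_derivative_within_subset[OF has_derivative_u[OF N_in r Y(1)]])
    moreover have "((\<lambda>t. t - t0) has_vector_derivative 1) (at t within {t0..t0 + h})"
      by (auto intro!: derivative_eq_intros)
    ultimately have "((\<lambda>r. u N r (Y t0)) \<circ> (\<lambda>t. t - t0) has_vector_derivative 1 *\<^sub>R ud N (t - t0) (Y t0)) (at t within {t0..t0 + h})"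
      by (rule vector_diff_chain_within[rotated])
    then have "((\<lambda>t. u N (t - t0) (Y t0)) has_vector_derivative ud N (t - t0) (Y t0)) (at t within {t0..t0 + h})"
      by (simp add: o_def)
    then have "(Y has_vector_derivative ud N (t - t0) (Y t0)) (at t within {t0..t0 + h})"
      by (rule has_vector_derivative_transform[OF t, rotated]) (rule Y_eq)
    \<comment> \<open>The inverse one-step map takes \<open>Y t\<close> back to \<open>Y t0\<close>,
      so the field at \<open>Y t\<close> is the velocity of this very curve.\<close>
    moreover have "rk_velocity V s a b c d t0 h t (Y t) = ud N (t - t0) (Y t0)"
      using velocity[OF t, of "Y t"] Y_eq[OF t] u_in[OF N_in r Y(1)] Ginv(3)[OF r Y(1)] by simp
    ultimately show "(Y has_vector_derivative rk_velocity V s a b c d t0 h t (Y t)) (at t within {t0..t0 + h})" by simp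
  next
    fix t x assume t: "t \<in> {t0..t0 + h}" and x: "x \<in> Rn d"
    have r: "t - t0 \<in> J" using t by auto
    have W_eq: "rk_velocity V s a b c d t0 h t y - V t y = W (t - t0) y" if "y \<in> Rn d" for y
      using velocity[OF t that] by (simp add: W_def)
    show "norm_inf d (rk_velocity V s a b c d t0 h t x - V t x)
           \<le> error_const (p - 1) s B * L * ((sqrt (real d) + norm2 d x) * sqrt (real d) * h * L) ^ p"
      using W_le[OF r x] unfolding W_eq[OF x] n diff_Suc_1 .
    show "jacobian_norm_inf d (\<lambda>y. rk_velocity V s a b c d t0 h t y - V t y) x
           \<le> error_const (p - 1) s B * L * ((sqrt (real d) + norm2 d x) * sqrt (real d) * h * L) ^ p"
      using W_derivative(2)[OF r x] jacobian_norm_inf_cong[OF W_eq x] unfolding n diff_Suc_1 by simp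
    obtain D where "(W (t - t0) has_derivative D) (at x within Rn d)"
      using W_derivative(1)[OF r x] unfolding differentiable_def by blast
    then have "((\<lambda>y. rk_velocity V s a b c d t0 h t y - V t y) has_derivative D) (at x within Rn d)"
      by (rule has_derivative_transform[OF x, rotated]) (rule W_eq)
    then show "(\<lambda>y. rk_velocity V s a b c d t0 h t y - V t y) differentiable (at x within Rn d)"
      unfolding differentiable_def by blast
  qed
qed

end
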